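(* Let $\gamma:I\to M$ be a unit speed curve in a spacelike hypersurface $M\subset\mathbb{R}^4_1$ such that $k_g(s)\neq0$, $(k_n\tau_2+k_g\tau_g)(s)\neq0$ and $k_g^2(s)>k_n^2(s)$ for any $s\in I$, and suppose $\rho\not\equiv0$. Let $(s_0,\theta_0)\in I\times\mathbb{R}$, $v_0=S_\gamma(s_0,\theta_0)$ and $c=\langle\gamma(s_0),v_0\rangle$. Then: (1) $\gamma$ and the spacelike slice surface $M\cap HP(v_0,c)$ have contact of at least order $3$ at $s_0$ if and only if $(h^T_t)_{v_0}$ has an $A_k$-singularity at $s_0$ for some $k\ge2$. Furthermore, if $\gamma$ and $M\cap HP(v_0,c)$ have contact of order exactly $3$ at $s_0$, then the hyperbolic curve $CH_\gamma$ of $\gamma$ is, at $s_0$, locally diffeomorphic to a line. (2) $\gamma$ and the spacelike slice surface $M\cap HP(v_0,c)$ have contact of order $4$ at $s_0$ if and only if $(h^T_t)_{v_0}$ has an $A_3$-singularity at $s_0$. In this case, if $\lambda_0(s_0)\neq0$, then the hyperbolic curve $CH_\gamma$ of $\gamma$ is, at $s_0$, locally diffeomorphic to the $(2,3,4)$-cusp $C(2,3,4)=\{(u^2,u^3,u^4)\mid u\in\mathbb{R}\}$.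
   Context: $\mathbb{R}^4_1$ is $\mathbb{R}^4$ with $\langle x,y\rangle=-x_0y_0+x_1y_1+x_2y_2+x_3y_3$; a nonzero vector $x$ is spacelike, lightlike or timelike if $\langle x,x\rangle$ is $>0$, $=0$ or $<0$; $\|x\|=\sqrt{|\langle x,x\rangle|}$. With $\{e_0,e_1,e_2,e_3\}$ the canonical basis, $x\wedge y\wedge z$ is the formal determinant with rows $(-e_0,e_1,e_2,e_3),x,y,z$. For $v\ne0$ and $c\in\mathbb{R}$, $HP(v,c)=\{x\in\mathbb{R}^4_1\mid\langle x,v\rangle=c\}$; $M\cap HP(v,c)$ is a spacelike slice surface if $v$ is timelike. $H^3(-1)=\{x\in\mathbb{R}^4_1\mid\langle x,x\rangle=-1\}$. $U\subset\mathbb{R}^3$ is open, $X:U\to\mathbb{R}^4_1$ is a smooth embedding all of whose nonzero tangent vectors are spacelike, $M=X(U)$ (a spacelike hypersurface), and $n$ is the unit timelike normal field along $M$ which is future directed ($\langle n,e_0\rangle<0$). $I$ is an open interval and $\gamma=X\circ\bar\gamma:I\to M$, with $\bar\gamma:I\to U$ a smooth regular curve, is parametrized by arc length ("unit speed"). Put $t=\gamma'$, $n_\gamma(s)=n(\gamma(s))$, $k_n=-\langle n_\gamma,t'\rangle$, $k_g=\|t'-k_nn_\gamma\|$ and, when $k_g\ne0$ (so $k_g>0$), $n_1=(t'-k_nn_\gamma)/k_g$, $n_2=n_\gamma\wedge t\wedge n_1$, $\tau_1=\langle n_1,n_\gamma'\rangle$, $\tau_2=\langle n_2,n_\gamma'\rangle$,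 $\tau_g=-\langle n_2',n_1\rangle$. Then $\{n_\gamma,t,n_1,n_2\}$ is a pseudo-orthonormal frame along $\gamma$ with $n_\gamma'=k_nt+\tau_1n_1+\tau_2n_2$, $t'=k_nn_\gamma+k_gn_1$, $n_1'=\tau_1n_\gamma-k_gt+\tau_gn_2$, $n_2'=\tau_2n_\gamma-\tau_gn_1$. The hyperbolic surface of $\gamma$ is $S_\gamma:I\times\mathbb{R}\to H^3(-1)$, $$S_\gamma(s,\theta)=\frac{\cosh\theta}{\sqrt{k_g^2(s)-k_n^2(s)}}\bigl(k_g(s)n_\gamma(s)+k_n(s)n_1(s)\bigr)+\sinh\theta\,n_2(s).$$ Put $\lambda_0=k_gk_n'+k_g^2\tau_1-k_n^2\tau_1-k_nk_g'$. The hyperbolic curve of $\gamma$ is $CH_\gamma(s)=S_\gamma(s,\theta(s))$, where $\tanh\theta(s)=\dfrac{\lambda_0}{(k_n\tau_2+k_g\tau_g)\sqrt{k_g^2-k_n^2}}(s)$ (defined for those $s$ for which the quotient lies in $(-1,1)$). For $v\in H^3(-1)$, $(h^T_t)_v(s)=\langle t(s),v\rangle$. The invariant $\rho$ is $$\begin{aligned}\rho=\;&(-k_gk_n''-k_gk_n\tau_2^2-2k_gk_g'\tau_1-k_g^2\tau_1'-k_g^2\tau_g\tau_2+2k_nk_n'\tau_1+k_n^2\tau_1'-k_n^2\tau_g\tau_2+k_g''k_n-k_gk_n\tau_g^2)(k_n\tau_2+k_g\tau_g)\\&+(k_gk_n'+k_g^2\tau_1-k_n^2\tau_1-k_nk_g')(2k_n'\tau_2+k_n\tau_1\tau_g+k_n\tau_2'+2k_g'\tau_g+k_g\tau_1\tau_2+k_g\tau_g').\end{aligned}$$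 A function $f$ has an $A_k$-singularity at $s_0$ if $f(s_0)=f'(s_0)=\dots=f^{(k)}(s_0)=0$ and $f^{(k+1)}(s_0)\neq0$. $\gamma$ and $M\cap HP(v_0,c)$ have contact of order $k$ at $s_0$ if $g(s)=\langle\gamma(s),v_0\rangle-c$ has an $A_k$-singularity at $s_0$; contact of at least order $3$ means contact of order $k$ for some $k\ge3$. $CH_\gamma$ is at $s_0$ locally diffeomorphic to a set $Z\subset\mathbb{R}^3$ (a line through $0$, or $C(2,3,4)$) if some local diffeomorphism from a neighbourhood of $CH_\gamma(s_0)$ in $H^3(-1)$ to a neighbourhood of $0$ in $\mathbb{R}^3$ carries the germ of the image of $CH_\gamma$ near $s_0$ to the germ of $Z$ at $0$. *)

theory Defs
  imports "HOL-Analysis.Analysis"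
begin

section \<open>Smooth maps and diffeomorphisms\<close>

text \<open>On an open subset of a Euclidean space, C^n regularity: all iterated directional derivatives
  up to order n exist, the ones of order less than n being Frechet differentiable, those of order n
  being continuous.\<close>

fun higher_differentiable_on ::
  "'a::euclidean_space set \<Rightarrow> ('a \<Rightarrow> 'b::real_normed_vector) \<Rightarrow> nat \<Rightarrow> bool" where
  "higher_differentiable_on S f 0 \<longleftrightarrow> continuous_on S f"
| "higher_differentiable_on S f (Suc n) \<longleftrightarrow>
     (\<forall>x\<in>S. f differentiable (at x)) \<and>
     (\<forall>v. higher_differentiable_on S (\<lambda>x. frechet_derivative f (at x) v) n)"

definition smooth_on :: "'a::euclidean_space set \<Rightarrow> ('a \<Rightarrow> 'b::real_normed_vector) \<Rightarrow> bool" where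
  "smooth_on S f \<longleftrightarrow> (\<forall>n. higher_differentiable_on S f n)"

text \<open>Smoothness on an arbitrary subset of a Euclidean space (such as an open piece of a
  submanifold): the map has local smooth extensions to open sets of the ambient space.\<close>

definition smooth_map_on :: "'a::euclidean_space set \<Rightarrow> ('a \<Rightarrow> 'b::real_normed_vector) \<Rightarrow> bool" where
  "smooth_map_on A f \<longleftrightarrow>
     (\<forall>x\<in>A. \<exists>V F. open V \<and> x \<in> V \<and> smooth_on V F \<and> (\<forall>y\<in>A \<inter> V. F y = f y))"

definition diffeomorphism ::
  "'a::euclidean_space set \<Rightarrow> 'b::euclidean_space set \<Rightarrow> ('a \<Rightarrow> 'b) \<Rightarrow> ('b \<Rightarrow> 'a) \<Rightarrow> bool" where
  "diffeomorphism A B f g \<longleftrightarrow>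
     homeomorphism A B f g \<and> smooth_map_on A f \<and> smooth_map_on B g"

definition smooth_embedding :: "'a::euclidean_space set \<Rightarrow> ('a \<Rightarrow> 'b::euclidean_space) \<Rightarrow> bool" where
  "smooth_embedding U X \<longleftrightarrow>
     smooth_on U X \<and> (\<forall>u\<in>U. inj (frechet_derivative X (at u))) \<and>
     (\<exists>Y. homeomorphism U (X ` U) X Y)"

definition same_germ :: "'a::topological_space \<Rightarrow> 'a set \<Rightarrow> 'a set \<Rightarrow> bool" where
  "same_germ p A B \<longleftrightarrow> (\<exists>W. open W \<and> p \<in> W \<and> A \<inter> W = B \<inter> W)"

text \<open>The curve \<open>\<alpha>\<close>, defined on \<open>D\<close> with values in the submanifold \<open>N\<close>, is at \<open>s0\<close> locally
  diffeomorphic to the set \<open>Z\<close> (at the origin). The image near \<open>s0\<close> is the image of an arbitrarily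
  small neighbourhood of the parameter \<open>s0\<close>, so far away branches of \<open>\<alpha>\<close> that return to \<open>\<alpha> s0\<close> do
  not matter.\<close>

definition curve_locally_diffeomorphic ::
  "'a::euclidean_space set \<Rightarrow> real set \<Rightarrow> (real \<Rightarrow> 'a) \<Rightarrow> real \<Rightarrow> 'b::euclidean_space set \<Rightarrow> bool" where
  "curve_locally_diffeomorphic N D \<alpha> s0 Z \<longleftrightarrow>
     s0 \<in> D \<and>
     (\<exists>V W \<Phi> \<Psi>. openin (top_of_set N) V \<and> \<alpha> s0 \<in> V \<and> open W \<and> 0 \<in> W \<and>
        diffeomorphism V W \<Phi> \<Psi> \<and> \<Phi> (\<alpha> s0) = 0 \<and>
        (\<forall>\<^sub>F \<epsilon> in at_right 0. same_germ 0 (\<Phi> ` (V \<inter> \<alpha> ` (D \<inter> ball s0 \<epsilon>))) Z))"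

definition cusp234 :: "(real ^ 3) set" where
  "cusp234 = range (\<lambda>u. vector [u ^ 2, u ^ 3, u ^ 4])"


section \<open>Lorentz-Minkowski space\<close>

text \<open>Coordinates are indexed by the four elements \<open>0, 1, 2, 3\<close> of the type \<open>4\<close>; the index \<open>0\<close> is
  the time coordinate (beware that \<open>0 = 4\<close> in this type).\<close>

definition lprod :: "real ^ 4 \<Rightarrow> real ^ 4 \<Rightarrow> real" where
  "lprod x y = - (x $ 0 * y $ 0) + x $ 1 * y $ 1 + x $ 2 * y $ 2 + x $ 3 * y $ 3"

definition lnorm :: "real ^ 4 \<Rightarrow> real" where
  "lnorm x = sqrt \<bar>lprod x x\<bar>"

definition spacelike :: "real ^ 4 \<Rightarrow> bool" where
  "spacelike x \<longleftrightarrow> x \<noteq> 0 \<and> lprod x x > 0"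

definition timelike :: "real ^ 4 \<Rightarrow> bool" where
  "timelike x \<longleftrightarrow> x \<noteq> 0 \<and> lprod x x < 0"

text \<open>The formal determinant with rows \<open>(-e0, e1, e2, e3), x, y, z\<close>: by expansion along the first
  row, the coefficient of \<open>ei\<close> is, up to the sign -1 for \<open>i = 0\<close>, the determinant in which the first
  row is the i-th unit vector.\<close>

definition lwedge :: "real ^ 4 \<Rightarrow> real ^ 4 \<Rightarrow> real ^ 4 \<Rightarrow> real ^ 4" where
  "lwedge x y z = (\<chi> i. (if i = 0 then -1 else 1) *
     det (\<chi> j. if j = 0 then axis i 1 else if j = 1 then x else if j = 2 then y else z))"

definition H3 :: "(real ^ 4) set" where
  "H3 = {x. lprod x x = -1}"

definition spacelike_hypersurface :: "(real ^ 3) set \<Rightarrow> (real ^ 3 \<Rightarrow> real ^ 4) \<Rightarrow> bool" where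
  "spacelike_hypersurface U X \<longleftrightarrow>
     open U \<and> smooth_embedding U X \<and>
     (\<forall>u\<in>U. \<forall>x\<in>range (frechet_derivative X (at u)). x \<noteq> 0 \<longrightarrow> spacelike x)"

text \<open>These conditions determine \<open>n\<close> on the image of \<open>X\<close>, and imply that \<open>n \<circ> X\<close> is smooth, when
  \<open>X\<close> parametrizes a spacelike hypersurface.\<close>

definition future_unit_normal ::
  "(real ^ 3) set \<Rightarrow> (real ^ 3 \<Rightarrow> real ^ 4) \<Rightarrow> (real ^ 4 \<Rightarrow> real ^ 4) \<Rightarrow> bool" where
  "future_unit_normal U X n \<longleftrightarrow>
     (\<forall>u\<in>U. timelike (n (X u)) \<and> lnorm (n (X u)) = 1 \<and> lprod (n (X u)) (axis 0 1) < 0 \<and>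
        (\<forall>x\<in>range (frechet_derivative X (at u)). lprod (n (X u)) x = 0))"

definition unit_speed_curve ::
  "(real ^ 3) set \<Rightarrow> (real ^ 3 \<Rightarrow> real ^ 4) \<Rightarrow> real set \<Rightarrow> (real \<Rightarrow> real ^ 3) \<Rightarrow> (real \<Rightarrow> real ^ 4) \<Rightarrow> bool" where
  "unit_speed_curve U X I \<beta> \<gamma> \<longleftrightarrow>
     smooth_on I \<beta> \<and> \<beta> ` I \<subseteq> U \<and> (\<forall>s\<in>I. vector_derivative \<beta> (at s) \<noteq> 0) \<and>
     (\<forall>s\<in>I. \<gamma> s = X (\<beta> s)) \<and> (\<forall>s\<in>I. lnorm (vector_derivative \<gamma> (at s)) = 1)"


section \<open>The moving frame and the invariants of a curve\<close>

text \<open>Throughout, \<open>n\<close> is the unit normal field of the hypersurface and \<open>\<gamma>\<close> the unit speed curve.\<close>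

definition n_gamma :: "(real ^ 4 \<Rightarrow> real ^ 4) \<Rightarrow> (real \<Rightarrow> real ^ 4) \<Rightarrow> real \<Rightarrow> real ^ 4" where
  "n_gamma n \<gamma> s = n (\<gamma> s)"

definition tangent :: "(real \<Rightarrow> real ^ 4) \<Rightarrow> real \<Rightarrow> real ^ 4" where
  "tangent \<gamma> s = vector_derivative \<gamma> (at s)"

definition kn :: "(real ^ 4 \<Rightarrow> real ^ 4) \<Rightarrow> (real \<Rightarrow> real ^ 4) \<Rightarrow> real \<Rightarrow> real" where
  "kn n \<gamma> s = - lprod (n_gamma n \<gamma> s) (vector_derivative (tangent \<gamma>) (at s))"

definition kg :: "(real ^ 4 \<Rightarrow> real ^ 4) \<Rightarrow> (real \<Rightarrow> real ^ 4) \<Rightarrow> real \<Rightarrow> real" where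
  "kg n \<gamma> s = lnorm (vector_derivative (tangent \<gamma>) (at s) - kn n \<gamma> s *\<^sub>R n_gamma n \<gamma> s)"

definition n1 :: "(real ^ 4 \<Rightarrow> real ^ 4) \<Rightarrow> (real \<Rightarrow> real ^ 4) \<Rightarrow> real \<Rightarrow> real ^ 4" where
  "n1 n \<gamma> s =
     (1 / kg n \<gamma> s) *\<^sub>R (vector_derivative (tangent \<gamma>) (at s) - kn n \<gamma> s *\<^sub>R n_gamma n \<gamma> s)"

definition n2 :: "(real ^ 4 \<Rightarrow> real ^ 4) \<Rightarrow> (real \<Rightarrow> real ^ 4) \<Rightarrow> real \<Rightarrow> real ^ 4" where
  "n2 n \<gamma> s = lwedge (n_gamma n \<gamma> s) (tangent \<gamma> s) (n1 n \<gamma> s)"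

definition tau1 :: "(real ^ 4 \<Rightarrow> real ^ 4) \<Rightarrow> (real \<Rightarrow> real ^ 4) \<Rightarrow> real \<Rightarrow> real" where
  "tau1 n \<gamma> s = lprod (n1 n \<gamma> s) (vector_derivative (n_gamma n \<gamma>) (at s))"

definition tau2 :: "(real ^ 4 \<Rightarrow> real ^ 4) \<Rightarrow> (real \<Rightarrow> real ^ 4) \<Rightarrow> real \<Rightarrow> real" where
  "tau2 n \<gamma> s = lprod (n2 n \<gamma> s) (vector_derivative (n_gamma n \<gamma>) (at s))"

definition taug :: "(real ^ 4 \<Rightarrow> real ^ 4) \<Rightarrow> (real \<Rightarrow> real ^ 4) \<Rightarrow> real \<Rightarrow> real" where
  "taug n \<gamma> s = - lprod (vector_derivative (n2 n \<gamma>) (at s)) (n1 n \<gamma> s)"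

definition lambda0 :: "(real ^ 4 \<Rightarrow> real ^ 4) \<Rightarrow> (real \<Rightarrow> real ^ 4) \<Rightarrow> real \<Rightarrow> real" where
  "lambda0 n \<gamma> s =
     kg n \<gamma> s * deriv (kn n \<gamma>) s + (kg n \<gamma> s)\<^sup>2 * tau1 n \<gamma> s
     - (kn n \<gamma> s)\<^sup>2 * tau1 n \<gamma> s - kn n \<gamma> s * deriv (kg n \<gamma>) s"

definition rho :: "(real ^ 4 \<Rightarrow> real ^ 4) \<Rightarrow> (real \<Rightarrow> real ^ 4) \<Rightarrow> real \<Rightarrow> real" where
  "rho n \<gamma> s =
    (let g = kg n \<gamma> s; g' = deriv (kg n \<gamma>) s; g'' = deriv (deriv (kg n \<gamma>)) s;
         k = kn n \<gamma> s; k' = deriv (kn n \<gamma>) s; k'' = deriv (deriv (kn n \<gamma>)) s;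
         a = tau1 n \<gamma> s; a' = deriv (tau1 n \<gamma>) s;
         b = tau2 n \<gamma> s; b' = deriv (tau2 n \<gamma>) s;
         e = taug n \<gamma> s; e' = deriv (taug n \<gamma>) s
     in (- g * k'' - g * k * b\<^sup>2 - 2 * g * g' * a - g\<^sup>2 * a' - g\<^sup>2 * e * b + 2 * k * k' * a
          + k\<^sup>2 * a' - k\<^sup>2 * e * b + g'' * k - g * k * e\<^sup>2) * (k * b + g * e)
        + (g * k' + g\<^sup>2 * a - k\<^sup>2 * a - k * g')
          * (2 * k' * b + k * a * e + k * b' + 2 * g' * e + g * a * b + g * e'))"

definition hyperbolic_surface ::
  "(real ^ 4 \<Rightarrow> real ^ 4) \<Rightarrow> (real \<Rightarrow> real ^ 4) \<Rightarrow> real \<Rightarrow> real \<Rightarrow> real ^ 4" where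
  "hyperbolic_surface n \<gamma> s \<theta> =
     (cosh \<theta> / sqrt ((kg n \<gamma> s)\<^sup>2 - (kn n \<gamma> s)\<^sup>2)) *\<^sub>R
       (kg n \<gamma> s *\<^sub>R n_gamma n \<gamma> s + kn n \<gamma> s *\<^sub>R n1 n \<gamma> s)
     + sinh \<theta> *\<^sub>R n2 n \<gamma> s"

definition tanh_theta :: "(real ^ 4 \<Rightarrow> real ^ 4) \<Rightarrow> (real \<Rightarrow> real ^ 4) \<Rightarrow> real \<Rightarrow> real" where
  "tanh_theta n \<gamma> s =
     lambda0 n \<gamma> s /
     ((kn n \<gamma> s * tau2 n \<gamma> s + kg n \<gamma> s * taug n \<gamma> s) * sqrt ((kg n \<gamma> s)\<^sup>2 - (kn n \<gamma> s)\<^sup>2))"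

text \<open>The hyperbolic curve is only defined where the prescribed value of \<open>tanh \<theta>\<close> is in (-1,1).\<close>

definition hyperbolic_curve_domain ::
  "(real ^ 4 \<Rightarrow> real ^ 4) \<Rightarrow> (real \<Rightarrow> real ^ 4) \<Rightarrow> real set \<Rightarrow> real set" where
  "hyperbolic_curve_domain n \<gamma> I = {s \<in> I. tanh_theta n \<gamma> s \<in> {-1<..<1}}"

definition hyperbolic_curve ::
  "(real ^ 4 \<Rightarrow> real ^ 4) \<Rightarrow> (real \<Rightarrow> real ^ 4) \<Rightarrow> real \<Rightarrow> real ^ 4" where
  "hyperbolic_curve n \<gamma> s = hyperbolic_surface n \<gamma> s (artanh (tanh_theta n \<gamma> s))"

definition tangential_height :: "(real \<Rightarrow> real ^ 4) \<Rightarrow> real ^ 4 \<Rightarrow> real \<Rightarrow> real" where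
  "tangential_height \<gamma> v s = lprod (tangent \<gamma> s) v"


section \<open>Singularities and contact\<close>

definition A_singularity :: "nat \<Rightarrow> (real \<Rightarrow> real) \<Rightarrow> real \<Rightarrow> bool" where
  "A_singularity k f s0 \<longleftrightarrow>
     (\<forall>i\<le>k. (deriv ^^ i) f s0 = 0) \<and> (deriv ^^ (k + 1)) f s0 \<noteq> 0"

text \<open>Contact of order \<open>k\<close> at \<open>s0\<close> of the curve \<open>\<gamma>\<close> in \<open>M\<close> with the slice surface
  \<open>M \<inter> HP(v,c)\<close>, where \<open>HP(v,c)\<close> is the hyperplane of equation \<open>\<langle>x,v\<rangle> = c\<close>; the slice is called
  spacelike when \<open>v\<close> is timelike. As \<open>\<gamma>\<close> lies in \<open>M\<close>, only the equation of the hyperplane matters.\<close>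

definition slice_contact :: "(real \<Rightarrow> real ^ 4) \<Rightarrow> real ^ 4 \<Rightarrow> real \<Rightarrow> nat \<Rightarrow> real \<Rightarrow> bool" where
  "slice_contact \<gamma> v c k s0 \<longleftrightarrow> A_singularity k (\<lambda>s. lprod (\<gamma> s) v - c) s0"

end

theory Submission
  imports Defs
begin

text \<open>Let \<open>h s = \<langle>t s, v0\<rangle>\<close>. As \<open>h\<close> is the derivative of \<open>\<langle>\<gamma>, v0\<rangle> - c\<close>, which vanishes at \<open>s0\<close>, contact of
order \<open>k + 1\<close> is the same as an \<open>A\<^sub>k\<close>-singularity of \<open>h\<close> (\<open>slice_contact_Suc_iff\<close>), so both equivalences
are immediate. The substance is the shape of the hyperbolic curve \<open>C\<close>.

Every point of the hyperbolic surface over \<open>s\<close> is unit timelike and orthogonal to \<open>t s\<close> and \<open>t' s\<close>; it is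
orthogonal to \<open>t'' s\<close> exactly when \<open>tanh \<theta>\<close> has the value that defines the hyperbolic curve
(\<open>third_derivative_orthogonal_iff\<close>). So \<open>C s\<close> is the unit timelike vector on the surface that is orthogonal
to \<open>t\<close>, \<open>t'\<close> and \<open>t''\<close>, and \<open>h'' s0 = 0\<close> means that \<open>C\<close> passes through \<open>v0\<close> at \<open>s0\<close>. The values
\<open>\<langle>C, t'''\<rangle>\<close> and \<open>\<langle>C, t''''\<rangle>\<close> at \<open>s0\<close> are then the derivatives of order 3 and 4 of \<open>h\<close>. Differentiating
the identities \<open>\<langle>C, t\<rangle> = \<langle>C, t'\<rangle> = \<langle>C, t''\<rangle> = 0\<close> along the curve relates products of \<open>C'\<close>, \<open>C''\<close>, \<open>C'''\<close> with
\<open>t\<close>, \<open>t'\<close>, \<open>t''\<close> to these values (\<open>pairing_table\<close>). If \<open>h''' s0 \<noteq> 0\<close>, then \<open>\<langle>C', t''\<rangle>\<close> and hence \<open>C'\<close> are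
nonzero at \<open>s0\<close>. If \<open>h''' s0 = 0 \<noteq> h'''' s0\<close>, then \<open>C' s0\<close> is orthogonal to \<open>t\<close>, \<open>t'\<close>, \<open>t''\<close> and \<open>C\<close>, which forces \<open>C' s0 = 0\<close>
(\<open>osculating_complement_trivial\<close>), while the table shows that \<open>C'' s0\<close> and \<open>C''' s0\<close> are independent.

It remains to recognise these germs in a chart of the hyperbolic space, where the curve becomes a curve \<open>c\<close> in
three-space. A regular curve is straightened by the inverse function theorem (\<open>regular_curve_model\<close>). For
\<open>c' 0 = 0\<close> with \<open>c'' 0\<close>, \<open>c''' 0\<close> independent, separating even and odd parts gives
\<open>c u = c 0 + u\<^sup>2 A(u\<^sup>2) + u\<^sup>3 B(u\<^sup>2)\<close> with \<open>A 0\<close>, \<open>B 0\<close> independent, and hence \<open>c\<close> is the image of the cusp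
\<open>(u\<^sup>2, u\<^sup>3, u\<^sup>4)\<close> under \<open>(x, y, z) \<mapsto> c 0 + x A x + y B x + (z - x\<^sup>2) e\<close>, a local diffeomorphism for suitable \<open>e\<close>
(\<open>cusp_curve_model\<close>). For this map to be smooth near the origin, \<open>A\<close> and \<open>B\<close> must be smooth on both sides
of 0, although the curve determines them only on nonnegative arguments: this is the theorem of Whitney on even
functions, obtained here from Borel's theorem on the existence of smooth functions with prescribed
derivatives at a point (\<open>borel_realization\<close>).\<close>

section \<open>Calculus of smooth maps\<close>

lemma higher_diff_cong:
  assumes "open S" "\<And>x. x \<in> S \<Longrightarrow> f x = g x"
  shows "higher_differentiable_on S f n \<longleftrightarrow> higher_differentiable_on S g n"
  using assms(2)
proof (induction n arbitrary: f g)
  case 0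
  then show ?case by (simp cong: continuous_on_cong)
next
  case (Suc n)
  have *: "(f has_derivative D) (at x) \<longleftrightarrow> (g has_derivative D) (at x)" if "x \<in> S" for x D
  proof
    show "(f has_derivative D) (at x) \<Longrightarrow> (g has_derivative D) (at x)"
      by (rule has_derivative_transform_within_open[OF _ assms(1) that Suc.prems])
    show "(g has_derivative D) (at x) \<Longrightarrow> (f has_derivative D) (at x)"
      by (rule has_derivative_transform_within_open[OF _ assms(1) that Suc.prems[symmetric]])
  qed
  have "frechet_derivative f (at x) = frechet_derivative g (at x)" if "x \<in> S" for x
    unfolding frechet_derivative_def using *[OF that] by presburger
  then have "higher_differentiable_on S (\<lambda>x. frechet_derivative f (at x) v) n \<longleftrightarrow>
      higher_differentiable_on S (\<lambda>x. frechet_derivative g (at x) v) n" for v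
    by (intro Suc.IH) metis
  moreover have "f differentiable (at x) \<longleftrightarrow> g differentiable (at x)" if "x \<in> S" for x
    unfolding differentiable_def using *[OF that] by presburger
  ultimately show ?case
    unfolding higher_differentiable_on.simps by metis
qed

lemma higher_diff_Suc_lower: "higher_differentiable_on S f (Suc n) \<Longrightarrow> higher_differentiable_on S f n"
proof (induction n arbitrary: f)
  case 0
  then have "f differentiable_on S"
    by (simp add: differentiable_on_def differentiable_at_withinI)
  then show ?case
    by (simp add: differentiable_imp_continuous_on)
next
  case (Suc n)
  then show ?case
    unfolding higher_differentiable_on.simps(2) by blast
qed

lemma higher_diff_subset: "higher_differentiable_on S f n \<Longrightarrow> T \<subseteq> S \<Longrightarrow> higher_differentiable_on T f n"
  by (induction n arbitrary: f) (auto intro: continuous_on_subset)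

text \<open>Stated for an explicit derivative \<open>D\<close>, so that the chosen \<open>frechet_derivative\<close> does not have to
  be evaluated.\<close>

lemma higher_diff_SucI:
  assumes "open S" "\<And>x. x \<in> S \<Longrightarrow> (f has_derivative D x) (at x)"
    and "\<And>v. higher_differentiable_on S (\<lambda>x. D x v) n"
  shows "higher_differentiable_on S f (Suc n)"
proof -
  have "frechet_derivative f (at x) = D x" if "x \<in> S" for x
    using frechet_derivative_at[OF assms(2)[OF that]] by simp
  then have "higher_differentiable_on S (\<lambda>x. frechet_derivative f (at x) v) n" for v
    using higher_diff_cong[OF assms(1), of "\<lambda>x. frechet_derivative f (at x) v" "\<lambda>x. D x v"] assms(3)
    by simp
  then show ?thesis
    using assms(2) by (auto simp: differentiable_def)
qed

lemma higher_diff_SucD: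
  assumes "higher_differentiable_on S f (Suc n)"
  shows "x \<in> S \<Longrightarrow> (f has_derivative frechet_derivative f (at x)) (at x)"
    and "higher_differentiable_on S (\<lambda>x. frechet_derivative f (at x) v) n"
  using assms by (auto simp: frechet_derivative_works)

lemma higher_diff_const: "open S \<Longrightarrow> higher_differentiable_on S (\<lambda>x. c) n"
proof (induction n arbitrary: c)
  case (Suc n)
  then show ?case by (intro higher_diff_SucI[where D = "\<lambda>_ _. 0"]) auto
qed auto

lemma higher_diff_linear:
  assumes "open S" "bounded_linear f"
  shows "higher_differentiable_on S f n"
proof (cases n)
  case 0
  then show ?thesis using assms(2) by (simp add: linear_continuous_on)
next
  case (Suc m)
  show ?thesis
    unfolding Suc
    by (intro higher_diff_SucI[OF assms(1), where D = "\<lambda>_. f"] higher_diff_const assms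
        bounded_linear_imp_has_derivative)
qed

lemma higher_diff_add:
  assumes "open S"
  shows "higher_differentiable_on S f n \<Longrightarrow> higher_differentiable_on S g n \<Longrightarrow>
    higher_differentiable_on S (\<lambda>x. f x + g x) n"
proof (induction n arbitrary: f g)
  case (Suc n)
  show ?case
    by (rule higher_diff_SucI[OF assms has_derivative_add[OF higher_diff_SucD(1)[OF Suc.prems(1)] higher_diff_SucD(1)[OF Suc.prems(2)]]])
       (auto intro!: Suc.IH higher_diff_SucD(2) Suc.prems)
qed (auto intro: continuous_on_add)

lemma higher_diff_bilinear:
  assumes "open S" "bounded_bilinear B"
  shows "higher_differentiable_on S f n \<Longrightarrow> higher_differentiable_on S g n \<Longrightarrow>
    higher_differentiable_on S (\<lambda>x. B (f x) (g x)) n"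
proof (induction n arbitrary: f g)
  case 0
  then show ?case by (simp add: bounded_bilinear.continuous_on[OF assms(2)])
next
  case (Suc n)
  show ?case
    by (rule higher_diff_SucI[OF assms(1) bounded_bilinear.FDERIV[OF assms(2) higher_diff_SucD(1)[OF Suc.prems(1)]
          higher_diff_SucD(1)[OF Suc.prems(2)]]])
       (assumption | rule higher_diff_add[OF assms(1)] Suc.IH[OF higher_diff_Suc_lower[OF Suc.prems(1)] higher_diff_SucD(2)[OF Suc.prems(2)]]
          Suc.IH[OF higher_diff_SucD(2)[OF Suc.prems(1)] higher_diff_Suc_lower[OF Suc.prems(2)]])+
qed

lemma higher_diff_sum:
  assumes "open S" "\<And>i. i \<in> A \<Longrightarrow> higher_differentiable_on S (f i) n"
  shows "higher_differentiable_on S (\<lambda>x. \<Sum>i\<in>A. f i x) n"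
  using assms(2)
  by (induction A rule: infinite_finite_induct) (auto intro!: higher_diff_const higher_diff_add assms(1))

text \<open>The chain rule writes a directional derivative of the composite as a combination of the partial
  derivatives of the outer map, with coefficients of the same regularity as the derivative of the
  inner map; hence the induction over all outer maps.\<close>

lemma higher_diff_compose:
  fixes f :: "'a::euclidean_space \<Rightarrow> 'b::euclidean_space" and g :: "'b \<Rightarrow> 'c::real_normed_vector"
  assumes "open S" "open T" "f ` S \<subseteq> T"
  shows "higher_differentiable_on S f n \<Longrightarrow> higher_differentiable_on T g n \<Longrightarrow>
    higher_differentiable_on S (\<lambda>x. g (f x)) n"
proof (induction n arbitrary: g)
  case 0
  then show ?case
    using assms(3) by (auto intro: continuous_on_compose2)
next
  case (Suc n)
  note f = higher_diff_SucD[OF Suc.prems(1)] and g = higher_diff_SucD[OF Suc.prems(2)]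
  show ?case
  proof (rule higher_diff_SucI[OF assms(1), where D = "\<lambda>x v. \<Sum>b\<in>Basis.
            (frechet_derivative f (at x) v \<bullet> b) *\<^sub>R frechet_derivative g (at (f x)) b"])
    fix x assume x: "x \<in> S"
    then have "f x \<in> T" using assms(3) by auto
    then have gd: "(g has_derivative frechet_derivative g (at (f x))) (at (f x))"
      by (rule g(1))
    then have lin: "linear (frechet_derivative g (at (f x)))"
      using has_derivative_linear by blast
    have comp: "(\<lambda>v. frechet_derivative g (at (f x)) (w v)) =
        (\<lambda>v. \<Sum>b\<in>Basis. (w v \<bullet> b) *\<^sub>R frechet_derivative g (at (f x)) b)" for w :: "'a \<Rightarrow> 'b"
      by (rule ext, subst (1) euclidean_representation[symmetric])
         (simp only: linear_sum[OF lin] linear_scale[OF lin])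
    have "((\<lambda>x. g (f x)) has_derivative
        (\<lambda>v. frechet_derivative g (at (f x)) (frechet_derivative f (at x) v))) (at x)"
      using has_derivative_compose[OF f(1)[OF x] gd] by simp
    then show "((\<lambda>x. g (f x)) has_derivative (\<lambda>v. \<Sum>b\<in>Basis.
            (frechet_derivative f (at x) v \<bullet> b) *\<^sub>R frechet_derivative g (at (f x)) b)) (at x)"
      by (simp only: comp[of "frechet_derivative f (at x)"])
  next
    fix v
    show "higher_differentiable_on S (\<lambda>x. \<Sum>b\<in>Basis.
            (frechet_derivative f (at x) v \<bullet> b) *\<^sub>R frechet_derivative g (at (f x)) b) n"
    proof (intro higher_diff_sum[OF assms(1)] higher_diff_bilinear[OF assms(1) bounded_bilinear_scaleR])
      fix b :: 'b
      show "higher_differentiable_on S (\<lambda>x. frechet_derivative g (at (f x)) b) n"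
        using Suc.IH[OF higher_diff_Suc_lower[OF Suc.prems(1)] g(2)] .
      show "higher_differentiable_on S (\<lambda>x. frechet_derivative f (at x) v \<bullet> b) n"
        by (intro higher_diff_bilinear[OF assms(1) bounded_bilinear_inner] f(2) higher_diff_const assms(1))
    qed
  qed
qed

lemma higher_diff_prod:
  fixes f :: "'i \<Rightarrow> 'a::euclidean_space \<Rightarrow> real"
  assumes "open S" "\<And>i. i \<in> A \<Longrightarrow> higher_differentiable_on S (f i) n"
  shows "higher_differentiable_on S (\<lambda>x. \<Prod>i\<in>A. f i x) n"
  using assms(2)
  by (induction A rule: infinite_finite_induct)
     (auto intro!: higher_diff_const higher_diff_bilinear[OF _ bounded_bilinear_mult] assms(1))

lemma higher_diff_det:
  fixes M :: "'a::euclidean_space \<Rightarrow> real ^ 'n ^ 'n"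
  assumes "open S" "\<And>i j. higher_differentiable_on S (\<lambda>x. M x $ i $ j) k"
  shows "higher_differentiable_on S (\<lambda>x. det (M x)) k"
  unfolding det_def
  by (intro higher_diff_sum higher_diff_prod higher_diff_const higher_diff_bilinear[OF _ bounded_bilinear_mult] assms)

lemma higher_diff_vec:
  fixes f :: "'a::euclidean_space \<Rightarrow> real ^ 'n"
  assumes "open S" "\<And>i. higher_differentiable_on S (\<lambda>x. f x $ i) k"
  shows "higher_differentiable_on S f k"
proof -
  have "higher_differentiable_on S (\<lambda>x. \<Sum>i\<in>UNIV. f x $ i *\<^sub>R (axis i 1 :: real ^ 'n)) k"
    by (intro higher_diff_sum higher_diff_bilinear[OF _ bounded_bilinear_scaleR] higher_diff_const assms)
  moreover have "(\<lambda>x. \<Sum>i\<in>UNIV. f x $ i *\<^sub>R (axis i 1 :: real ^ 'n)) = f"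
    by (simp add: fun_eq_iff vec_eq_iff axis_def if_distrib sum.delta' cong: if_cong)
  ultimately show ?thesis by metis
qed

lemma higher_diff_component:
  fixes f :: "'a::euclidean_space \<Rightarrow> real ^ 'n"
  assumes "open S" "higher_differentiable_on S f k"
  shows "higher_differentiable_on S (\<lambda>x. f x $ i) k"
  using higher_diff_bilinear[OF assms(1) bounded_bilinear_inner assms(2) higher_diff_const[OF assms(1)], of "axis i 1"]
  by (simp add: inner_axis)

lemma higher_diff_inverse: "higher_differentiable_on {x::real. x \<noteq> 0} inverse n"
proof (induction n)
  case 0
  then show ?case by (auto intro: continuous_intros)
next
  case (Suc n)
  have o: "open {x::real. x \<noteq> 0}" by (simp add: open_Collect_neq)
  show ?case
  proof (rule higher_diff_SucI[OF o])
    show "(inverse has_derivative (\<lambda>v. (- v) * (inverse x * inverse x))) (at x)"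
      if "x \<in> {x. x \<noteq> 0}" for x :: real
      using that by (auto intro!: derivative_eq_intros simp: algebra_simps)
    show "higher_differentiable_on {x. x \<noteq> 0} (\<lambda>x. (- v) * (inverse x * inverse x)) n" for v :: real
      by (intro higher_diff_bilinear[OF o bounded_bilinear_mult] higher_diff_const[OF o] Suc.IH)
  qed
qed

lemma higher_diff_sqrt: "higher_differentiable_on {x::real. x > 0} sqrt n"
proof (induction n)
  case 0
  then show ?case by (auto intro: continuous_intros)
next
  case (Suc n)
  have o: "open {x::real. x > 0}" by (simp add: open_Collect_less)
  show ?case
  proof (rule higher_diff_SucI[OF o])
    show "(sqrt has_derivative (\<lambda>v. (v / 2) * inverse (sqrt x))) (at x)"
      if "x \<in> {x. x > 0}" for x :: real
      using that by (auto intro!: derivative_eq_intros simp: field_simps)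
    show "higher_differentiable_on {x. x > 0} (\<lambda>x. (v / 2) * inverse (sqrt x)) n" for v :: real
      by (intro higher_diff_bilinear[OF o bounded_bilinear_mult] higher_diff_const[OF o]
          higher_diff_compose[OF o _ _ Suc.IH higher_diff_inverse]) (auto simp: open_Collect_neq)
  qed
qed

lemma smooth_on_cong:
  "open S \<Longrightarrow> (\<And>x. x \<in> S \<Longrightarrow> f x = g x) \<Longrightarrow> smooth_on S f \<longleftrightarrow> smooth_on S g"
  unfolding smooth_on_def using higher_diff_cong by metis

lemma smooth_on_subset: "smooth_on S f \<Longrightarrow> T \<subseteq> S \<Longrightarrow> smooth_on T f"
  unfolding smooth_on_def using higher_diff_subset by blast

lemma smooth_on_const: "open S \<Longrightarrow> smooth_on S (\<lambda>x. c)"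
  unfolding smooth_on_def using higher_diff_const by blast

lemma smooth_on_bounded_linear: "open S \<Longrightarrow> bounded_linear f \<Longrightarrow> smooth_on S f"
  unfolding smooth_on_def using higher_diff_linear by blast

lemma smooth_on_ident: "open S \<Longrightarrow> smooth_on S (\<lambda>x. x)"
  by (intro smooth_on_bounded_linear bounded_linear_ident)

lemma smooth_on_add:
  "open S \<Longrightarrow> smooth_on S f \<Longrightarrow> smooth_on S g \<Longrightarrow> smooth_on S (\<lambda>x. f x + g x)"
  unfolding smooth_on_def using higher_diff_add by blast

lemma smooth_on_bilinear:
  "open S \<Longrightarrow> bounded_bilinear B \<Longrightarrow> smooth_on S f \<Longrightarrow> smooth_on S g \<Longrightarrow> smooth_on S (\<lambda>x. B (f x) (g x))"
  unfolding smooth_on_def using higher_diff_bilinear by blast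

lemmas smooth_on_mult = smooth_on_bilinear[OF _ bounded_bilinear_mult]
  and smooth_on_scaleR = smooth_on_bilinear[OF _ bounded_bilinear_scaleR]

lemma smooth_on_uminus:
  assumes "open S" "smooth_on S f" shows "smooth_on S (\<lambda>x. - f x)"
  using smooth_on_scaleR[OF assms(1) smooth_on_const[OF assms(1)] assms(2), of "-1"] by simp

lemma smooth_on_diff:
  "open S \<Longrightarrow> smooth_on S f \<Longrightarrow> smooth_on S g \<Longrightarrow> smooth_on S (\<lambda>x. f x - g x)"
  using smooth_on_add[of S f "\<lambda>x. - g x"] smooth_on_uminus[of S g] by simp

lemma smooth_on_sum:
  "open S \<Longrightarrow> (\<And>i. i \<in> A \<Longrightarrow> smooth_on S (f i)) \<Longrightarrow> smooth_on S (\<lambda>x. \<Sum>i\<in>A. f i x)"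
  unfolding smooth_on_def using higher_diff_sum by metis

lemma smooth_on_power:
  fixes f :: "'a::euclidean_space \<Rightarrow> real"
  assumes "open S" "smooth_on S f" shows "smooth_on S (\<lambda>x. f x ^ k)"
  using assms(2) higher_diff_prod[OF assms(1), of "{..<k}" "\<lambda>_. f"] by (simp add: smooth_on_def)

lemma smooth_on_compose:
  fixes f :: "'a::euclidean_space \<Rightarrow> 'b::euclidean_space" and g :: "'b \<Rightarrow> 'c::real_normed_vector"
  shows "open S \<Longrightarrow> open T \<Longrightarrow> smooth_on S f \<Longrightarrow> smooth_on T g \<Longrightarrow> f ` S \<subseteq> T \<Longrightarrow>
    smooth_on S (\<lambda>x. g (f x))"
  unfolding smooth_on_def using higher_diff_compose by blast

lemma smooth_on_inverse:
  fixes f :: "'a::euclidean_space \<Rightarrow> real"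
  assumes "open S" "smooth_on S f" "\<And>x. x \<in> S \<Longrightarrow> f x \<noteq> 0"
  shows "smooth_on S (\<lambda>x. inverse (f x))"
  by (rule smooth_on_compose[OF assms(1) _ assms(2), where T = "{x. x \<noteq> 0}"])
     (use assms(3) higher_diff_inverse in \<open>auto simp: smooth_on_def open_Collect_neq\<close>)

lemma smooth_on_divide:
  fixes f g :: "'a::euclidean_space \<Rightarrow> real"
  shows "open S \<Longrightarrow> smooth_on S f \<Longrightarrow> smooth_on S g \<Longrightarrow> (\<And>x. x \<in> S \<Longrightarrow> g x \<noteq> 0) \<Longrightarrow>
    smooth_on S (\<lambda>x. f x / g x)"
  unfolding divide_inverse by (intro smooth_on_mult smooth_on_inverse)

lemma smooth_on_sqrt:
  fixes f :: "'a::euclidean_space \<Rightarrow> real"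
  assumes "open S" "smooth_on S f" "\<And>x. x \<in> S \<Longrightarrow> f x > 0"
  shows "smooth_on S (\<lambda>x. sqrt (f x))"
  by (rule smooth_on_compose[OF assms(1) _ assms(2), where T = "{x. x > 0}"])
     (use assms(3) higher_diff_sqrt in \<open>auto simp: smooth_on_def open_Collect_less\<close>)

lemma smooth_on_component:
  fixes f :: "'a::euclidean_space \<Rightarrow> real ^ 'n"
  shows "open S \<Longrightarrow> smooth_on S f \<Longrightarrow> smooth_on S (\<lambda>x. f x $ i)"
  unfolding smooth_on_def using higher_diff_component by blast

lemma smooth_on_vec:
  fixes f :: "'a::euclidean_space \<Rightarrow> real ^ 'n"
  shows "open S \<Longrightarrow> (\<And>i. smooth_on S (\<lambda>x. f x $ i)) \<Longrightarrow> smooth_on S f"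
  unfolding smooth_on_def using higher_diff_vec by blast

lemma smooth_on_frechet:
  "smooth_on S f \<Longrightarrow> smooth_on S (\<lambda>x. frechet_derivative f (at x) v)"
  unfolding smooth_on_def by (metis higher_diff_SucD(2))

lemma smooth_on_has_derivative:
  "smooth_on S f \<Longrightarrow> x \<in> S \<Longrightarrow> (f has_derivative frechet_derivative f (at x)) (at x)"
  unfolding smooth_on_def by (metis higher_diff_SucD(1))

lemma smooth_on_continuous: "smooth_on S f \<Longrightarrow> continuous_on S f"
  unfolding smooth_on_def by (metis higher_differentiable_on.simps(1))

lemma smooth_on_has_vector_derivative:
  fixes f :: "real \<Rightarrow> 'b::real_normed_vector"
  shows "smooth_on S f \<Longrightarrow> x \<in> S \<Longrightarrow> (f has_vector_derivative vector_derivative f (at x)) (at x)"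
  using smooth_on_has_derivative vector_derivative_works differentiableI by blast

lemma smooth_on_vector_derivative:
  fixes f :: "real \<Rightarrow> 'b::real_normed_vector"
  assumes "open S" "smooth_on S f" shows "smooth_on S (\<lambda>x. vector_derivative f (at x))"
proof -
  have "frechet_derivative f (at x) 1 = vector_derivative f (at x)" if "x \<in> S" for x
    using fun_cong[OF frechet_derivative_at[OF smooth_on_has_vector_derivative[OF assms(2) that,
      unfolded has_vector_derivative_def]], of 1] by simp
  then show ?thesis
    using smooth_on_frechet[OF assms(2), of 1] smooth_on_cong[OF assms(1)] by (metis (mono_tags, lifting))
qed

lemma smooth_on_deriv:
  fixes f :: "real \<Rightarrow> real"
  assumes "open S" "smooth_on S f"
  shows "smooth_on S (deriv f)" and "x \<in> S \<Longrightarrow> (f has_field_derivative deriv f x) (at x)"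
proof -
  have *: "(f has_field_derivative vector_derivative f (at x)) (at x)" if "x \<in> S" for x
    using smooth_on_has_vector_derivative[OF assms(2) that]
    by (simp add: has_real_derivative_iff_has_vector_derivative)
  then show "x \<in> S \<Longrightarrow> (f has_field_derivative deriv f x) (at x)"
    using DERIV_imp_deriv by fastforce
  show "smooth_on S (deriv f)"
    using smooth_on_vector_derivative[OF assms] smooth_on_cong[OF assms(1)] * DERIV_imp_deriv
    by (metis (mono_tags, lifting))
qed

lemma higher_diff_tower:
  fixes T :: "nat \<Rightarrow> real \<Rightarrow> 'b::real_normed_vector"
  assumes "open S" "\<And>k x. x \<in> S \<Longrightarrow> (T k has_vector_derivative T (Suc k) x) (at x)"
  shows "higher_differentiable_on S (T k) n"
proof (induction n arbitrary: k)
  case 0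
  then show ?case
    using assms(2) by (auto simp: continuous_on_eq_continuous_within
        intro!: has_vector_derivative_continuous intro: has_vector_derivative_at_within)
next
  case (Suc n)
  show ?case
    by (rule higher_diff_SucI[OF assms(1) assms(2)[unfolded has_vector_derivative_def]])
       (auto intro!: higher_diff_bilinear[OF assms(1) bounded_bilinear_scaleR] higher_diff_const assms(1) Suc.IH)
qed

text \<open>For functions given by integrals, series or case distinctions, the successive derivatives are
  easier to exhibit than to compute.\<close>

lemma smooth_on_tower:
  fixes T :: "nat \<Rightarrow> real \<Rightarrow> 'b::real_normed_vector"
  assumes "open S" "\<And>k x. x \<in> S \<Longrightarrow> (T k has_vector_derivative T (Suc k) x) (at x)"
  shows "smooth_on S (T k)"
  unfolding smooth_on_def using higher_diff_tower[of S T, OF assms] by blast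

text \<open>By Cramer's rule, the solution is a quotient of determinants of the coefficients. This gives the
  smoothness both of inverse functions and of the unit normal field.\<close>

lemma higher_diff_linear_system:
  fixes L :: "'a::euclidean_space \<Rightarrow> real ^ 'n \<Rightarrow> real ^ 'n" and m b :: "'a \<Rightarrow> real ^ 'n"
  assumes S: "open S"
    and L: "\<And>x. x \<in> S \<Longrightarrow> linear (L x)" "\<And>x. x \<in> S \<Longrightarrow> inj (L x)"
    and hL: "\<And>v. higher_differentiable_on S (\<lambda>x. L x v) k"
    and b: "higher_differentiable_on S b k"
    and eq: "\<And>x. x \<in> S \<Longrightarrow> L x (m x) = b x"
  shows "higher_differentiable_on S m k"
proof -
  define M where "M x = matrix (L x)" for x
  have Mij: "M x $ i $ j = L x (axis j 1) $ i" for x i j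
    by (simp add: M_def matrix_def)
  define R where "R l x = (\<chi> i j. if j = l then b x $ i else M x $ i $ j)" for l x
  have det0: "det (M x) \<noteq> 0" if "x \<in> S" for x
    using det_nz_iff_inj[OF L(1)[OF that]] L(2)[OF that] by (simp add: M_def)
  have "m x $ l = det (R l x) * inverse (det (M x))" if "x \<in> S" for x l
  proof -
    have "M x *v m x = b x"
      using eq[OF that] fun_cong[OF matrix_vector_mul(2)[OF L(1)[OF that]], of "m x"]
      by (simp add: M_def)
    then show ?thesis
      using cramer[OF det0[OF that], of "m x" "b x"] by (simp add: R_def divide_inverse)
  qed
  moreover have "higher_differentiable_on S (\<lambda>x. det (R l x) * inverse (det (M x))) k" for l
  proof (intro higher_diff_bilinear[OF S bounded_bilinear_mult])
    have comp: "higher_differentiable_on S (\<lambda>x. M x $ i $ j) k" for i j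
      unfolding Mij by (rule higher_diff_component[OF S hL])
    have "higher_differentiable_on S (\<lambda>x. R l x $ i $ j) k" for i j
      by (cases "j = l") (simp_all add: R_def comp higher_diff_component[OF S b])
    then show "higher_differentiable_on S (\<lambda>x. det (R l x)) k"
      by (rule higher_diff_det[OF S])
    show "higher_differentiable_on S (\<lambda>x. inverse (det (M x))) k"
      by (rule higher_diff_compose[OF S _ _ higher_diff_det[OF S comp] higher_diff_inverse])
         (auto simp: open_Collect_neq det0)
  qed
  ultimately show ?thesis
    using higher_diff_vec[OF S] higher_diff_cong[OF S, of "\<lambda>x. m x $ l" for l] by (metis (mono_tags, lifting))
qed

text \<open>The theorem for continuously differentiable maps gives the local inverse and its derivative; what
  is left to prove is the higher regularity of the inverse.\<close>

theorem smooth_inverse_function: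
  fixes f :: "real ^ 'n \<Rightarrow> real ^ 'n"
  assumes "open U" "smooth_on U f" "x0 \<in> U" "inj (frechet_derivative f (at x0))"
  obtains U' V g where "open U'" "U' \<subseteq> U" "x0 \<in> U'" "open V" "f x0 \<in> V" "homeomorphism U' V f g"
    "smooth_on V g"
proof -
  define f' where "f' x = Blinfun (frechet_derivative f (at x))" for x
  have der: "(f has_derivative frechet_derivative f (at x)) (at x)" if "x \<in> U" for x
    using smooth_on_has_derivative[OF assms(2) that] .
  have f': "blinfun_apply (f' x) = frechet_derivative f (at x)" if "x \<in> U" for x
    unfolding f'_def by (intro bounded_linear_Blinfun_apply has_derivative_bounded_linear[OF der[OF that]])
  have lin: "linear (frechet_derivative f (at x))" if "x \<in> U" for x
    using has_derivative_linear[OF der[OF that]] .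
  have "continuous_on U (\<lambda>x. blinfun_apply (f' x) v)" for v
    using smooth_on_continuous[OF smooth_on_frechet[OF assms(2), of v]] f'
    by (simp cong: continuous_on_cong)
  then have cont: "continuous_on U f'"
    by (simp add: continuous_on_blinfun_componentwise)
  obtain h where h: "linear h" "h \<circ> frechet_derivative f (at x0) = id"
    using linear_injective_left_inverse[OF lin[OF assms(3)] assms(4)] by blast
  define invf where "invf = Blinfun h"
  have "blinfun_apply invf = h"
    unfolding invf_def using h(1) by (simp add: bounded_linear_Blinfun_apply linear_linear)
  then have "invf o\<^sub>L f' x0 = id_blinfun"
    using h(2) f'[OF assms(3)] by (intro blinfun_eqI) (simp add: fun_eq_iff)
  then obtain U' V g g' where 1: "open U'" "U' \<subseteq> U" "x0 \<in> U'" "open V" "f x0 \<in> V"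
      "homeomorphism U' V f g"
    and g: "\<And>y. y \<in> V \<Longrightarrow> (g has_derivative (g' y)) (at y)"
      "\<And>y. y \<in> V \<Longrightarrow> g' y = inv (blinfun_apply (f'(g y)))"
      "\<And>y. y \<in> V \<Longrightarrow> bij (blinfun_apply (f'(g y)))"
    using inverse_function_theorem[OF assms(1) _ cont assms(3), of f invf] der f' by metis
  have gU: "g y \<in> U" if "y \<in> V" for y
    using 1 that by (auto simp: homeomorphism_def)
  \<comment> \<open>The derivative of the inverse solves a linear system with coefficients \<open>Df \<circ> g\<close>, which is as
     regular as \<open>g\<close>: one order of regularity is gained at each step.\<close>
  have "higher_differentiable_on V g k" for k
  proof (induction k)
    case 0
    show ?case using 1(6) by (simp add: homeomorphism_def)
  next
    case (Suc k)
    show ?case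
    proof (rule higher_diff_SucI[OF 1(4) g(1)])
      fix v
      show "higher_differentiable_on V (\<lambda>y. g' y v) k"
      proof (rule higher_diff_linear_system[OF 1(4), where L = "\<lambda>y. frechet_derivative f (at (g y))"
            and b = "\<lambda>_. v"])
        fix y assume y: "y \<in> V"
        show "linear (frechet_derivative f (at (g y)))" by (rule lin[OF gU[OF y]])
        show "inj (frechet_derivative f (at (g y)))"
          using g(3)[OF y] f'[OF gU[OF y]] by (simp add: bij_is_inj)
        show "frechet_derivative f (at (g y)) (g' y v) = v"
          using g(2,3)[OF y] f'[OF gU[OF y]] by (simp add: bij_is_surj surj_f_inv_f)
      next
        fix w
        show "higher_differentiable_on V (\<lambda>y. frechet_derivative f (at (g y)) w) k"
          using smooth_on_frechet[OF assms(2), of w] gU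
          by (intro higher_diff_compose[OF 1(4) assms(1) _ Suc.IH, of "\<lambda>x. frechet_derivative f (at x) w"])
             (auto simp: smooth_on_def)
      qed (rule higher_diff_const[OF 1(4)])
    qed
  qed
  then show thesis
    using that 1 by (auto simp: smooth_on_def)
qed

section \<open>Smooth functions of one variable: Hadamard, Borel, Whitney\<close>

lemma smooth_on_iterated_deriv:
  fixes f :: "real \<Rightarrow> real"
  assumes "open S" "smooth_on S f"
  shows "smooth_on S ((deriv ^^ k) f)"
    and "x \<in> S \<Longrightarrow> ((deriv ^^ k) f has_field_derivative (deriv ^^ Suc k) f x) (at x)"
proof -
  show *: "smooth_on S ((deriv ^^ k) f)" for k
    by (induction k) (auto intro: assms smooth_on_deriv(1))
  show "x \<in> S \<Longrightarrow> ((deriv ^^ k) f has_field_derivative (deriv ^^ Suc k) f x) (at x)"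
    using smooth_on_deriv(2)[OF assms(1) *] by simp
qed

text \<open>The quotient is \<open>\<integral> f' (t x) dt\<close> over the unit interval, whose derivatives are
  \<open>\<integral> t\<^sup>k f\<^bsup>(k+1)\<^esup> (t x) dt\<close>.\<close>

lemma hadamard_factor:
  fixes f :: "real \<Rightarrow> real"
  assumes "smooth_on {-r<..<r} f" "f 0 = 0"
  obtains g where "smooth_on {-r<..<r} g" "\<And>x. x \<in> {-r<..<r} \<Longrightarrow> f x = x * g x"
proof -
  define S where "S = {-r<..<r}"
  have S: "open S" "convex S" by (simp_all add: S_def)
  have scal: "t * x \<in> S" if "x \<in> S" "0 \<le> t" "t \<le> 1" for t x
  proof -
    have "\<bar>t * x\<bar> \<le> 1 * \<bar>x\<bar>"
      unfolding abs_mult using that by (intro mult_right_mono) auto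
    then show ?thesis using that by (auto simp: S_def)
  qed
  define F where "F k = (deriv ^^ k) f" for k
  have F: "(F k has_field_derivative F (Suc k) x) (at x)" if "x \<in> S" for k x
    using smooth_on_iterated_deriv(2)[OF S(1) assms(1)[folded S_def] that] by (simp add: F_def)
  have contF: "continuous_on S (F k)" for k
    using smooth_on_continuous smooth_on_iterated_deriv(1)[OF S(1) assms(1)[folded S_def]]
    unfolding F_def by blast
  have cont2: "continuous_on (S \<times> cbox 0 1) (\<lambda>(x, t). t ^ j * F k (t * x))" for j k
    unfolding case_prod_beta
    by (intro continuous_intros continuous_on_compose2[OF contF]) (auto intro: scal)
  define D where "D k x = integral (cbox 0 1) (\<lambda>t. t ^ k * F (Suc k) (t * x))" for k x
  have "(D k has_vector_derivative D (Suc k) x) (at x)" if x: "x \<in> S" for k x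
  proof -
    have "(D k has_field_derivative D (Suc k) x) (at x within S)"
      unfolding D_def
    proof (rule leibniz_rule_field_derivative[OF _ _ cont2 x S(2)])
      fix y t :: real assume *: "y \<in> S" "t \<in> cbox 0 1"
      have "((\<lambda>x. F (Suc k) (t * x)) has_field_derivative F (Suc (Suc k)) (t * y) * t) (at y)"
        using * by (intro DERIV_chain2[OF F] derivative_eq_intros scal) auto
      from DERIV_cmult[OF this, of "t ^ k"]
      show "((\<lambda>x. t ^ k * F (Suc k) (t * x)) has_field_derivative
          t ^ Suc k * F (Suc (Suc k)) (t * y)) (at y within S)"
        by (simp add: algebra_simps has_field_derivative_at_within)
    next
      fix y assume "y \<in> S"
      then show "(\<lambda>t. t ^ k * F (Suc k) (t * y)) integrable_on cbox 0 1"
        by (intro integrable_continuous continuous_intros continuous_on_compose2[OF contF])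
           (auto intro: scal)
    qed
    then show ?thesis
      using at_within_open[OF x S(1)] by (simp add: has_real_derivative_iff_has_vector_derivative)
  qed
  then have "smooth_on S (D 0)"
    using smooth_on_tower[OF S(1), of D] by blast
  moreover have "f x = x * D 0 x" if x: "x \<in> S" for x
  proof -
    have "((\<lambda>t. x * F (Suc 0) (t * x)) has_integral F 0 (1 * x) - F 0 (0 * x)) {0..1}"
    proof (intro fundamental_theorem_of_calculus)
      fix t :: real assume "t \<in> {0..1}"
      then have "((\<lambda>t. F 0 (t * x)) has_field_derivative F (Suc 0) (t * x) * x) (at t)"
        using x by (intro DERIV_chain2[OF F] derivative_eq_intros scal) auto
      then show "((\<lambda>t. F 0 (t * x)) has_vector_derivative x * F (Suc 0) (t * x)) (at t within {0..1})"
        by (simp add: has_real_derivative_iff_has_vector_derivative mult.commute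
            has_vector_derivative_at_within)
    qed simp
    from integral_unique[OF this] show ?thesis
      using assms(2) by (simp add: F_def D_def)
  qed
  ultimately show thesis
    using that by (simp add: S_def)
qed

text \<open>Antiderivatives of \<open>cos (b x)\<close> of order \<open>m\<close>, each the one vanishing at 0. The one of order 2 is
  \<open>(1 - cos (b x)) / b\<^sup>2\<close>; integrating both of its terms \<open>m\<close> times gives the recursion.\<close>

fun cos_antideriv :: "real \<Rightarrow> nat \<Rightarrow> real \<Rightarrow> real" where
  "cos_antideriv b 0 x = cos (b * x)"
| "cos_antideriv b (Suc 0) x = sin (b * x) / b"
| "cos_antideriv b (Suc (Suc m)) x = (x ^ m / fact m - cos_antideriv b m x) / b\<^sup>2"

lemma DERIV_cos_antideriv:
  assumes "b \<noteq> 0"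
  shows "(cos_antideriv b (Suc m) has_field_derivative cos_antideriv b m x) (at x)"
proof (induction m rule: induct_nat_012)
  case 0
  have "((\<lambda>x. sin (b * x) / b) has_field_derivative cos (b * x)) (at x)"
    using assms by (auto intro!: derivative_eq_intros)
  then show ?case by simp
next
  case 1
  have "((\<lambda>x. (1 - cos (b * x)) / b\<^sup>2) has_field_derivative sin (b * x) / b) (at x)"
    using assms by (auto intro!: derivative_eq_intros simp: power2_eq_square)
  then show ?case by simp
next
  case (ge2 m)
  have "((\<lambda>x. x ^ Suc m / fact (Suc m)) has_field_derivative x ^ m / fact m) (at x)"
    using DERIV_cdivide[OF DERIV_pow[of "Suc m" x], of "fact (Suc m)"]
    by (simp del: power_Suc of_nat_Suc)
  from DERIV_cdivide[OF DERIV_diff[OF this ge2(1)], of "b\<^sup>2"]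
  show ?case by simp
qed

lemma cos_antideriv_Suc_0: "cos_antideriv b (Suc m) 0 = 0"
  by (induction m rule: induct_nat_012) auto

lemma cos_antideriv_bound:
  assumes "b \<ge> 2" "\<bar>x\<bar> \<le> 1"
  shows "\<bar>cos_antideriv b (Suc m) x\<bar> \<le> 1 / b"
proof -
  have b: "2 / b\<^sup>2 \<le> 1 / b"
    using assms by (simp add: field_simps power2_eq_square)
  have step: "\<bar>(p - q) / b\<^sup>2\<bar> \<le> 1 / b" if "\<bar>p\<bar> \<le> 1" "\<bar>q\<bar> \<le> 1" for p q
  proof -
    have "\<bar>(p - q) / b\<^sup>2\<bar> \<le> 2 / b\<^sup>2"
      using that by (auto simp: abs_divide intro!: divide_right_mono)
    then show ?thesis using b by linarith
  qed
  show ?thesis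
  proof (induction m rule: induct_nat_012)
    case 0
    then show ?case using assms by (auto simp: abs_divide intro!: divide_right_mono)
  next
    case 1
    then show ?case using step[of 1 "cos (b * x)"] by simp
  next
    case (ge2 m)
    have "\<bar>x ^ Suc m / fact (Suc m)\<bar> \<le> 1"
    proof -
      have "\<bar>x\<bar> ^ Suc m \<le> 1" using assms by (intro power_le_one) auto
      also have "1 \<le> (fact (Suc m) :: real)" by (rule fact_ge_1)
      finally show ?thesis by (simp add: abs_divide power_abs del: fact_Suc power_Suc)
    qed
    moreover have "\<bar>cos_antideriv b (Suc m) x\<bar> \<le> 1"
    proof -
      have "1 / b \<le> 1" using assms by simp
      then show ?thesis using ge2(1) by linarith
    qed
    ultimately show ?case using step[of "x ^ Suc m / fact (Suc m)"]
      by (simp del: fact_Suc power_Suc)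
  qed
qed

text \<open>The derivative of order \<open>n\<close> of the \<open>k\<close>-fold antiderivative of \<open>cos (b x)\<close>. These are the building
  blocks of a series with prescribed derivatives at 0: the derivatives of order less than \<open>k\<close> vanish
  at 0 and, for \<open>b \<ge> 2\<close>, are at most \<open>1 / b\<close> on \<open>[-1, 1]\<close>, while the one of order \<open>k\<close> is 1 at 0.\<close>

definition borel_term :: "real \<Rightarrow> nat \<Rightarrow> nat \<Rightarrow> real \<Rightarrow> real" where
  "borel_term b k n x =
    (if n \<le> k then cos_antideriv b (k - n) x else b ^ (n - k) * cos (b * x + of_nat (n - k) * (pi / 2)))"

lemma DERIV_borel_term:
  assumes "b \<noteq> 0"
  shows "(borel_term b k n has_field_derivative borel_term b k (Suc n) x) (at x)"
proof (cases "n < k")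
  case True
  then have "k - n = Suc (k - Suc n)" by simp
  then show ?thesis
    using True DERIV_cos_antideriv[OF assms, of "k - Suc n" x] by (simp add: borel_term_def[abs_def])
next
  case False
  define j where "j = n - k"
  have shift: "cos (b * x + (of_nat (Suc j)) * (pi / 2)) = - sin (b * x + of_nat j * (pi / 2))"
  proof -
    have "b * x + of_nat (Suc j) * (pi / 2) = (b * x + of_nat j * (pi / 2)) + pi / 2"
      by (simp add: field_simps)
    then show ?thesis
      using cos_add[of "b * x + of_nat j * (pi / 2)" "pi / 2"] by (simp only:) simp
  qed
  have "((\<lambda>x. b ^ j * cos (b * x + of_nat j * (pi / 2))) has_field_derivative
      b ^ Suc j * cos (b * x + of_nat (Suc j) * (pi / 2))) (at x)"
    unfolding shift by (auto intro!: derivative_eq_intros)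
  moreover have "borel_term b k n = (\<lambda>x. b ^ j * cos (b * x + of_nat j * (pi / 2)))"
    using False by (cases "n = k") (auto simp: borel_term_def j_def fun_eq_iff)
  moreover have "borel_term b k (Suc n) x = b ^ Suc j * cos (b * x + of_nat (Suc j) * (pi / 2))"
    using False by (simp add: borel_term_def j_def Suc_diff_le)
  ultimately show ?thesis by simp
qed

text \<open>Large enough to make \<open>c\<close> times the term of index \<open>k\<close> at most \<open>2\<^bsup>-k\<^esup>\<close> on \<open>[-1, 1]\<close>, together with all
  its derivatives of order less than \<open>k\<close>.\<close>

definition borel_freq :: "nat \<Rightarrow> real \<Rightarrow> real" where
  "borel_freq k c = 2 ^ Suc k * (1 + \<bar>c\<bar>)"

lemma borel_freq_ge: "borel_freq k c \<ge> 2"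
proof -
  have "2 * 1 \<le> 2 ^ Suc k * (1 + \<bar>c\<bar>)"
    by (intro mult_mono) auto
  then show ?thesis by (simp add: borel_freq_def)
qed

lemma borel_term_small:
  assumes "\<bar>x\<bar> \<le> 1" "n < k"
  shows "norm (c * borel_term (borel_freq k c) k n x) \<le> (1 / 2) ^ k"
proof -
  have "k - n = Suc (k - Suc n)" using assms by simp
  then have "\<bar>borel_term (borel_freq k c) k n x\<bar> \<le> 1 / borel_freq k c"
    using assms cos_antideriv_bound[OF borel_freq_ge, of x k c "k - Suc n"] by (simp add: borel_term_def)
  then have "\<bar>c\<bar> * \<bar>borel_term (borel_freq k c) k n x\<bar> \<le> (1 + \<bar>c\<bar>) * (1 / borel_freq k c)"
    by (intro mult_mono) auto
  also have "\<dots> = 1 / 2 ^ Suc k"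
    by (simp add: borel_freq_def divide_simps)
  also have "\<dots> \<le> (1 / 2) ^ k"
    by (simp add: divide_simps)
  finally show ?thesis by (simp add: abs_mult)
qed

text \<open>The system for the coefficients is triangular: the derivative of order \<open>n\<close> at 0 involves only the
  terms of index at most \<open>n\<close>, and the coefficient of index \<open>n\<close> with factor 1.\<close>

function borel_coeff :: "(nat \<Rightarrow> real) \<Rightarrow> nat \<Rightarrow> real" where
  "borel_coeff a n =
    a n - (\<Sum>k<n. borel_coeff a k * borel_term (borel_freq k (borel_coeff a k)) k n 0)"
  by pat_completeness auto
termination by (relation "Wellfounded.measure snd") auto

declare borel_coeff.simps [simp del]

text \<open>Borel's theorem, on an interval. For each \<open>n\<close> all but finitely many terms of the series of derivatives
  of order \<open>n\<close> are bounded by a geometric series, so the series may be differentiated term by term.\<close>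

lemma borel_realization:
  fixes a :: "nat \<Rightarrow> real"
  obtains T where "\<And>n x. x \<in> {-1<..<1} \<Longrightarrow> (T n has_field_derivative T (Suc n) x) (at x)"
    and "\<And>n. T n 0 = a n"
proof -
  define t where
    "t n k x = borel_coeff a k * borel_term (borel_freq k (borel_coeff a k)) k n x" for n k x
  define T where "T n x = (\<Sum>k. t n k x)" for n x
  let ?S = "{-1..1::real}"
  have unif: "uniformly_convergent_on ?S (\<lambda>N x. \<Sum>k<N. t n k x)" for n
  proof (rule Weierstrass_m_test'_ev)
    show "\<forall>\<^sub>F k in sequentially. \<forall>x\<in>?S. norm (t n k x) \<le> (1 / 2) ^ k"
      using eventually_gt_at_top[of n]
    proof eventually_elim
      case (elim k)
      show ?case
        unfolding t_def by (intro ballI borel_term_small elim) auto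
    qed
  qed (simp add: summable_geometric)
  have "(T n has_field_derivative T (Suc n) x) (at x)" if x: "x \<in> {-1<..<1}" for n x
    unfolding T_def
  proof (rule has_field_derivative_series'(2)[OF _ _ unif[of "Suc n"], of "t n" 0])
    fix k y
    show "(t n k has_field_derivative t (Suc n) k y) (at y within ?S)"
      using DERIV_cmult[OF DERIV_borel_term, of "borel_freq k (borel_coeff a k)"]
        borel_freq_ge[of k "borel_coeff a k"]
      unfolding t_def by (fastforce intro: has_field_derivative_at_within)
  next
    show "summable (\<lambda>k. t n k 0)"
      using uniformly_convergent_imp_convergent[OF unif, of 0 n] by (simp add: summable_iff_convergent)
  qed (use x in auto)
  moreover have "T n 0 = a n" for n
  proof -
    have "t n k 0 = 0" if "k \<notin> {..n}" for k
    proof -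
      have "k - n = Suc (k - Suc n)" using that by simp
      then show ?thesis
        using that cos_antideriv_Suc_0 by (simp add: t_def borel_term_def)
    qed
    then have "T n 0 = (\<Sum>k\<le>n. t n k 0)"
      unfolding T_def by (intro suminf_finite) auto
    also have "\<dots> = (\<Sum>k<n. t n k 0) + borel_coeff a n"
      by (simp add: lessThan_Suc_atMost[symmetric] t_def borel_term_def)
    also have "\<dots> = a n"
      using borel_coeff.simps[of a n] unfolding t_def by linarith
    finally show ?thesis .
  qed
  ultimately show thesis using that by blast
qed

text \<open>By the rule of L'Hospital applied to the difference quotient at 0.\<close>

lemma DERIV_removable:
  fixes G g :: "real \<Rightarrow> real"
  assumes "continuous_on {-d<..<d} G" "continuous_on {-d<..<d} g" "d > 0"
    and "\<And>x. x \<in> {-d<..<d} \<Longrightarrow> x \<noteq> 0 \<Longrightarrow> (G has_field_derivative g x) (at x)"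
  shows "(G has_field_derivative g 0) (at 0)"
proof -
  have ev: "\<forall>\<^sub>F x in at 0. x \<in> {-d<..<d} \<and> x \<noteq> 0"
    using assms(3) by (auto simp: eventually_at dist_real_def intro!: exI[of _ d])
  have lim: "(f \<longlongrightarrow> f 0) (at 0)" if "continuous_on {-d<..<d} f" for f :: "real \<Rightarrow> real"
    using that assms(3) by (simp add: continuous_on_eq_continuous_at isCont_def)
  have "((\<lambda>y. (G y - G 0) / y) \<longlongrightarrow> g 0) (at 0)"
  proof (rule lhopital[where f' = g and g' = "\<lambda>_. 1"])
    show "((\<lambda>y. G y - G 0) \<longlongrightarrow> 0) (at 0)"
      using tendsto_diff[OF lim[OF assms(1)] tendsto_const, of "G 0"] by simp
    show "\<forall>\<^sub>F x in at 0. ((\<lambda>y. G y - G 0) has_real_derivative g x) (at x)"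
      using ev
    proof eventually_elim
      case (elim x)
      then show ?case using DERIV_diff[OF assms(4) DERIV_const, of x "G 0"] by simp
    qed
    show "((\<lambda>x. g x / 1) \<longlongrightarrow> g 0) (at 0)"
      using lim[OF assms(2)] by simp
  qed (use ev in \<open>auto elim: eventually_mono intro: tendsto_ident_at\<close>)
  then show ?thesis by (simp add: has_field_derivative_iff)
qed

text \<open>Whitney's theorem on even functions. On the positive side \<open>A x = f (sqrt x)\<close>, and since
  \<open>f' u / (2 u)\<close> is again smooth and even, \<open>A' x = f\<^sub>1 (sqrt x)\<close> with \<open>f\<^sub>1\<close> of the same kind; so all derivatives of
  \<open>A\<close> have limits at 0. Borel's theorem provides a function on the negative side whose derivatives have
  the same limits.\<close>

lemma even_smooth_factor:
  fixes f :: "real \<Rightarrow> real"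
  assumes "r > 0" "smooth_on {-r<..<r} f" "\<And>u. u \<in> {-r<..<r} \<Longrightarrow> f (- u) = f u"
  obtains d A where "d > 0" "smooth_on {-d<..<d} A" "\<And>u. u\<^sup>2 < d \<Longrightarrow> f u = A (u\<^sup>2)"
proof -
  define S where "S = {-r<..<r}"
  have S: "open S" by (simp add: S_def)
  have Sm: "- u \<in> S" if "u \<in> S" for u using that by (auto simp: S_def)
  define P where "P n \<phi> \<longleftrightarrow> smooth_on S \<phi> \<and> (\<forall>u\<in>S. \<phi> (- u) = \<phi> u)" for n :: nat and \<phi> :: "real \<Rightarrow> real"
  define Q where "Q n \<phi> \<psi> \<longleftrightarrow> (\<forall>u\<in>S. (\<phi> has_field_derivative 2 * u * \<psi> u) (at u))"
    for n :: nat and \<phi> \<psi> :: "real \<Rightarrow> real"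
  have "\<exists>\<phi>. \<phi> 0 = f \<and> (\<forall>n. P n (\<phi> n) \<and> Q n (\<phi> n) (\<phi> (Suc n)))"
  proof -
    have "\<exists>\<phi>. \<forall>n. (P n (\<phi> n) \<and> (n = 0 \<longrightarrow> \<phi> n = f)) \<and> Q n (\<phi> n) (\<phi> (Suc n))"
    proof (rule dependent_nat_choice)
      show "\<exists>x. P 0 x \<and> (0 = (0::nat) \<longrightarrow> x = f)"
        using assms by (auto simp: P_def S_def)
    next
      fix \<phi> and n :: nat assume "P n \<phi> \<and> (n = 0 \<longrightarrow> \<phi> = f)"
      then have sm: "smooth_on S \<phi>" and ev: "\<And>u. u \<in> S \<Longrightarrow> \<phi> (- u) = \<phi> u"
        by (auto simp: P_def)
      note D = smooth_on_deriv(2)[OF S sm]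
      have odd: "deriv \<phi> (- u) = - deriv \<phi> u" if u: "u \<in> S" for u
      proof -
        have "((\<lambda>u. \<phi> (- u)) has_field_derivative deriv \<phi> (- u) * - 1) (at u)"
          using D[OF Sm[OF u]] by (intro DERIV_chain2[of \<phi>] derivative_eq_intros) auto
        moreover have "((\<lambda>u. \<phi> (- u)) has_field_derivative deriv \<phi> u) (at u)"
          by (rule has_field_derivative_transform_within_open[OF D[OF u] S u]) (simp add: ev)
        ultimately show ?thesis using DERIV_unique by fastforce
      qed
      then have "deriv \<phi> 0 = 0" using odd[of 0] assms(1) by (simp add: S_def)
      then obtain g where g: "smooth_on S g" "\<And>u. u \<in> S \<Longrightarrow> deriv \<phi> u = u * g u"
        using hadamard_factor[of r "deriv \<phi>"] smooth_on_deriv(1)[OF S sm] unfolding S_def by blast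
      have "g (- u) = g u" if "u \<in> S" for u
        using odd[OF that] g(2)[OF that] g(2)[OF Sm[OF that]] by (cases "u = 0") auto
      then have "P (Suc n) (\<lambda>u. g u / 2)"
        using smooth_on_divide[OF S g(1) smooth_on_const[OF S], of 2] by (simp add: P_def)
      moreover have "Q n \<phi> (\<lambda>u. g u / 2)"
        using D g(2) by (simp add: Q_def)
      ultimately show "\<exists>y. (P (Suc n) y \<and> (Suc n = 0 \<longrightarrow> y = f)) \<and> Q n \<phi> y"
        by auto
    qed
    then show ?thesis by metis
  qed
  then obtain \<phi> where \<phi>0: "\<phi> 0 = f" and sm: "\<And>n. smooth_on S (\<phi> n)"
    and ev: "\<And>n u. u \<in> S \<Longrightarrow> \<phi> n (- u) = \<phi> n u"
    and d\<phi>: "\<And>n u. u \<in> S \<Longrightarrow> (\<phi> n has_field_derivative 2 * u * \<phi> (Suc n) u) (at u)"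
    unfolding P_def Q_def by blast
  \<comment> \<open>Here \<open>\<phi> n (sqrt x)\<close> is the derivative of order \<open>n\<close> of \<open>f (sqrt x)\<close>.\<close>
  obtain B where B: "\<And>n x. x \<in> {-1<..<1} \<Longrightarrow> (B n has_field_derivative B (Suc n) x) (at x)"
    and B0: "\<And>n. B n 0 = \<phi> n 0"
    using borel_realization[of "\<lambda>n. \<phi> n 0"] by blast
  define d where "d = min 1 (r\<^sup>2)"
  have d: "d > 0" "d \<le> 1" "d \<le> r\<^sup>2" using assms(1) by (auto simp: d_def)
  have sqrtS: "sqrt x \<in> S" if "0 \<le> x" "x < d" for x
  proof -
    have "sqrt x < sqrt (r\<^sup>2)" using that d by (intro real_sqrt_less_mono) linarith
    then show ?thesis using that assms(1) by (auto simp: S_def intro: less_le_trans[of _ 0])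
  qed
  define T where "T n x = (if x \<le> 0 then B n x else \<phi> n (sqrt x))" for n x
  have contT: "continuous_on {-d<..<d} (T n)" for n
    unfolding T_def
  proof (rule continuous_on_cases_le)
    have "continuous_on {-1<..<1} (B n)"
      using B DERIV_isCont by (meson continuous_at_imp_continuous_on)
    then show "continuous_on {t \<in> {-d<..<d}. t \<le> 0} (B n)"
      by (rule continuous_on_subset) (use d in auto)
    show "continuous_on {t \<in> {-d<..<d}. 0 \<le> t} (\<lambda>x. \<phi> n (sqrt x))"
      by (rule continuous_on_compose2[OF smooth_on_continuous[OF sm]])
         (auto intro!: continuous_intros sqrtS)
  qed (auto simp: B0)
  have dT: "(T n has_field_derivative T (Suc n) x) (at x)" if x: "x \<in> {-d<..<d}" "x \<noteq> 0" for n x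
  proof (cases "x < 0")
    case True
    have "(T n has_field_derivative B (Suc n) x) (at x)"
      by (rule has_field_derivative_transform_within_open[OF B, of x "{..<0}"])
         (use True x d in \<open>auto simp: T_def\<close>)
    then show ?thesis using True by (simp add: T_def)
  next
    case False
    then have "x > 0" using x by simp
    have "((\<lambda>x. \<phi> n (sqrt x)) has_field_derivative
        2 * sqrt x * \<phi> (Suc n) (sqrt x) * (inverse (sqrt x) / 2)) (at x)"
      using \<open>x > 0\<close> x by (intro DERIV_chain2[OF d\<phi>] DERIV_real_sqrt sqrtS) auto
    moreover have "2 * sqrt x * \<phi> (Suc n) (sqrt x) * (inverse (sqrt x) / 2) = \<phi> (Suc n) (sqrt x)"
      using \<open>x > 0\<close> by simp
    ultimately have "((\<lambda>x. \<phi> n (sqrt x)) has_field_derivative \<phi> (Suc n) (sqrt x)) (at x)"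
      by metis
    then have "(T n has_field_derivative \<phi> (Suc n) (sqrt x)) (at x)"
      by (rule has_field_derivative_transform_within_open[of _ _ _ "{0<..}"])
         (use \<open>x > 0\<close> in \<open>auto simp: T_def\<close>)
    then show ?thesis using \<open>x > 0\<close> by (simp add: T_def)
  qed
  have "(T n has_field_derivative T (Suc n) x) (at x)" if "x \<in> {-d<..<d}" for n x
    using dT[OF that] DERIV_removable[OF contT contT d(1) dT] by (cases "x = 0") auto
  then have "smooth_on {-d<..<d} (T 0)"
    using smooth_on_tower[of "{-d<..<d}" T]
    by (simp add: has_real_derivative_iff_has_vector_derivative)
  moreover have "f u = T 0 (u\<^sup>2)" if "u\<^sup>2 < d" for u
  proof -
    have "\<bar>u\<bar> \<in> S" using sqrtS[of "u\<^sup>2"] that by simp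
    then have "f \<bar>u\<bar> = f u" using assms(3)[of u] by (auto simp: abs_if S_def)
    then show ?thesis using B0[of 0] \<phi>0 by (auto simp: T_def)
  qed
  ultimately show thesis using that d(1) by blast
qed

text \<open>The odd part of \<open>f\<close> is \<open>u\<close> times an even smooth function.\<close>

lemma even_odd_decomposition:
  fixes f :: "real \<Rightarrow> real"
  assumes "r > 0" "smooth_on {-r<..<r} f"
  obtains d A B where "d > 0" "smooth_on {-d<..<d} A" "smooth_on {-d<..<d} B"
    "\<And>u. u\<^sup>2 < d \<Longrightarrow> f u = A (u\<^sup>2) + u * B (u\<^sup>2)"
proof -
  let ?S = "{-r<..<r}"
  have S: "open ?S" by simp
  have sm': "smooth_on ?S (\<lambda>u. f (- u))"
    by (rule smooth_on_compose[OF S S smooth_on_uminus[OF S smooth_on_ident[OF S]] assms(2)]) auto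
  have e: "smooth_on ?S (\<lambda>u. (f u + f (- u)) / 2)" and o: "smooth_on ?S (\<lambda>u. (f u - f (- u)) / 2)"
    by (auto intro!: smooth_on_divide smooth_on_add smooth_on_diff smooth_on_const assms sm')
  obtain g where g: "smooth_on ?S g" "\<And>u. u \<in> ?S \<Longrightarrow> (f u - f (- u)) / 2 = u * g u"
    using hadamard_factor[OF o] by auto
  have even: "g (- u) = g u" if "u \<in> ?S" for u
    using g(2)[OF that] g(2)[of "- u"] that by (cases "u = 0") (auto simp: field_simps)
  obtain d1 A where A: "d1 > 0" "smooth_on {-d1<..<d1} A"
      "\<And>u. u\<^sup>2 < d1 \<Longrightarrow> (f u + f (- u)) / 2 = A (u\<^sup>2)"
    using even_smooth_factor[OF assms(1) e] by auto
  obtain d2 B where B: "d2 > 0" "smooth_on {-d2<..<d2} B" "\<And>u. u\<^sup>2 < d2 \<Longrightarrow> g u = B (u\<^sup>2)"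
    using even_smooth_factor[OF assms(1) g(1) even] by blast
  define d where "d = min (r\<^sup>2) (min d1 d2)"
  show thesis
  proof
    show "d > 0" using assms(1) A(1) B(1) by (simp add: d_def)
    show "smooth_on {-d<..<d} A" "smooth_on {-d<..<d} B"
      by (rule smooth_on_subset[OF A(2)], auto simp: d_def)
         (rule smooth_on_subset[OF B(2)], auto simp: d_def)
    show "f u = A (u\<^sup>2) + u * B (u\<^sup>2)" if "u\<^sup>2 < d" for u
    proof -
      have "u \<in> ?S"
        using that power2_less_imp_less[of "\<bar>u\<bar>" r] assms(1) by (auto simp: d_def abs_less_iff)
      then have "f u = (f u + f (- u)) / 2 + u * g u" by (simp add: g(2)[symmetric] field_simps)
      then show ?thesis using A(3)[of u] B(3)[of u] that by (simp add: d_def)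
    qed
  qed
qed

section \<open>Germs of space curves\<close>

definition vderiv :: "(real \<Rightarrow> 'a::real_normed_vector) \<Rightarrow> real \<Rightarrow> 'a" where
  "vderiv f s = vector_derivative f (at s)"

lemma deriv_eq_vderiv: "(deriv :: (real \<Rightarrow> real) \<Rightarrow> real \<Rightarrow> real) = vderiv"
  by (simp add: vderiv_def fun_eq_iff field_derivative_eq_vector_derivative)

lemma vderiv_eqI: "(f has_vector_derivative d) (at s) \<Longrightarrow> vderiv f s = d"
  by (simp add: vderiv_def vector_derivative_at)

lemma smooth_on_vderiv: "open S \<Longrightarrow> smooth_on S f \<Longrightarrow> smooth_on S (vderiv f)"
  using smooth_on_vector_derivative[of S f] by (simp add: vderiv_def[abs_def])

lemma smooth_on_iterated_vderiv: "open S \<Longrightarrow> smooth_on S f \<Longrightarrow> smooth_on S ((vderiv ^^ k) f)"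
  by (induction k) (auto intro: smooth_on_vderiv)

lemma iterated_vderiv_works:
  assumes "open S" "smooth_on S f" "s \<in> S"
  shows "((vderiv ^^ k) f has_vector_derivative (vderiv ^^ Suc k) f s) (at s)"
  using smooth_on_has_vector_derivative[OF smooth_on_iterated_vderiv[OF assms(1,2)] assms(3)]
  by (simp add: vderiv_def)

lemma vderiv_cong_open:
  assumes "open S" "\<And>x. x \<in> S \<Longrightarrow> f x = g x" "s \<in> S"
  shows "(vderiv ^^ k) f s = (vderiv ^^ k) g s"
  using assms(3)
proof (induction k arbitrary: s)
  case (Suc k)
  have "((vderiv ^^ k) f has_vector_derivative d) (at s) \<longleftrightarrow>
      ((vderiv ^^ k) g has_vector_derivative d) (at s)" for d
    using has_vector_derivative_transform_within_open[OF _ assms(1) Suc.prems, of "(vderiv ^^ k) f" d "(vderiv ^^ k) g"]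
      has_vector_derivative_transform_within_open[OF _ assms(1) Suc.prems, of "(vderiv ^^ k) g" d "(vderiv ^^ k) f"]
      Suc.IH by metis
  then show ?case
    unfolding funpow.simps o_apply vderiv_def[of "(vderiv ^^ k) f"] vderiv_def[of "(vderiv ^^ k) g"]
      vector_derivative_def by presburger
qed (use assms(2) in auto)

text \<open>Covers components, scalar products with a fixed vector and translations of the parameter.\<close>

lemma iterated_vderiv_linear_shift:
  assumes "open S" "smooth_on S c" "bounded_linear L" "a + u \<in> S"
  shows "(vderiv ^^ k) (\<lambda>u. L (c (a + u))) u = L ((vderiv ^^ k) c (a + u))"
  using assms(4)
proof (induction k arbitrary: u)
  case (Suc k)
  have "(((vderiv ^^ k) c \<circ> (+) a) has_vector_derivative 1 *\<^sub>R (vderiv ^^ Suc k) c (a + u)) (at u)"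
    by (rule vector_diff_chain_at)
      (use iterated_vderiv_works[OF assms(1,2) Suc.prems] in \<open>auto intro!: derivative_eq_intros\<close>)
  from bounded_linear.has_vector_derivative[OF assms(3) this]
  have "((\<lambda>u. L ((vderiv ^^ k) c (a + u))) has_vector_derivative L ((vderiv ^^ Suc k) c (a + u))) (at u)"
    by simp
  then have "((vderiv ^^ k) (\<lambda>u. L (c (a + u))) has_vector_derivative L ((vderiv ^^ Suc k) c (a + u))) (at u)"
    by (rule has_vector_derivative_transform_within_open[OF _ open_translation[OF assms(1), of "- a"]])
       (use Suc in \<open>auto simp: image_iff intro: bexI[of _ "a + u"]\<close>)
  from vderiv_eqI[OF this] show ?case
    by (simp only: funpow.simps o_apply)
qed auto

lemmas iterated_vderiv_linear = iterated_vderiv_linear_shift[where a = 0, simplified]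

text \<open>Two Hadamard factorizations give \<open>f u = u\<^sup>2 p u\<close>, and \<open>A\<close>, \<open>B\<close> come from the even and odd parts of \<open>p\<close>;
  the last two equations follow from \<open>f'' 0 = 2 p 0\<close> and \<open>f''' 0 = 6 p' 0\<close>.\<close>

lemma square_cube_factor:
  fixes f :: "real \<Rightarrow> real"
  assumes r: "r > 0" and f: "smooth_on {-r<..<r} f" "f 0 = 0" "vderiv f 0 = 0"
  obtains d A B where "d > 0" "smooth_on {-d<..<d} A" "smooth_on {-d<..<d} B"
    "\<And>u. u\<^sup>2 < d \<Longrightarrow> f u = u\<^sup>2 * A (u\<^sup>2) + u ^ 3 * B (u\<^sup>2)"
    "(vderiv ^^ 2) f 0 = 2 * A 0" "(vderiv ^^ 3) f 0 = 6 * B 0"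
proof -
  let ?S = "{-r<..<r}"
  have S: "open ?S" by simp
  have 0: "0 \<in> ?S" using r by simp
  obtain g where g: "smooth_on ?S g" "\<And>x. x \<in> ?S \<Longrightarrow> f x = x * g x"
    using hadamard_factor[OF f(1,2)] by blast
  have "(f has_field_derivative g 0) (at 0)"
    by (rule has_field_derivative_transform_within_open[OF _ S 0, of "\<lambda>x. x * g x"])
       (auto intro!: derivative_eq_intros smooth_on_deriv(2)[OF S g(1) 0] simp: g(2))
  then have "g 0 = 0" using f(3) DERIV_imp_deriv deriv_eq_vderiv by metis
  then obtain p where p: "smooth_on ?S p" "\<And>x. x \<in> ?S \<Longrightarrow> g x = x * p x"
    using hadamard_factor[OF g(1)] by blast
  define p1 p2 where "p1 = vderiv p" and "p2 = vderiv p1"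
  have p1: "smooth_on ?S p1" and p2: "smooth_on ?S p2"
    by (simp_all add: p1_def p2_def smooth_on_vderiv p(1))
  have dp: "(p has_field_derivative p1 x) (at x)" "(p1 has_field_derivative p2 x) (at x)"
     "(p2 has_field_derivative vderiv p2 x) (at x)"
    if "x \<in> ?S" for x
    using smooth_on_deriv(2)[OF S _ that] p(1) p1 p2 by (auto simp: p1_def p2_def deriv_eq_vderiv)
  have f0: "f x = x\<^sup>2 * p x" if "x \<in> ?S" for x
    using g(2)[OF that] p(2)[OF that] by (simp add: power2_eq_square)
  have f1: "vderiv f x = 2 * x * p x + x\<^sup>2 * p1 x" if x: "x \<in> ?S" for x
  proof (rule vderiv_eqI, fold has_real_derivative_iff_has_vector_derivative)
    have "((\<lambda>x. x\<^sup>2 * p x) has_field_derivative 2 * x * p x + x\<^sup>2 * p1 x) (at x)"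
      by (auto intro!: derivative_eq_intros dp x)
    then show "(f has_field_derivative 2 * x * p x + x\<^sup>2 * p1 x) (at x)"
      by (rule has_field_derivative_transform_within_open[OF _ S x]) (simp add: f0)
  qed
  have f2: "vderiv (vderiv f) x = 2 * p x + 4 * x * p1 x + x\<^sup>2 * p2 x" if x: "x \<in> ?S" for x
  proof (rule vderiv_eqI, fold has_real_derivative_iff_has_vector_derivative)
    have "((\<lambda>x. 2 * x * p x + x\<^sup>2 * p1 x) has_field_derivative 2 * p x + 4 * x * p1 x + x\<^sup>2 * p2 x) (at x)"
      by (auto intro!: derivative_eq_intros dp x)
    then show "(vderiv f has_field_derivative 2 * p x + 4 * x * p1 x + x\<^sup>2 * p2 x) (at x)"
      by (rule has_field_derivative_transform_within_open[OF _ S x]) (simp add: f1)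
  qed
  have f3: "vderiv (vderiv (vderiv f)) 0 = 6 * p1 0"
  proof (rule vderiv_eqI, fold has_real_derivative_iff_has_vector_derivative)
    have "((\<lambda>x. 2 * p x + 4 * x * p1 x + x\<^sup>2 * p2 x) has_field_derivative 6 * p1 0) (at 0)"
      by (auto intro!: derivative_eq_intros dp 0)
    then show "(vderiv (vderiv f) has_field_derivative 6 * p1 0) (at 0)"
      by (rule has_field_derivative_transform_within_open[OF _ S 0]) (simp add: f2)
  qed
  obtain d0 A B where AB: "d0 > 0" "smooth_on {-d0<..<d0} A" "smooth_on {-d0<..<d0} B"
    and pAB: "\<And>u. u\<^sup>2 < d0 \<Longrightarrow> p u = A (u\<^sup>2) + u * B (u\<^sup>2)"
    using even_odd_decomposition[OF r p(1)] by blast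
  have "(p has_field_derivative B 0) (at 0)"
  proof -
    have *: "((\<lambda>u. F (u\<^sup>2)) has_field_derivative 0) (at 0)"
      if "smooth_on {-d0<..<d0} F" for F
    proof -
      have "((\<lambda>u::real. u\<^sup>2) has_field_derivative 0) (at 0)"
        by (auto intro!: derivative_eq_intros)
      moreover have "(F has_field_derivative deriv F (0\<^sup>2)) (at (0\<^sup>2))"
        by (rule smooth_on_deriv(2)[OF _ that]) (use AB in auto)
      ultimately show ?thesis using DERIV_chain2 by fastforce
    qed
    have "((\<lambda>u. A (u\<^sup>2) + u * B (u\<^sup>2)) has_field_derivative B 0) (at 0)"
      by (auto intro!: derivative_eq_intros * AB)
    moreover have "open {u::real. u\<^sup>2 < d0}" by (intro open_Collect_less continuous_intros)
    ultimately show ?thesis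
      by (rule has_field_derivative_transform_within_open) (use AB pAB in auto)
  qed
  then have "p1 0 = B 0" using dp(1)[OF 0] DERIV_unique by blast
  define d where "d = min d0 (r\<^sup>2)"
  show thesis
  proof
    show "d > 0" using AB r by (simp add: d_def)
    show "smooth_on {-d<..<d} A" "smooth_on {-d<..<d} B"
      by (rule smooth_on_subset[OF AB(2)], auto simp: d_def)
         (rule smooth_on_subset[OF AB(3)], auto simp: d_def)
    show "f u = u\<^sup>2 * A (u\<^sup>2) + u ^ 3 * B (u\<^sup>2)" if "u\<^sup>2 < d" for u
    proof -
      have "u \<in> ?S"
        using that power2_less_imp_less[of "\<bar>u\<bar>" r] r by (auto simp: d_def abs_less_iff)
      then show ?thesis
        using f0 pAB[of u] that by (simp add: d_def power2_eq_square power3_eq_cube algebra_simps)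
    qed
    show "(vderiv ^^ 2) f 0 = 2 * A 0" "(vderiv ^^ 3) f 0 = 6 * B 0"
      using f2[OF 0] f3 pAB[of 0] AB(1) \<open>p1 0 = B 0\<close> by (simp_all add: numeral_eq_Suc)
  qed
qed

lemma frechet_injI:
  assumes "(f has_derivative D) (at x)" "\<And>h. D h = 0 \<Longrightarrow> h = 0"
  shows "inj (frechet_derivative f (at x))"
  using assms frechet_derivative_at[OF assms(1)] linear_injective_0[OF has_derivative_linear[OF assms(1)]]
  by simp

text \<open>The map \<open>\<Psi>\<close> adds to the identity the deviation of \<open>c\<close> from its tangent line, as a function of the
  coordinate along that line; its derivative at 0 is the identity.\<close>

lemma regular_curve_model:
  fixes c :: "real \<Rightarrow> real ^ 'n"
  assumes r: "r > 0" and c: "smooth_on {-r<..<r} c" and d: "d = vderiv c 0" "d \<noteq> 0"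
  obtains U \<Psi> where "open U" "0 \<in> U" "smooth_on U \<Psi>" "inj (frechet_derivative \<Psi> (at 0))"
    "\<And>u. \<bar>u\<bar> < r \<Longrightarrow> u *\<^sub>R d \<in> U \<and> \<Psi> (u *\<^sub>R d) = c u"
proof -
  define l where "l w = (w \<bullet> d) / (d \<bullet> d)" for w
  have dd: "d \<bullet> d \<noteq> 0" using d(2) by simp
  have ld: "l (u *\<^sub>R d) = u" for u using dd by (simp add: l_def)
  have bl: "bounded_linear l"
    unfolding l_def divide_inverse by (intro bounded_linear_mult_const bounded_linear_inner_left)
  define U where "U = {w. \<bar>l w\<bar> < r}"
  have U: "open U"
    unfolding U_def by (intro open_Collect_less continuous_intros linear_continuous_on bl)
  define \<Psi> where "\<Psi> w = w + (c (l w) - l w *\<^sub>R d)" for w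
  have sl: "smooth_on U l" by (rule smooth_on_bounded_linear[OF U bl])
  show thesis
  proof
    show "open U" by (rule U)
    show "0 \<in> U" using r by (simp add: U_def l_def)
    have "smooth_on U (\<lambda>w. c (l w))"
      by (rule smooth_on_compose[OF U _ sl c]) (auto simp: U_def abs_less_iff)
    then show "smooth_on U \<Psi>"
      unfolding \<Psi>_def
      by (intro smooth_on_add smooth_on_diff smooth_on_scaleR smooth_on_ident smooth_on_const U sl)
    have dc: "(c has_derivative (\<lambda>h. h *\<^sub>R d)) (at (l 0))"
      using smooth_on_has_vector_derivative[OF c, of 0] r
      by (simp add: d(1) vderiv_def has_vector_derivative_def l_def)
    have "(\<Psi> has_derivative (\<lambda>h. h + (l h *\<^sub>R d - l h *\<^sub>R d))) (at 0)"
      unfolding \<Psi>_def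
      by (intro has_derivative_add has_derivative_diff has_derivative_ident has_derivative_scaleR_left
          has_derivative_compose[OF bounded_linear_imp_has_derivative[OF bl] dc]
          bounded_linear_imp_has_derivative[OF bl])
    then show "inj (frechet_derivative \<Psi> (at 0))"
      by (rule frechet_injI) simp
    show "u *\<^sub>R d \<in> U \<and> \<Psi> (u *\<^sub>R d) = c u" if "\<bar>u\<bar> < r" for u
      using that ld by (simp add: U_def \<Psi>_def)
  qed
qed

text \<open>With \<open>c u = c 0 + u\<^sup>2 A(u\<^sup>2) + u\<^sup>3 B(u\<^sup>2)\<close>, the map
  \<open>\<Psi> (x, y, z) = c 0 + x A x + y B x + (z - x\<^sup>2) e\<close> takes the cusp to \<open>c\<close>, and its derivative at 0 has the
  columns \<open>A 0\<close>, \<open>B 0\<close>, \<open>e\<close>.\<close>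

lemma cusp_curve_model:
  fixes c :: "real \<Rightarrow> real ^ 3"
  assumes r: "r > 0" and c: "smooth_on {-r<..<r} c" "vderiv c 0 = 0"
    and indep: "\<And>a b. a *\<^sub>R (vderiv ^^ 2) c 0 + b *\<^sub>R (vderiv ^^ 3) c 0 = 0 \<Longrightarrow> a = 0 \<and> b = 0"
  obtains U and \<Psi> :: "real ^ 3 \<Rightarrow> real ^ 3" and e where "open U" "0 \<in> U" "smooth_on U \<Psi>" "inj (frechet_derivative \<Psi> (at 0))" "e > 0"
    "\<And>u. \<bar>u\<bar> < e \<Longrightarrow> vector [u ^ 2, u ^ 3, u ^ 4] \<in> U \<and> \<Psi> (vector [u ^ 2, u ^ 3, u ^ 4]) = c u"
proof -
  let ?S = "{-r<..<r}"
  have S: "open ?S" "0 \<in> ?S" using r by auto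
  have bc: "bounded_linear (\<lambda>x :: real ^ 3. x $ i)" for i by (rule bounded_linear_vec_nth)
  have "\<exists>d A B. d > 0 \<and> smooth_on {-d<..<d} A \<and> smooth_on {-d<..<d} B \<and>
     (\<forall>u. u\<^sup>2 < d \<longrightarrow> c u $ i - c 0 $ i = u\<^sup>2 * A (u\<^sup>2) + u ^ 3 * B (u\<^sup>2)) \<and>
     (vderiv ^^ 2) c 0 $ i = 2 * A 0 \<and> (vderiv ^^ 3) c 0 $ i = 6 * B 0" for i
  proof -
    let ?f = "\<lambda>u. (c u - c 0) $ i"
    have sm: "smooth_on ?S (\<lambda>u. c u - c 0)"
      by (intro smooth_on_diff smooth_on_const S c)
    have e: "(vderiv ^^ Suc k) ?f 0 = (vderiv ^^ Suc k) c 0 $ i" for k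
    proof -
      have "((\<lambda>u. c u - c 0) has_vector_derivative vderiv c s) (at s)" if "s \<in> ?S" for s
        using iterated_vderiv_works[OF S(1) c(1) that, of 0]
        by (auto intro!: derivative_eq_intros)
      then have "(vderiv ^^ k) (vderiv (\<lambda>u. c u - c 0)) 0 = (vderiv ^^ k) (vderiv c) 0"
        by (intro vderiv_cong_open[OF S(1) _ S(2)] vderiv_eqI)
      then show ?thesis
        using iterated_vderiv_linear[OF S(1) sm bc S(2), of "Suc k" i]
        by (simp only: funpow_Suc_right o_apply)
    qed
    have "smooth_on ?S ?f" by (rule smooth_on_component[OF S(1) sm])
    moreover have "vderiv ?f 0 = 0" using e[of 0] c(2) by simp
    ultimately obtain d A B where "d > 0" "smooth_on {-d<..<d} A" "smooth_on {-d<..<d} B"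
      "\<And>u. u\<^sup>2 < d \<Longrightarrow> ?f u = u\<^sup>2 * A (u\<^sup>2) + u ^ 3 * B (u\<^sup>2)"
      "(vderiv ^^ 2) ?f 0 = 2 * A 0" "(vderiv ^^ 3) ?f 0 = 6 * B 0"
      using square_cube_factor[OF r, of ?f] by auto
    then show ?thesis using e[of 1] e[of 2]
      by (intro exI[of _ d] exI[of _ A] exI[of _ B]) (auto simp: numeral_eq_Suc)
  qed
  then obtain d A' B' where d: "\<And>i. d i > 0"
      "\<And>i. smooth_on {- d i<..<d i} (A' i)" "\<And>i. smooth_on {- d i<..<d i} (B' i)"
    and cAB: "\<And>i u. u\<^sup>2 < d i \<Longrightarrow> c u $ i - c 0 $ i = u\<^sup>2 * A' i (u\<^sup>2) + u ^ 3 * B' i (u\<^sup>2)"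
    and AB0: "\<And>i. (vderiv ^^ 2) c 0 $ i = 2 * A' i 0" "\<And>i. (vderiv ^^ 3) c 0 $ i = 6 * B' i 0"
    by metis
  define D where "D = Min (range d)"
  have D: "D > 0" "\<And>i. D \<le> d i" using d(1) by (auto simp: D_def)
  define A B where "A x = (\<chi> i. A' i x)" and "B x = (\<chi> i. B' i x)" for x
  have sAB: "smooth_on {-D<..<D} A" "smooth_on {-D<..<D} B"
  proof -
    have sub: "{-D<..<D} \<subseteq> {- d i<..<d i}" for i
      using D(2)[of i] by auto
    show "smooth_on {-D<..<D} A" "smooth_on {-D<..<D} B"
      by (rule smooth_on_vec, simp, simp add: A_def smooth_on_subset[OF d(2) sub])
         (rule smooth_on_vec, simp, simp add: B_def smooth_on_subset[OF d(3) sub])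
  qed
  have A0: "A 0 = (1 / 2) *\<^sub>R (vderiv ^^ 2) c 0" and B0: "B 0 = (1 / 6) *\<^sub>R (vderiv ^^ 3) c 0"
    using AB0 by (simp_all add: A_def B_def vec_eq_iff)
  \<comment> \<open>Any \<open>e\<close> outside the plane of \<open>A 0\<close> and \<open>B 0\<close> would do; orthogonality makes the injectivity of the
     derivative evident.\<close>
  have "dim {A 0, B 0} < DIM(real ^ 3)"
    using dim_le_card[of "{A 0, B 0}" "{A 0, B 0}"] card_insert_le_m1[of 2 "{B 0}" "A 0"]
    by (simp add: span_superset)
  then obtain e where e: "e \<noteq> 0" "e \<bullet> A 0 = 0" "e \<bullet> B 0 = 0"
    using orthogonal_to_subspace_exists[of "{A 0, B 0}"]
    by (metis insertCI orthogonal_def span_base)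
  define U where "U = {w :: real ^ 3. \<bar>w $ 1\<bar> < D}"
  have U: "open U" unfolding U_def by (intro open_Collect_less continuous_intros)
  have sc: "smooth_on U (\<lambda>w. w $ j)" for j
    by (intro smooth_on_component smooth_on_ident U)
  define \<Psi> where "\<Psi> w = c 0 + ((w :: real ^ 3) $ 1 *\<^sub>R A (w $ 1) + w $ 2 *\<^sub>R B (w $ 1) + (w $ 3 - (w $ 1)\<^sup>2) *\<^sub>R e)" for w
  show thesis
  proof
    show "open U" by (rule U)
    show "0 \<in> U" using D by (simp add: U_def)
    have AB: "smooth_on U (\<lambda>w. A (w $ 1))" "smooth_on U (\<lambda>w. B (w $ 1))"
    proof -
      have sub: "(\<lambda>w. w $ 1) ` U \<subseteq> {-D<..<D}" by (auto simp: U_def abs_less_iff)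
      show "smooth_on U (\<lambda>w. A (w $ 1))" "smooth_on U (\<lambda>w. B (w $ 1))"
        using smooth_on_compose[OF U _ sc sAB(1) sub] smooth_on_compose[OF U _ sc sAB(2) sub]
        by auto
    qed
    show "smooth_on U \<Psi>"
      unfolding \<Psi>_def
      by (intro smooth_on_add smooth_on_diff smooth_on_scaleR smooth_on_power smooth_on_const U sc AB)
    have 0: "0 \<in> U" using D by (simp add: U_def)
    have "(\<Psi> has_derivative (\<lambda>h. h $ 1 *\<^sub>R A 0 + h $ 2 *\<^sub>R B 0 + h $ 3 *\<^sub>R e)) (at 0)"
      unfolding \<Psi>_def
      by (auto intro!: derivative_eq_intros smooth_on_has_derivative[OF AB(1) 0]
          smooth_on_has_derivative[OF AB(2) 0] bounded_linear_imp_has_derivative bc)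
    then show "inj (frechet_derivative \<Psi> (at 0))"
    proof (rule frechet_injI, goal_cases)
      case (1 h)
      then have h: "h $ 1 *\<^sub>R A 0 + h $ 2 *\<^sub>R B 0 + h $ 3 *\<^sub>R e = 0" .

      have "e \<bullet> (h $ 1 *\<^sub>R A 0 + h $ 2 *\<^sub>R B 0 + h $ 3 *\<^sub>R e) = h $ 3 * (e \<bullet> e)"
        using e by (simp add: inner_add_right)
      then have 3: "h $ 3 = 0" using h e(1) by simp
      then have "h $ 1 / 2 = 0 \<and> h $ 2 / 6 = 0"
        using h by (intro indep) (simp add: A0 B0)
      then show "h = 0" using 3 by (simp add: vec_eq_iff forall_3)
    qed
    show "sqrt D > 0" using D by simp
    fix u :: real assume "\<bar>u\<bar> < sqrt D"
    then have u: "u\<^sup>2 < D"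
      using real_less_rsqrt real_sqrt_less_iff[of "u\<^sup>2" D] by (simp del: real_sqrt_less_iff)
    then have "c u - c 0 = u\<^sup>2 *\<^sub>R A (u\<^sup>2) + u ^ 3 *\<^sub>R B (u\<^sup>2)"
      using cAB[OF less_le_trans[OF u D(2)]] by (simp add: vec_eq_iff A_def B_def)
    then have "\<Psi> (vector [u ^ 2, u ^ 3, u ^ 4]) = c u"
      by (simp add: \<Psi>_def power_mult[symmetric] algebra_simps)
    then show "vector [u ^ 2, u ^ 3, u ^ 4] \<in> U \<and> \<Psi> (vector [u ^ 2, u ^ 3, u ^ 4]) = c u"
      using u by (simp add: U_def)
  qed
qed

section \<open>Local diffeomorphism type of curves in hyperbolic space\<close>

lemma exhaust_4': "(i :: 4) = 0 \<or> i = 1 \<or> i = 2 \<or> i = 3"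
  using exhaust_4[of i] by auto

lemma forall_4': "(\<forall>i :: 4. P i) \<longleftrightarrow> P 0 \<and> P 1 \<and> P 2 \<and> P 3"
  using exhaust_4' by metis

lemma UNIV_4': "(UNIV :: 4 set) = {0, 1, 2, 3}"
  using exhaust_4' by auto

definition spatial :: "real ^ 4 \<Rightarrow> real ^ 3" where
  "spatial x = vector [x $ 1, x $ 2, x $ 3]"

text \<open>Each sheet of the hyperboloid, labelled by the sign \<open>\<sigma>\<close> of the time coordinate, is a graph over the
  spatial coordinates; the lift is the inverse of the projection.\<close>

definition sheet_lift :: "real \<Rightarrow> real ^ 3 \<Rightarrow> real ^ 4" where
  "sheet_lift \<sigma> y = (\<chi> i. if i = 0 then \<sigma> * sqrt (1 + (y $ 1)\<^sup>2 + (y $ 2)\<^sup>2 + (y $ 3)\<^sup>2)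
     else if i = 1 then y $ 1 else if i = 2 then y $ 2 else y $ 3)"

lemma bounded_linear_spatial: "bounded_linear spatial"
proof -
  have "linear spatial"
    by (rule linearI) (simp_all add: spatial_def vec_eq_iff forall_3)
  then show ?thesis by (simp add: linear_linear)
qed

lemma smooth_on_sheet_lift: "open S \<Longrightarrow> smooth_on S (sheet_lift \<sigma>)"
proof (rule smooth_on_vec)
  fix i assume S: "open S"
  have c: "smooth_on S (\<lambda>y :: real ^ 3. y $ j)" for j
    by (intro smooth_on_component smooth_on_ident S)
  have "smooth_on S (\<lambda>y :: real ^ 3. \<sigma> * sqrt (1 + (y $ 1)\<^sup>2 + (y $ 2)\<^sup>2 + (y $ 3)\<^sup>2))"
  proof (intro smooth_on_mult smooth_on_sqrt smooth_on_add smooth_on_power smooth_on_const c S)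
    fix y :: "real ^ 3"
    have "0 \<le> (y $ 1)\<^sup>2" "0 \<le> (y $ 2)\<^sup>2" "0 \<le> (y $ 3)\<^sup>2" by simp_all
    then show "0 < 1 + (y $ 1)\<^sup>2 + (y $ 2)\<^sup>2 + (y $ 3)\<^sup>2" by linarith
  qed
  then show "smooth_on S (\<lambda>x. sheet_lift \<sigma> x $ i)"
    using c exhaust_4'[of i] by (auto simp: sheet_lift_def)
qed

lemma spatial_sheet_lift: "spatial (sheet_lift \<sigma> y) = y"
  by (simp add: spatial_def sheet_lift_def vec_eq_iff forall_3)

lemma sheet_lift_time: "\<sigma> \<noteq> 0 \<Longrightarrow> \<sigma> * sheet_lift \<sigma> y $ 0 > 0"
proof -
  assume "\<sigma> \<noteq> 0"
  moreover have "0 \<le> (y $ 1)\<^sup>2" "0 \<le> (y $ 2)\<^sup>2" "0 \<le> (y $ 3)\<^sup>2" by simp_all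
  then have "0 < 1 + (y $ 1)\<^sup>2 + (y $ 2)\<^sup>2 + (y $ 3)\<^sup>2" by linarith
  ultimately show ?thesis
    by (simp add: sheet_lift_def mult.assoc[symmetric] zero_less_mult_iff not_less
        flip: power2_eq_square)
qed

lemma sheet_lift_H3: "\<sigma>\<^sup>2 = 1 \<Longrightarrow> sheet_lift \<sigma> y \<in> H3"
proof -
  assume \<sigma>: "\<sigma>\<^sup>2 = 1"
  have "0 \<le> (y $ 1)\<^sup>2" "0 \<le> (y $ 2)\<^sup>2" "0 \<le> (y $ 3)\<^sup>2" by simp_all
  then have "0 \<le> 1 + (y $ 1)\<^sup>2 + (y $ 2)\<^sup>2 + (y $ 3)\<^sup>2" by linarith
  then have "(sheet_lift \<sigma> y $ 0)\<^sup>2 = 1 + (y $ 1)\<^sup>2 + (y $ 2)\<^sup>2 + (y $ 3)\<^sup>2"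
    using \<sigma> by (simp add: sheet_lift_def power_mult_distrib)
  then show ?thesis
    by (simp add: H3_def lprod_def sheet_lift_def power2_eq_square)
qed

lemma sheet_lift_spatial:
  assumes "x \<in> H3" "\<sigma>\<^sup>2 = 1" "\<sigma> * x $ 0 > 0"
  shows "sheet_lift \<sigma> (spatial x) = x"
proof -
  have "(x $ 0)\<^sup>2 = 1 + (x $ 1)\<^sup>2 + (x $ 2)\<^sup>2 + (x $ 3)\<^sup>2"
    using assms(1) by (simp add: H3_def lprod_def power2_eq_square)
  then have "sqrt (1 + (x $ 1)\<^sup>2 + (x $ 2)\<^sup>2 + (x $ 3)\<^sup>2) = \<bar>x $ 0\<bar>"
    by (metis real_sqrt_abs)
  moreover have "\<sigma> * \<bar>x $ 0\<bar> = x $ 0"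
    using assms(2,3) by (auto simp: power2_eq_1_iff abs_if)
  ultimately show ?thesis
    by (simp add: vec_eq_iff forall_4' sheet_lift_def spatial_def)
qed

lemma isCont_preimage_ball:
  fixes f :: "real \<Rightarrow> 'a::topological_space"
  assumes "isCont f a" "open S" "f a \<in> S"
  obtains e where "e > 0" "\<And>x. \<bar>x - a\<bar> < e \<Longrightarrow> f x \<in> S"
proof -
  obtain T where T: "open T" "a \<in> T" "\<And>x. x \<in> T \<Longrightarrow> f x \<in> S"
    using assms(1)[unfolded continuous_at_open, rule_format, OF conjI[OF assms(2,3)]] by metis
  then obtain e where "e > 0" "ball a e \<subseteq> T"
    using openE by blast
  then show thesis
    using that[of e] T(3) by (auto simp: ball_def dist_real_def abs_minus_commute)
qed

text \<open>The local diffeomorphism of hyperbolic space is the spatial projection followed by the local inverse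
  of \<open>\<Psi>\<close>; it takes the curve to the model curve \<open>m\<close>.\<close>

lemma curve_in_H3_locally_diffeomorphic:
  fixes \<alpha> :: "real \<Rightarrow> real ^ 4" and m :: "real \<Rightarrow> real ^ 3"
  assumes \<alpha>: "r > 0" "\<And>u. \<bar>u\<bar> < r \<Longrightarrow> s0 + u \<in> D \<and> \<alpha> (s0 + u) \<in> H3"
    and cont: "isCont \<alpha> s0"
    and \<Psi>: "open U" "0 \<in> U" "smooth_on U \<Psi>" "inj (frechet_derivative \<Psi> (at 0))"
    and model: "\<And>u. \<bar>u\<bar> < r \<Longrightarrow> m u \<in> U \<and> \<Psi> (m u) = spatial (\<alpha> (s0 + u))"
    and m: "isCont m 0" "m 0 = 0"
    and germ: "\<And>e. e > 0 \<Longrightarrow> same_germ 0 (m ` {-e<..<e}) Z"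
  shows "curve_locally_diffeomorphic H3 D \<alpha> s0 Z"
proof -
  obtain W V' g where W: "open W" "W \<subseteq> U" "0 \<in> W" and V': "open V'" "\<Psi> 0 \<in> V'"
    and hom: "homeomorphism W V' \<Psi> g" and g: "smooth_on V' g"
    using smooth_inverse_function[OF \<Psi>(1,3,2,4)] by metis
  have \<alpha>0: "\<alpha> s0 \<in> H3" "s0 \<in> D" "spatial (\<alpha> s0) = \<Psi> 0"
    using \<alpha>(2)[of 0] \<alpha>(1) model[of 0] m(2) by auto
  have "\<alpha> s0 $ 0 \<noteq> 0"
  proof
    assume "\<alpha> s0 $ 0 = 0"
    then have "\<alpha> s0 $ 0 * \<alpha> s0 $ 0 = 0" by simp
    moreover have "0 \<le> \<alpha> s0 $ 1 * \<alpha> s0 $ 1" "0 \<le> \<alpha> s0 $ 2 * \<alpha> s0 $ 2" "0 \<le> \<alpha> s0 $ 3 * \<alpha> s0 $ 3"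
      by simp_all
    ultimately have "lprod (\<alpha> s0) (\<alpha> s0) \<ge> 0"
      unfolding lprod_def by linarith
    then show False
      using \<alpha>0(1) by (simp add: H3_def)
  qed
  define \<sigma> where "\<sigma> = sgn (\<alpha> s0 $ 0)"
  have \<sigma>: "\<sigma>\<^sup>2 = 1" "\<sigma> * \<alpha> s0 $ 0 > 0"
    using \<open>\<alpha> s0 $ 0 \<noteq> 0\<close> by (auto simp: \<sigma>_def sgn_if)
  have sp_cont: "continuous_on A spatial" for A
    by (rule linear_continuous_on[OF bounded_linear_spatial])
  define N where "N = {x. \<sigma> * x $ 0 > 0} \<inter> spatial -` V'"
  have N: "open N"
    unfolding N_def
    by (intro open_Int open_Collect_less continuous_intros open_vimage V' sp_cont)
  define V where "V = H3 \<inter> N"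
  define \<Phi> where "\<Phi> x = g (spatial x)" for x
  define \<Theta> where "\<Theta> w = sheet_lift \<sigma> (\<Psi> w)" for w
  have g\<Psi>: "g (\<Psi> w) = w" if "w \<in> W" for w using hom that by (simp add: homeomorphism_def)
  have \<Psi>g: "\<Psi> (g y) = y" if "y \<in> V'" for y using hom that by (simp add: homeomorphism_def)
  have gW: "g y \<in> W" if "y \<in> V'" for y using hom that by (auto simp: homeomorphism_def)
  have \<Psi>V: "\<Psi> w \<in> V'" if "w \<in> W" for w using hom that by (auto simp: homeomorphism_def)
  have sm\<Theta>: "smooth_on W \<Theta>"
    unfolding \<Theta>_def
    by (rule smooth_on_compose[OF W(1) open_UNIV smooth_on_subset[OF \<Psi>(3) W(2)] smooth_on_sheet_lift]) auto
  have sm\<Phi>: "smooth_on N \<Phi>"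
    unfolding \<Phi>_def
    by (rule smooth_on_compose[OF N V'(1) smooth_on_bounded_linear[OF N bounded_linear_spatial] g])
       (auto simp: N_def)
  have \<Theta>V: "\<Theta> w \<in> V" if "w \<in> W" for w
    using \<Psi>V[OF that] sheet_lift_H3[OF \<sigma>(1)] sheet_lift_time[of \<sigma> "\<Psi> w"] \<sigma>
    by (cases "\<sigma> = 0") (auto simp: V_def N_def \<Theta>_def spatial_sheet_lift)
  have \<Phi>W: "\<Phi> x \<in> W" "\<Theta> (\<Phi> x) = x" if "x \<in> V" for x
    using that gW sheet_lift_spatial[OF _ \<sigma>(1), of x] by (auto simp: V_def N_def \<Phi>_def \<Theta>_def \<Psi>g)
  have \<Phi>\<Theta>: "\<Phi> (\<Theta> w) = w" if "w \<in> W" for w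
    using g\<Psi>[OF that] by (simp add: \<Phi>_def \<Theta>_def spatial_sheet_lift)
  have "homeomorphism V W \<Phi> \<Theta>"
  proof (rule homeomorphismI)
    show "continuous_on V \<Phi>"
      using smooth_on_continuous[OF sm\<Phi>] by (rule continuous_on_subset) (simp add: V_def)
    show "continuous_on W \<Theta>" by (rule smooth_on_continuous[OF sm\<Theta>])
  qed (use \<Phi>W \<Phi>\<Theta> \<Theta>V in auto)
  moreover have "smooth_map_on V \<Phi>"
    using N sm\<Phi> unfolding smooth_map_on_def V_def by blast
  moreover have "smooth_map_on W \<Theta>"
    using W(1) sm\<Theta> unfolding smooth_map_on_def by blast
  ultimately have diff: "diffeomorphism V W \<Phi> \<Theta>"
    by (simp add: diffeomorphism_def)
  have \<alpha>V: "\<alpha> s0 \<in> N"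
    using \<alpha>0 \<sigma> V'(2) by (simp add: N_def)
  obtain e1 where e1: "e1 > 0" "\<And>s. \<bar>s - s0\<bar> < e1 \<Longrightarrow> \<alpha> s \<in> N"
    using isCont_preimage_ball[OF cont N \<alpha>V] by metis
  obtain e2 where e2: "e2 > 0" "\<And>u. \<bar>u - 0\<bar> < e2 \<Longrightarrow> m u \<in> W"
    using isCont_preimage_ball[OF m(1) W(1)] W(3) m(2) by metis
  define e0 where "e0 = min r (min e1 e2)"
  have e0: "e0 > 0" using \<alpha>(1) e1(1) e2(1) by (simp add: e0_def)
  have "\<Phi> ` (V \<inter> \<alpha> ` (D \<inter> ball s0 \<epsilon>)) = m ` {-\<epsilon><..<\<epsilon>}" if \<epsilon>: "0 < \<epsilon>" "\<epsilon> < e0" for \<epsilon>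
  proof -
    have *: "\<alpha> (s0 + u) \<in> V \<and> s0 + u \<in> D \<and> \<Phi> (\<alpha> (s0 + u)) = m u" if "\<bar>u\<bar> < \<epsilon>" for u
    proof -
      have "\<bar>u\<bar> < r" "\<bar>u\<bar> < e1" "\<bar>u\<bar> < e2" using that \<epsilon> by (auto simp: e0_def)
      then show ?thesis
        using e1(2)[of "s0 + u"] e2(2)[of u] \<alpha>(2)[of u] model[of u] g\<Psi>[of "m u"]
        by (simp add: V_def \<Phi>_def)
    qed
    have "V \<inter> \<alpha> ` (D \<inter> ball s0 \<epsilon>) = (\<lambda>u. \<alpha> (s0 + u)) ` {-\<epsilon><..<\<epsilon>}"
    proof (intro equalityI subsetI)
      fix x assume "x \<in> V \<inter> \<alpha> ` (D \<inter> ball s0 \<epsilon>)"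
      then obtain s where "x = \<alpha> s" "\<bar>s - s0\<bar> < \<epsilon>"
        by (auto simp: dist_real_def abs_minus_commute)
      then show "x \<in> (\<lambda>u. \<alpha> (s0 + u)) ` {-\<epsilon><..<\<epsilon>}"
        by (intro image_eqI[of _ _ "s - s0"]) (auto simp: abs_less_iff)
    next
      fix x assume "x \<in> (\<lambda>u. \<alpha> (s0 + u)) ` {-\<epsilon><..<\<epsilon>}"
      then obtain u where "x = \<alpha> (s0 + u)" "\<bar>u\<bar> < \<epsilon>"
        by (auto simp: abs_less_iff)
      then show "x \<in> V \<inter> \<alpha> ` (D \<inter> ball s0 \<epsilon>)"
        using *[of u] by (auto simp: dist_real_def)
    qed
    then show ?thesis
      using * by (auto simp: image_image abs_less_iff intro!: image_cong)
  qed
  then have "\<forall>\<^sub>F \<epsilon> in at_right 0. same_germ 0 (\<Phi> ` (V \<inter> \<alpha> ` (D \<inter> ball s0 \<epsilon>))) Z"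
    using germ e0 unfolding eventually_at_right_field by (metis less_le_trans)
  moreover have "openin (top_of_set H3) V"
    unfolding V_def using N by (simp add: openin_open_Int)
  moreover have "\<Phi> (\<alpha> s0) = 0"
    using g\<Psi>[OF W(3)] \<alpha>0(3) by (simp add: \<Phi>_def)
  ultimately show ?thesis
    unfolding curve_locally_diffeomorphic_def
    using \<alpha>0 \<alpha>V diff W(1,3) unfolding V_def by blast
qed

lemma same_germ_line:
  fixes d :: "'a::real_normed_vector"
  assumes "d \<noteq> 0" "e > 0"
  shows "same_germ 0 ((\<lambda>u. u *\<^sub>R d) ` {-e<..<e}) (span {d})"
  unfolding same_germ_def
proof (intro exI conjI)
  show "open (ball 0 (e * norm d))" by simp
  show "0 \<in> ball 0 (e * norm d)" using assms by simp
  show "(\<lambda>u. u *\<^sub>R d) ` {-e<..<e} \<inter> ball 0 (e * norm d) = span {d} \<inter> ball 0 (e * norm d)"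
    using assms by (auto simp: span_singleton abs_less_iff image_iff)
qed

text \<open>On the cusp, the parameter interval is cut out by the first coordinate \<open>u\<^sup>2\<close>.\<close>

lemma same_germ_cusp:
  assumes "e > 0"
  shows "same_germ 0 ((\<lambda>u. vector [u ^ 2, u ^ 3, u ^ 4]) ` {-e<..<e}) cusp234"
  unfolding same_germ_def
proof (intro exI conjI)
  let ?W = "{x :: real ^ 3. x $ 1 < e\<^sup>2}"
  show "open ?W" by (intro open_Collect_less continuous_intros)
  show "0 \<in> ?W" using assms by simp
  have "u\<^sup>2 < e\<^sup>2 \<longleftrightarrow> u \<in> {-e<..<e}" for u
    using abs_le_square_iff[of e u] assms by (auto simp: not_le[symmetric] abs_le_iff)
  then show "(\<lambda>u. vector [u ^ 2, u ^ 3, u ^ 4]) ` {-e<..<e} \<inter> ?W = cusp234 \<inter> ?W"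
    by (auto simp: cusp234_def)
qed

section \<open>Lorentzian linear algebra\<close>

lemma bounded_bilinear_lprod: "bounded_bilinear lprod"
  by (rule bilinear_conv_bounded_bilinear[THEN iffD1])
     (auto simp: bilinear_def lprod_def algebra_simps intro!: linearI)

interpretation lprod: bounded_bilinear lprod
  by (rule bounded_bilinear_lprod)

lemma lprod_commute: "lprod x y = lprod y x"
  by (simp add: lprod_def mult.commute)

lemmas smooth_on_lprod = smooth_on_bilinear[OF _ bounded_bilinear_lprod]

lemma lprod_nondegenerate:
  assumes "\<And>y. lprod x y = 0"
  shows "x = 0"
  using assms[of "axis 0 1"] assms[of "axis 1 1"] assms[of "axis 2 1"] assms[of "axis 3 1"]
  by (simp add: lprod_def axis_def vec_eq_iff forall_4')

text \<open>The inequality of Cauchy and Schwarz for the spatial parts.\<close>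

lemma lprod_orthogonal_timelike_nonneg:
  assumes "lprod n n = -1" "lprod n a = 0"
  shows "lprod a a \<ge> 0"
proof -
  define N where "N = n $ 1 * n $ 1 + n $ 2 * n $ 2 + n $ 3 * n $ 3"
  define A where "A = a $ 1 * a $ 1 + a $ 2 * a $ 2 + a $ 3 * a $ 3"
  define P where "P = n $ 1 * a $ 1 + n $ 2 * a $ 2 + n $ 3 * a $ 3"
  have n: "n $ 0 * n $ 0 = 1 + N" and p: "n $ 0 * a $ 0 = P"
    using assms by (simp_all add: lprod_def N_def P_def)
  have "N * A - P * P = (n $ 1 * a $ 2 - n $ 2 * a $ 1)\<^sup>2 + (n $ 1 * a $ 3 - n $ 3 * a $ 1)\<^sup>2
      + (n $ 2 * a $ 3 - n $ 3 * a $ 2)\<^sup>2"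
    unfolding N_def A_def P_def by (simp add: power2_eq_square algebra_simps)
  then have "P * P \<le> N * A"
    by (smt (verit) zero_le_power2)
  moreover have "P * P = (1 + N) * (a $ 0 * a $ 0)"
    unfolding p[symmetric] n[symmetric] by (simp add: algebra_simps)
  moreover have "N \<ge> 0" "A \<ge> 0" by (simp_all add: N_def A_def)
  ultimately have "(1 + N) * (a $ 0 * a $ 0) \<le> (1 + N) * A"
    by (simp add: distrib_right)
  then have "a $ 0 * a $ 0 \<le> A"
    using \<open>N \<ge> 0\<close> by (simp add: mult_le_cancel_left)
  then show ?thesis by (simp add: lprod_def A_def)
qed

lemma lprod_span_eq_0:
  assumes "y \<in> span S" "\<And>s. s \<in> S \<Longrightarrow> lprod x s = 0"
  shows "lprod x y = 0"
  using assms(1)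
  by (induction rule: span_induct_alt)
     (simp_all add: lprod.zero_right lprod.add_right lprod.scaleR_right assms(2))

text \<open>The four vectors span the space, by dimension, and the product is nondegenerate.\<close>

lemma pseudo_orthonormal_complete:
  assumes "lprod a a = -1" "lprod b b = 1" "lprod c c = 1" "lprod d d = 1"
    and "lprod a b = 0" "lprod a c = 0" "lprod a d = 0" "lprod b c = 0" "lprod b d = 0" "lprod c d = 0"
    and x: "lprod x a = 0" "lprod x b = 0" "lprod x c = 0" "lprod x d = 0"
  shows "x = 0"
proof -
  have "a \<notin> span {b, c, d}" "b \<notin> span {c, d}" "c \<notin> span {d}"
    using lprod_span_eq_0[of a "{b, c, d}" a] lprod_span_eq_0[of b "{c, d}" b] lprod_span_eq_0[of c "{d}" c]
      assms by auto
  moreover have "d \<noteq> 0" using assms(4) by (auto simp: lprod.zero_left)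
  ultimately have "dim {a, b, c, d} = DIM(real ^ 4)"
    by (simp add: dim_insert)
  then have "span {a, b, c, d} = UNIV" using dim_eq_full by blast
  then show "x = 0"
    using lprod_span_eq_0[of _ "{a, b, c, d}" x] x by (intro lprod_nondegenerate) auto
qed

lemma lwedge_components:
  "lwedge x y z $ 0 = - (x $ 1 * (y $ 2 * z $ 3 - y $ 3 * z $ 2) - x $ 2 * (y $ 1 * z $ 3 - y $ 3 * z $ 1)
     + x $ 3 * (y $ 1 * z $ 2 - y $ 2 * z $ 1))"
  "lwedge x y z $ 1 = - (x $ 0 * (y $ 2 * z $ 3 - y $ 3 * z $ 2) - x $ 2 * (y $ 0 * z $ 3 - y $ 3 * z $ 0)
     + x $ 3 * (y $ 0 * z $ 2 - y $ 2 * z $ 0))"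
  "lwedge x y z $ 2 = x $ 0 * (y $ 1 * z $ 3 - y $ 3 * z $ 1) - x $ 1 * (y $ 0 * z $ 3 - y $ 3 * z $ 0)
     + x $ 3 * (y $ 0 * z $ 1 - y $ 1 * z $ 0)"
  "lwedge x y z $ 3 = - (x $ 0 * (y $ 1 * z $ 2 - y $ 2 * z $ 1) - x $ 1 * (y $ 0 * z $ 2 - y $ 2 * z $ 0)
     + x $ 2 * (y $ 0 * z $ 1 - y $ 1 * z $ 0))"
proof -
  have f0: "finite {1::4, 2, 3}" "0 \<notin> {1::4, 2, 3}" by auto
  have f1: "finite {2::4, 3}" "1 \<notin> {2::4, 3}" by auto
  have f2: "finite {3::4}" "2 \<notin> {3::4}" by auto
  note expand = det_def UNIV_4' sum_over_permutations_insert[OF f0] sum_over_permutations_insert[OF f1]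
    sum_over_permutations_insert[OF f2] permutes_sing
  note sgn = sign_swap_id permutation_swap_id sign_compose sign_id permutation_compose transpose_def
  show
    "lwedge x y z $ 0 = - (x $ 1 * (y $ 2 * z $ 3 - y $ 3 * z $ 2) - x $ 2 * (y $ 1 * z $ 3 - y $ 3 * z $ 1)
     + x $ 3 * (y $ 1 * z $ 2 - y $ 2 * z $ 1))"
    "lwedge x y z $ 1 = - (x $ 0 * (y $ 2 * z $ 3 - y $ 3 * z $ 2) - x $ 2 * (y $ 0 * z $ 3 - y $ 3 * z $ 0)
     + x $ 3 * (y $ 0 * z $ 2 - y $ 2 * z $ 0))"
    "lwedge x y z $ 2 = x $ 0 * (y $ 1 * z $ 3 - y $ 3 * z $ 1) - x $ 1 * (y $ 0 * z $ 3 - y $ 3 * z $ 0)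
     + x $ 3 * (y $ 0 * z $ 1 - y $ 1 * z $ 0)"
    "lwedge x y z $ 3 = - (x $ 0 * (y $ 1 * z $ 2 - y $ 2 * z $ 1) - x $ 1 * (y $ 0 * z $ 2 - y $ 2 * z $ 0)
     + x $ 2 * (y $ 0 * z $ 1 - y $ 1 * z $ 0))"
    unfolding lwedge_def expand by (simp_all add: sgn axis_def algebra_simps)
qed

lemma lprod_lwedge:
  "lprod (lwedge x y z) x = 0" "lprod (lwedge x y z) y = 0" "lprod (lwedge x y z) z = 0"
  by (simp_all add: lprod_def lwedge_components algebra_simps)

text \<open>The square of the wedge product is minus the Gram determinant.\<close>

lemma lprod_lwedge_lwedge:
  "lprod (lwedge x y z) (lwedge x y z) = - (lprod x x * (lprod y y * lprod z z - lprod y z * lprod y z)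
     - lprod x y * (lprod x y * lprod z z - lprod y z * lprod x z)
     + lprod x z * (lprod x y * lprod y z - lprod y y * lprod x z))"
  unfolding lprod_def lwedge_components by algebra

lemma smooth_on_lwedge:
  assumes "open S" "smooth_on S x" "smooth_on S y" "smooth_on S z"
  shows "smooth_on S (\<lambda>s. lwedge (x s) (y s) (z s))"
proof (rule smooth_on_vec[OF assms(1)])
  fix i
  have c: "smooth_on S (\<lambda>s. x s $ j)" "smooth_on S (\<lambda>s. y s $ j)" "smooth_on S (\<lambda>s. z s $ j)" for j
    using assms by (auto intro: smooth_on_component)
  have "smooth_on S (\<lambda>s. lwedge (x s) (y s) (z s) $ 0)" "smooth_on S (\<lambda>s. lwedge (x s) (y s) (z s) $ 1)"
    "smooth_on S (\<lambda>s. lwedge (x s) (y s) (z s) $ 2)" "smooth_on S (\<lambda>s. lwedge (x s) (y s) (z s) $ 3)"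
    unfolding lwedge_components
    by (intro smooth_on_add smooth_on_diff smooth_on_mult smooth_on_uminus c assms(1))+
  then show "smooth_on S (\<lambda>s. lwedge (x s) (y s) (z s) $ i)"
    using exhaust_4'[of i] by auto
qed

lemma tanh_artanh_real:
  fixes x :: real
  assumes "\<bar>x\<bar> < 1"
  shows "tanh (artanh x) = x"
proof -
  have "exp (- 2 * artanh x) = (1 - x) / (1 + x)"
  proof -
    have "- 2 * artanh x = - ln ((1 + x) / (1 - x))" by (simp add: artanh_def)
    then show ?thesis using assms by (simp add: exp_minus abs_less_iff)
  qed
  then show ?thesis
    unfolding tanh_real_altdef by (simp only:) (use assms in \<open>simp add: field_simps abs_less_iff\<close>)
qed

lemma cosh_artanh_real:
  fixes x :: real
  assumes "\<bar>x\<bar> < 1"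
  shows "cosh (artanh x) = 1 / sqrt (1 - x\<^sup>2)" "sinh (artanh x) = x / sqrt (1 - x\<^sup>2)"
proof -
  let ?c = "cosh (artanh x)"
  have c: "?c > 0" by simp
  have s: "sinh (artanh x) = x * ?c"
    using tanh_artanh_real[OF assms] c unfolding tanh_def by (simp add: field_simps)
  have "?c\<^sup>2 - (x * ?c)\<^sup>2 = 1"
    using hyperbolic_pythagoras[of "artanh x"] s by simp
  then have "?c\<^sup>2 * (1 - x\<^sup>2) = 1" by (simp add: algebra_simps power_mult_distrib)
  then have "sqrt (?c\<^sup>2 * (1 - x\<^sup>2)) = 1" by simp
  then have "?c * sqrt (1 - x\<^sup>2) = 1" using c by (simp add: real_sqrt_mult)
  moreover from this have "sqrt (1 - x\<^sup>2) \<noteq> 0" by auto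
  ultimately show "?c = 1 / sqrt (1 - x\<^sup>2)" by (simp add: field_simps)
  then show "sinh (artanh x) = x / sqrt (1 - x\<^sup>2)" using s by simp
qed

section \<open>The moving frame\<close>

locale curve_in_hypersurface =
  fixes U :: "(real ^ 3) set" and X :: "real ^ 3 \<Rightarrow> real ^ 4" and n :: "real ^ 4 \<Rightarrow> real ^ 4"
    and I :: "real set" and \<beta> :: "real \<Rightarrow> real ^ 3" and \<gamma> :: "real \<Rightarrow> real ^ 4"
  assumes hypersurface: "spacelike_hypersurface U X"
    and normal: "future_unit_normal U X n"
    and open_I: "open I"
    and curve: "unit_speed_curve U X I \<beta> \<gamma>"
    and kg_nonzero: "\<And>s. s \<in> I \<Longrightarrow> kg n \<gamma> s \<noteq> 0"
    and twist_nonzero: "\<And>s. s \<in> I \<Longrightarrow> kn n \<gamma> s * tau2 n \<gamma> s + kg n \<gamma> s * taug n \<gamma> s \<noteq> 0"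
    and kg_dominates: "\<And>s. s \<in> I \<Longrightarrow> (kg n \<gamma> s)\<^sup>2 > (kn n \<gamma> s)\<^sup>2"
begin

abbreviation "N \<equiv> n_gamma n \<gamma>"
abbreviation "t \<equiv> tangent \<gamma>"
abbreviation "k \<equiv> kn n \<gamma>"
abbreviation "g \<equiv> kg n \<gamma>"
abbreviation "e1 \<equiv> n1 n \<gamma>"
abbreviation "e2 \<equiv> n2 n \<gamma>"

lemma open_U: "open U" and smooth_X: "smooth_on U X"
  using hypersurface by (auto simp: spacelike_hypersurface_def smooth_embedding_def)

lemma smooth_\<beta>: "smooth_on I \<beta>" and \<beta>_in: "s \<in> I \<Longrightarrow> \<beta> s \<in> U" and \<gamma>_eq: "s \<in> I \<Longrightarrow> \<gamma> s = X (\<beta> s)"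
  using curve by (auto simp: unit_speed_curve_def)

lemma \<beta>_image: "\<beta> ` I \<subseteq> U" using \<beta>_in by auto

lemma tangent_vderiv: "t = vderiv \<gamma>"
  by (simp add: tangent_def vderiv_def fun_eq_iff)

lemma smooth_\<gamma>: "smooth_on I \<gamma>"
  using smooth_on_compose[OF open_I open_U smooth_\<beta> smooth_X \<beta>_image] smooth_on_cong[OF open_I] \<gamma>_eq
  by metis

lemma smooth_t: "smooth_on I t"
  unfolding tangent_vderiv by (rule smooth_on_vderiv[OF open_I smooth_\<gamma>])

lemma tangent_in_range:
  assumes "s \<in> I"
  shows "t s \<in> range (frechet_derivative X (at (\<beta> s)))"
proof -
  have "((\<lambda>s. X (\<beta> s)) has_vector_derivative frechet_derivative X (at (\<beta> s)) (vector_derivative \<beta> (at s))) (at s)"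
    using vector_derivative_diff_chain_within[OF smooth_on_has_vector_derivative[OF smooth_\<beta> assms]
        has_derivative_at_withinI[OF smooth_on_has_derivative[OF smooth_X \<beta>_in[OF assms]]]]
    by (simp add: o_def)
  then have "(\<gamma> has_vector_derivative frechet_derivative X (at (\<beta> s)) (vector_derivative \<beta> (at s))) (at s)"
    by (rule has_vector_derivative_transform_within_open[OF _ open_I assms]) (simp add: \<gamma>_eq)
  then show ?thesis
    by (simp add: tangent_def vector_derivative_at)
qed

lemma spacelike_range:
  assumes "s \<in> I" "x \<in> range (frechet_derivative X (at (\<beta> s)))" "x \<noteq> 0"
  shows "lprod x x > 0"
  using assms hypersurface \<beta>_in by (auto simp: spacelike_hypersurface_def spacelike_def)

lemma t_unit: "s \<in> I \<Longrightarrow> lprod (t s) (t s) = 1"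
proof -
  assume s: "s \<in> I"
  have 1: "sqrt \<bar>lprod (t s) (t s)\<bar> = 1"
    using curve s by (simp add: unit_speed_curve_def lnorm_def tangent_def)
  then have "t s \<noteq> 0" by (auto simp: lprod.zero_left)
  then show "lprod (t s) (t s) = 1"
    using spacelike_range[OF s tangent_in_range[OF s]] 1 by simp
qed

lemma N_normal: "s \<in> I \<Longrightarrow> x \<in> range (frechet_derivative X (at (\<beta> s))) \<Longrightarrow> lprod (N s) x = 0"
  and N_unit: "s \<in> I \<Longrightarrow> lprod (N s) (N s) = -1"
  and N_future: "s \<in> I \<Longrightarrow> N s $ 0 > 0"
proof -
  assume "s \<in> I"
  then have "timelike (n (X (\<beta> s))) \<and> lnorm (n (X (\<beta> s))) = 1 \<and> lprod (n (X (\<beta> s))) (axis 0 1) < 0 \<and>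
        (\<forall>x\<in>range (frechet_derivative X (at (\<beta> s))). lprod (n (X (\<beta> s))) x = 0)"
    using normal \<beta>_in unfolding future_unit_normal_def by blast
  then have *: "timelike (N s)" "lnorm (N s) = 1" "lprod (N s) (axis 0 1) < 0"
    "\<forall>x\<in>range (frechet_derivative X (at (\<beta> s))). lprod (N s) x = 0"
    using \<open>s \<in> I\<close> by (simp_all add: n_gamma_def \<gamma>_eq)
  show "x \<in> range (frechet_derivative X (at (\<beta> s))) \<Longrightarrow> lprod (N s) x = 0" using *(4) by blast
  show "lprod (N s) (N s) = -1" using *(1,2) by (auto simp: timelike_def lnorm_def)
  show "N s $ 0 > 0" using *(3) by (simp add: lprod_def axis_def)
qed

text \<open>The tangent space and the normal span everything. A vector orthogonal to the tangent space thus is a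
  multiple of the normal, since its tangential part is orthogonal to itself and the tangent space is
  positive definite.\<close>

lemma normal_direction_unique:
  assumes s: "s \<in> I" and x: "\<And>h. lprod (frechet_derivative X (at (\<beta> s)) h) x = 0" "x $ 0 = 0"
  shows "x = 0"
proof -
  let ?D = "frechet_derivative X (at (\<beta> s))"
  have lin: "linear ?D"
    using has_derivative_linear[OF smooth_on_has_derivative[OF smooth_X \<beta>_in[OF s]]] .
  have inj: "inj ?D"
    using hypersurface \<beta>_in[OF s] by (simp add: spacelike_hypersurface_def smooth_embedding_def)
  have sp: "span (range ?D) = range ?D"
    using linear_subspace_image[OF lin subspace_UNIV] span_eq_iff by blast
  have "N s \<notin> range ?D"
    using N_normal[OF s, of "N s"] N_unit[OF s] by auto
  then have "N s \<notin> span (range ?D)" using sp by metis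
  moreover have "dim (range ?D) = 3"
    using dim_image_eq[OF lin, of UNIV] inj by simp
  ultimately have "dim (insert (N s) (range ?D)) = DIM(real ^ 4)"
    by (simp add: dim_insert)
  then have "x \<in> span (insert (N s) (range ?D))" using dim_eq_full by blast
  then obtain b where "x - b *\<^sub>R N s \<in> span (range ?D)"
    unfolding span_breakdown_eq by blast
  then have b: "x - b *\<^sub>R N s \<in> range ?D" using sp by metis
  define y where "y = x - b *\<^sub>R N s"
  have "lprod y y = lprod y x - b * lprod y (N s)"
    by (simp add: y_def lprod.diff_right lprod.scaleR_right)
  moreover have "lprod y x = 0" "lprod y (N s) = 0"
    using b x(1) N_normal[OF s] by (auto simp: y_def lprod_commute[of _ "N s"])
  ultimately have "y = 0" using spacelike_range[OF s, of y] b by (auto simp: y_def)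
  then have xb: "x = b *\<^sub>R N s" by (simp add: y_def)
  then have "b = 0" using x(2) N_future[OF s] by simp
  then show "x = 0" using xb by simp
qed

text \<open>The normal field is only given by its values. Rescaled to have time coordinate 1, it is the solution
  of a linear system with smooth coefficients, and the normalization is then recovered by a square root.\<close>

lemma smooth_N: "smooth_on I N"
proof -
  define m where "m s = (1 / N s $ 0) *\<^sub>R N s" for s
  define L where "L s x = (\<chi> i::4. if i = 0 then x $ 0
     else lprod (frechet_derivative X (at (\<beta> s)) (if i = 1 then axis 1 1 else if i = 2 then axis 2 1 else axis 3 1)) x)"
    for s and x :: "real ^ 4"
  have lin: "linear (L s)" for s
    by (rule linearI) (auto simp: L_def vec_eq_iff lprod.add_right lprod.scaleR_right)
  have "smooth_on I m"
    unfolding smooth_on_def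
  proof (rule allI, rule higher_diff_linear_system[OF open_I, where L = L and b = "\<lambda>_. axis 0 1"])
    fix d
    show "linear (L s)" for s by (rule lin)
    show "inj (L s)" if s: "s \<in> I" for s
    proof (subst linear_injective_0[OF lin], intro allI impI)
      fix x assume x: "L s x = 0"
      let ?D = "frechet_derivative X (at (\<beta> s))"
      have linD: "linear ?D"
        using has_derivative_linear[OF smooth_on_has_derivative[OF smooth_X \<beta>_in[OF s]]] .
      have *: "L s x $ i = 0" for i using x by simp
      have ax: "lprod x (?D (axis 1 1)) = 0" "lprod x (?D (axis 2 1)) = 0" "lprod x (?D (axis 3 1)) = 0"
        using *[of 1] *[of 2] *[of 3] by (simp_all add: L_def lprod_commute[of x])
      have "lprod (?D h) x = 0" for h
      proof -
        have h: "h = h $ 1 *\<^sub>R axis 1 1 + h $ 2 *\<^sub>R axis 2 1 + h $ 3 *\<^sub>R axis 3 1"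
          by (simp add: vec_eq_iff forall_3 axis_def)
        have "?D h = h $ 1 *\<^sub>R ?D (axis 1 1) + h $ 2 *\<^sub>R ?D (axis 2 1) + h $ 3 *\<^sub>R ?D (axis 3 1)"
          by (subst h) (simp add: linear_add[OF linD] linear_scale[OF linD])
        then show ?thesis
          using ax by (simp add: lprod_commute[of _ x] lprod.add_right lprod.scaleR_right)
      qed
      then show "x = 0"
        using *[of 0] by (intro normal_direction_unique[OF s]) (simp_all add: L_def)
    qed
    show "higher_differentiable_on I (\<lambda>s. L s v) d" for v
    proof -
      have "smooth_on I (\<lambda>s. L s v)"
      proof (rule smooth_on_vec[OF open_I])
        fix i
        have "smooth_on I (\<lambda>s. lprod (frechet_derivative X (at (\<beta> s)) w) v)" for w
          using smooth_on_compose[OF open_I open_U smooth_\<beta> smooth_on_frechet[OF smooth_X] \<beta>_image]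
          by (intro smooth_on_lprod open_I smooth_on_const)
        then show "smooth_on I (\<lambda>s. L s v $ i)"
          using smooth_on_const[OF open_I] by (cases "i = 0") (simp_all add: L_def)
      qed
      then show ?thesis by (simp add: smooth_on_def)
    qed
    show "higher_differentiable_on I (\<lambda>s. axis 0 1 :: real ^ 4) d"
      by (rule higher_diff_const[OF open_I])
    show "L s (m s) = axis 0 1" if s: "s \<in> I" for s
      using N_normal[OF s] N_future[OF s]
      by (auto simp: vec_eq_iff L_def m_def axis_def lprod.scaleR_right lprod_commute[of _ "N s"])
  qed
  then have "smooth_on I (\<lambda>s. inverse (sqrt (- lprod (m s) (m s))) *\<^sub>R m s)"
    by (intro smooth_on_scaleR smooth_on_inverse smooth_on_sqrt smooth_on_uminus smooth_on_lprod open_I)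
       (use N_unit N_future in \<open>force simp: m_def lprod.scaleR_right lprod.scaleR_left\<close>)+
  moreover have "inverse (sqrt (- lprod (m s) (m s))) *\<^sub>R m s = N s" if "s \<in> I" for s
  proof -
    have "- lprod (m s) (m s) = (1 / N s $ 0)\<^sup>2"
      using N_unit[OF that] by (simp add: m_def lprod.scaleR_right lprod.scaleR_left power2_eq_square)
    then have "sqrt (- lprod (m s) (m s)) = 1 / N s $ 0"
      using N_future[OF that] by simp
    then show ?thesis using N_future[OF that] by (simp add: m_def)
  qed
  ultimately show ?thesis using smooth_on_cong[OF open_I] by (metis (mono_tags, lifting))
qed

abbreviation "t' \<equiv> vderiv t"
abbreviation "t'' \<equiv> vderiv (vderiv t)"

lemma smooth_t': "smooth_on I t'"
  by (intro smooth_on_vderiv open_I smooth_t)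

lemma k_eq: "k s = - lprod (N s) (t' s)"
  by (simp add: kn_def vderiv_def)

lemma g_eq: "g s = sqrt \<bar>lprod (t' s - k s *\<^sub>R N s) (t' s - k s *\<^sub>R N s)\<bar>"
  by (simp add: kg_def vderiv_def lnorm_def)

lemma smooth_k: "smooth_on I k"
  unfolding k_eq[abs_def] by (intro smooth_on_uminus smooth_on_lprod open_I smooth_N smooth_t')

lemma N_orthogonal_acceleration: "s \<in> I \<Longrightarrow> lprod (N s) (t' s - k s *\<^sub>R N s) = 0"
  using N_unit[of s] k_eq[of s] by (simp only: lprod.diff_right lprod.scaleR_right) simp

lemma acceleration_norm:
  "s \<in> I \<Longrightarrow> lprod (t' s - k s *\<^sub>R N s) (t' s - k s *\<^sub>R N s) = (g s)\<^sup>2"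
  using lprod_orthogonal_timelike_nonneg[OF N_unit N_orthogonal_acceleration] by (simp add: g_eq)

lemma g_pos: "s \<in> I \<Longrightarrow> g s > 0"
  using kg_nonzero[of s] g_eq[of s] by (simp add: less_le)

lemma smooth_g: "smooth_on I g"
proof -
  let ?a = "\<lambda>s. lprod (t' s - k s *\<^sub>R N s) (t' s - k s *\<^sub>R N s)"
  have "smooth_on I (\<lambda>s. sqrt (?a s))"
    using g_pos acceleration_norm
    by (intro smooth_on_sqrt smooth_on_lprod smooth_on_diff smooth_on_scaleR open_I smooth_k smooth_N smooth_t')
       fastforce
  moreover have "sqrt (?a s) = g s" if "s \<in> I" for s
    using g_pos[OF that] acceleration_norm[OF that] by simp
  ultimately show ?thesis using smooth_on_cong[OF open_I] by (metis (mono_tags, lifting))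
qed

lemma e1_eq: "e1 s = (1 / g s) *\<^sub>R (t' s - k s *\<^sub>R N s)"
  by (simp add: n1_def vderiv_def)

lemma smooth_e1: "smooth_on I e1"
  unfolding e1_eq[abs_def]
  by (intro smooth_on_diff smooth_on_scaleR smooth_on_divide smooth_on_const open_I smooth_k smooth_g
      smooth_N smooth_t' kg_nonzero)

lemma smooth_e2: "smooth_on I e2"
  unfolding n2_def[abs_def] by (intro smooth_on_lwedge open_I smooth_N smooth_t smooth_e1)

lemma t'_eq: "s \<in> I \<Longrightarrow> t' s = k s *\<^sub>R N s + g s *\<^sub>R e1 s"
  using g_pos[of s] by (simp add: e1_eq)

lemma vderiv_works: "smooth_on I f \<Longrightarrow> s \<in> I \<Longrightarrow> (f has_vector_derivative vderiv f s) (at s)"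
  using smooth_on_has_vector_derivative by (simp add: vderiv_def)

lemma lprod_vderiv_const:
  assumes "smooth_on I p" "smooth_on I q" "s \<in> I" "\<And>s. s \<in> I \<Longrightarrow> lprod (p s) (q s) = c"
  shows "lprod (vderiv p s) (q s) = - lprod (p s) (vderiv q s)"
proof -
  have "((\<lambda>s. lprod (p s) (q s)) has_vector_derivative
      lprod (p s) (vderiv q s) + lprod (vderiv p s) (q s)) (at s)"
    by (intro lprod.has_vector_derivative vderiv_works assms)
  moreover have "((\<lambda>s. lprod (p s) (q s)) has_vector_derivative 0) (at s)"
    by (rule has_vector_derivative_transform_within_open[OF has_vector_derivative_const open_I assms(3)])
       (simp add: assms(4))
  ultimately show ?thesis using vector_derivative_unique_at by fastforce
qed

lemma frame:
  assumes s: "s \<in> I"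
  shows "lprod (N s) (N s) = -1" "lprod (t s) (t s) = 1" "lprod (e1 s) (e1 s) = 1" "lprod (e2 s) (e2 s) = 1"
    "lprod (N s) (t s) = 0" "lprod (N s) (e1 s) = 0" "lprod (N s) (e2 s) = 0"
    "lprod (t s) (e1 s) = 0" "lprod (t s) (e2 s) = 0" "lprod (e1 s) (e2 s) = 0"
proof -
  show 1: "lprod (N s) (N s) = -1" "lprod (t s) (t s) = 1" "lprod (N s) (t s) = 0"
    using N_unit t_unit N_normal tangent_in_range s by auto
  show 2: "lprod (e1 s) (e1 s) = 1"
    using acceleration_norm[OF s] g_pos[OF s]
    by (simp add: e1_eq lprod.scaleR_left lprod.scaleR_right power2_eq_square)
  show 3: "lprod (N s) (e1 s) = 0"
    using N_orthogonal_acceleration[OF s] by (simp add: e1_eq lprod.scaleR_right)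
  have "lprod (t s) (t' s) = 0"
    using lprod_vderiv_const[OF smooth_t smooth_t s t_unit] by (simp add: lprod_commute[of "t' s"])
  then show 4: "lprod (t s) (e1 s) = 0"
    using 1(3) by (simp add: e1_eq lprod.scaleR_right lprod.diff_right lprod_commute[of "t s" "N s"])
  show "lprod (e2 s) (e2 s) = 1"
    unfolding n2_def lprod_lwedge_lwedge using 1 2 3 4 by simp
  show "lprod (N s) (e2 s) = 0" "lprod (t s) (e2 s) = 0" "lprod (e1 s) (e2 s) = 0"
    using lprod_lwedge[of "N s" "t s" "e1 s"] by (simp_all add: n2_def lprod_commute)
qed

abbreviation "T1 \<equiv> tau1 n \<gamma>"
abbreviation "T2 \<equiv> tau2 n \<gamma>"
abbreviation "Tg \<equiv> taug n \<gamma>"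

text \<open>The part of the Frenet type equations that is used below: \<open>t'' = (k N + g e1)'\<close>, with the products of
  the derivatives of the frame obtained from its orthonormality.\<close>

lemma third_derivative_components:
  assumes s: "s \<in> I"
  shows "lprod (N s) (t'' s) = - deriv k s - g s * T1 s"
    "lprod (e1 s) (t'' s) = k s * T1 s + deriv g s"
    "lprod (e2 s) (t'' s) = k s * T2 s + g s * Tg s"
proof -
  have d: "(k has_field_derivative deriv k s) (at s)" "(g has_field_derivative deriv g s) (at s)"
    using smooth_on_deriv(2)[OF open_I _ s] smooth_k smooth_g by auto
  have "((\<lambda>s. k s *\<^sub>R N s + g s *\<^sub>R e1 s) has_vector_derivative
     (k s *\<^sub>R vderiv N s + deriv k s *\<^sub>R N s) + (g s *\<^sub>R vderiv e1 s + deriv g s *\<^sub>R e1 s)) (at s)"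
    by (intro has_vector_derivative_add has_vector_derivative_scaleR d vderiv_works smooth_N smooth_e1 s)
  then have "(t' has_vector_derivative
     (k s *\<^sub>R vderiv N s + deriv k s *\<^sub>R N s) + (g s *\<^sub>R vderiv e1 s + deriv g s *\<^sub>R e1 s)) (at s)"
    by (rule has_vector_derivative_transform_within_open[OF _ open_I s]) (simp add: t'_eq)
  then have t'': "t'' s = (k s *\<^sub>R vderiv N s + deriv k s *\<^sub>R N s) + (g s *\<^sub>R vderiv e1 s + deriv g s *\<^sub>R e1 s)"
    by (rule vderiv_eqI)
  have tau: "T1 s = lprod (e1 s) (vderiv N s)" "T2 s = lprod (e2 s) (vderiv N s)" "Tg s = - lprod (vderiv e2 s) (e1 s)"
    by (simp_all add: tau1_def tau2_def taug_def vderiv_def)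
  have "lprod (N s) (vderiv N s) = 0"
    using lprod_vderiv_const[OF smooth_N smooth_N s frame(1)] by (simp add: lprod_commute[of "vderiv N s"])
  moreover have "lprod (e1 s) (vderiv e1 s) = 0"
    using lprod_vderiv_const[OF smooth_e1 smooth_e1 s frame(3)] by (simp add: lprod_commute[of "vderiv e1 s"])
  moreover have "lprod (N s) (vderiv e1 s) = - T1 s"
    using lprod_vderiv_const[OF smooth_N smooth_e1 s frame(6)] by (simp add: tau lprod_commute[of "vderiv N s"])
  moreover have "lprod (e2 s) (vderiv e1 s) = Tg s"
    using lprod_vderiv_const[OF smooth_e1 smooth_e2 s frame(10)]
    by (simp add: tau lprod_commute[of "e2 s"] lprod_commute[of "vderiv e2 s"])
  ultimately show "lprod (N s) (t'' s) = - deriv k s - g s * T1 s"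
    "lprod (e1 s) (t'' s) = k s * T1 s + deriv g s"
    "lprod (e2 s) (t'' s) = k s * T2 s + g s * Tg s"
    using frame[OF s] tau unfolding t''
    by (simp_all add: lprod.add_right lprod.scaleR_right lprod_commute[of "e1 s" "N s"]
        lprod_commute[of "e2 s" "N s"] lprod_commute[of "e2 s" "e1 s"])
qed

section \<open>The hyperbolic surface and the hyperbolic curve\<close>

abbreviation "lam \<equiv> lambda0 n \<gamma>"
abbreviation "S \<equiv> hyperbolic_surface n \<gamma>"
abbreviation "T \<equiv> tanh_theta n \<gamma>"
abbreviation "CH \<equiv> hyperbolic_curve n \<gamma>"
abbreviation "J \<equiv> hyperbolic_curve_domain n \<gamma> I"

lemma surface_products:
  assumes s: "s \<in> I"
  defines "r \<equiv> sqrt ((g s)\<^sup>2 - (k s)\<^sup>2)"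
  shows "lprod (S s \<theta>) (S s \<theta>) = -1" "lprod (S s \<theta>) (t s) = 0" "lprod (S s \<theta>) (t' s) = 0"
    "lprod (S s \<theta>) (t'' s) = sinh \<theta> * (k s * T2 s + g s * Tg s) - cosh \<theta> / r * lam s"
proof -
  have r: "r > 0" "r * r = g s * g s - k s * k s"
    using kg_dominates[OF s] by (simp_all add: r_def flip: power2_eq_square)
  note f = frame[OF s] lprod_commute[of "e1 s" "N s"] lprod_commute[of "e2 s" "N s"]
    lprod_commute[of "e2 s" "e1 s"] lprod_commute[of "e1 s" "t s"] lprod_commute[of "e2 s" "t s"]
  note bil = lprod.add_left lprod.add_right lprod.scaleR_left lprod.scaleR_right
  have S: "S s \<theta> = (cosh \<theta> / r) *\<^sub>R (g s *\<^sub>R N s + k s *\<^sub>R e1 s) + sinh \<theta> *\<^sub>R e2 s"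
    by (simp add: hyperbolic_surface_def r_def)
  have "lprod (S s \<theta>) (S s \<theta>) = (cosh \<theta> / r) * (cosh \<theta> / r) * (- (r * r)) + (sinh \<theta>)\<^sup>2"
    unfolding S r(2) by (simp add: bil f power2_eq_square algebra_simps)
  also have "\<dots> = - 1"
    using r(1) hyperbolic_pythagoras[of \<theta>] by (simp add: power2_eq_square)
  finally show "lprod (S s \<theta>) (S s \<theta>) = -1" .
  show "lprod (S s \<theta>) (t s) = 0" unfolding S by (simp add: bil f)
  show "lprod (S s \<theta>) (t' s) = 0" unfolding S t'_eq[OF s] by (simp add: bil f)
  show "lprod (S s \<theta>) (t'' s) = sinh \<theta> * (k s * T2 s + g s * Tg s) - cosh \<theta> / r * lam s"
    unfolding S lambda0_def by (simp add: bil third_derivative_components[OF s] power2_eq_square algebra_simps)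
qed

text \<open>This is the meaning of the defining equation of the hyperbolic curve.\<close>

lemma third_derivative_orthogonal_iff:
  assumes s: "s \<in> I"
  shows "lprod (S s \<theta>) (t'' s) = 0 \<longleftrightarrow> T s = tanh \<theta>"
proof -
  define r where "r = sqrt ((g s)\<^sup>2 - (k s)\<^sup>2)"
  define d where "d = k s * T2 s + g s * Tg s"
  have "r \<noteq> 0" "d \<noteq> 0" "cosh \<theta> \<noteq> 0"
    using kg_dominates[OF s] twist_nonzero[OF s] by (simp_all add: r_def d_def)
  then show ?thesis
    unfolding surface_products(4)[OF s] tanh_theta_def tanh_def r_def[symmetric] d_def[symmetric]
    by (auto simp: field_simps)
qed

text \<open>The vectors \<open>t\<close>, \<open>t'\<close>, \<open>t''\<close> and the point of the hyperbolic curve form a basis: in terms of the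
  components of \<open>x\<close> in the moving frame, orthogonality to \<open>t'\<close> leaves the two unknowns \<open>\<mu>\<close> and \<open>c\<close>, for
  which the other two conditions are a regular linear system.\<close>

lemma osculating_complement_trivial:
  assumes s: "s \<in> I" and T: "T s = tanh \<theta>"
    and x: "lprod x (t s) = 0" "lprod x (t' s) = 0" "lprod x (t'' s) = 0" "lprod x (S s \<theta>) = 0"
  shows "x = 0"
proof -
  define r where "r = sqrt ((g s)\<^sup>2 - (k s)\<^sup>2)"
  define d where "d = k s * T2 s + g s * Tg s"
  have r: "r > 0" "r * r = g s * g s - k s * k s"
    using kg_dominates[OF s] by (simp_all add: r_def flip: power2_eq_square)
  have d: "d \<noteq> 0" using twist_nonzero[OF s] by (simp add: d_def)
  have g: "g s > 0" by (rule g_pos[OF s])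
  note f = frame[OF s] lprod_commute[of "e1 s" "N s"] lprod_commute[of "e2 s" "N s"] lprod_commute[of "t s" "N s"]
    lprod_commute[of "e2 s" "e1 s"] lprod_commute[of "e1 s" "t s"] lprod_commute[of "e2 s" "t s"]
  note bil = lprod.add_left lprod.add_right lprod.scaleR_left lprod.scaleR_right lprod.diff_left lprod.diff_right
  define a b c where "a = lprod x (N s)" and "b = lprod x (e1 s)" and "c = lprod x (e2 s)"
  have "t'' s - (- lprod (N s) (t'' s) *\<^sub>R N s + lprod (t s) (t'' s) *\<^sub>R t s + lprod (e1 s) (t'' s) *\<^sub>R e1 s
      + lprod (e2 s) (t'' s) *\<^sub>R e2 s) = 0"
    by (rule pseudo_orthonormal_complete[of "N s" "t s" "e1 s" "e2 s"])
       (simp_all add: bil f lprod_commute[of "t'' s"])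
  then have t'': "t'' s = - lprod (N s) (t'' s) *\<^sub>R N s + lprod (t s) (t'' s) *\<^sub>R t s
      + lprod (e1 s) (t'' s) *\<^sub>R e1 s + lprod (e2 s) (t'' s) *\<^sub>R e2 s"
    by simp
  have 1: "k s * a + g s * b = 0"
    using x(2) unfolding t'_eq[OF s] by (simp add: bil a_def b_def)
  have 2: "cosh \<theta> * (g s * a + k s * b) + r * sinh \<theta> * c = 0"
  proof -
    have "cosh \<theta> / r * (g s * a + k s * b) + sinh \<theta> * c = 0"
      using x(4) unfolding hyperbolic_surface_def r_def[symmetric] by (simp add: bil a_def b_def c_def)
    then show ?thesis using r(1) by (simp add: field_simps)
  qed
  have "lprod x (t'' s) = - lprod (N s) (t'' s) * a + lprod (e1 s) (t'' s) * b + lprod (e2 s) (t'' s) * c"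
    by (subst t'') (simp add: bil x(1) a_def b_def c_def)
  then have 3: "(deriv k s + g s * T1 s) * a + (k s * T1 s + deriv g s) * b + d * c = 0"
    using x(3) by (simp add: third_derivative_components[OF s] d_def algebra_simps)
  define \<mu> where "\<mu> = a / g s"
  have a: "a = g s * \<mu>" and b: "b = - k s * \<mu>"
    using g 1 by (simp_all add: \<mu>_def field_simps)
  have "lam s * \<mu> + d * c = 0"
    using 3 unfolding a b lambda0_def by (simp add: power2_eq_square algebra_simps)
  moreover have "lam s * cosh \<theta> = d * r * sinh \<theta>"
  proof -
    have "lam s / (d * r) = sinh \<theta> / cosh \<theta>"
      using T unfolding tanh_theta_def tanh_def r_def d_def .
    then show ?thesis using d r(1) by (simp add: field_simps)
  qed
  ultimately have "d * (r * sinh \<theta> * \<mu> + cosh \<theta> * c) = 0"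
    by algebra
  then have 4: "r * sinh \<theta> * \<mu> + cosh \<theta> * c = 0" using d by simp
  have 5: "cosh \<theta> * (r * \<mu>) + sinh \<theta> * c = 0"
  proof -
    have "r * (cosh \<theta> * (r * \<mu>) + sinh \<theta> * c) = cosh \<theta> * (g s * a + k s * b) + r * sinh \<theta> * c"
      unfolding a b using r(2) by algebra
    then show ?thesis using 2 r(1) by simp
  qed
  \<comment> \<open>Equations 4 and 5 have the matrix of a hyperbolic rotation.\<close>
  have "r * \<mu> = 0" "c = 0"
    using 4 5 hyperbolic_pythagoras[of \<theta>] by algebra+
  then have "\<mu> = 0" using r(1) by simp
  then show "x = 0"
    using a b \<open>c = 0\<close> x(1)
    by (intro pseudo_orthonormal_complete[of "N s" "t s" "e1 s" "e2 s" x] frame[OF s])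
       (simp_all add: a_def b_def c_def)
qed

lemma smooth_T: "smooth_on I T"
proof -
  have dv: "smooth_on I (vderiv N)" "smooth_on I (vderiv e2)"
    by (intro smooth_on_vderiv open_I smooth_N smooth_e2)+
  have tau: "smooth_on I T1" "smooth_on I T2" "smooth_on I Tg"
    unfolding tau1_def[abs_def] tau2_def[abs_def] taug_def[abs_def] vderiv_def[symmetric]
    by (intro smooth_on_lprod smooth_on_uminus open_I dv smooth_e1 smooth_e2)+
  show ?thesis
    unfolding tanh_theta_def[abs_def] lambda0_def
    by (intro smooth_on_divide smooth_on_mult smooth_on_add smooth_on_diff smooth_on_sqrt smooth_on_power
        smooth_on_deriv(1) open_I smooth_k smooth_g tau)
       (use kg_dominates twist_nonzero in fastforce)+
qed

lemma open_J: "open J"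
proof -
  have "J = I \<inter> T -` {-1<..<1}" by (auto simp: hyperbolic_curve_domain_def)
  then show ?thesis
    using continuous_open_preimage[OF smooth_on_continuous[OF smooth_T] open_I] by simp
qed

lemma J_sub: "J \<subseteq> I" by (auto simp: hyperbolic_curve_domain_def)

text \<open>Without \<open>artanh\<close>, the curve is visibly smooth.\<close>

lemma CH_explicit:
  assumes "s \<in> J"
  shows "CH s = (1 / sqrt (1 - (T s)\<^sup>2) / sqrt ((g s)\<^sup>2 - (k s)\<^sup>2)) *\<^sub>R (g s *\<^sub>R N s + k s *\<^sub>R e1 s)
    + (T s / sqrt (1 - (T s)\<^sup>2)) *\<^sub>R e2 s"
  using assms unfolding hyperbolic_curve_def hyperbolic_surface_def
  by (simp add: hyperbolic_curve_domain_def cosh_artanh_real abs_less_iff)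

lemma smooth_CH: "smooth_on J CH"
proof -
  note sub = smooth_on_subset[OF _ J_sub]
  have 1: "1 - (T s)\<^sup>2 > 0" if "s \<in> J" for s
    using that abs_square_less_1[of "T s"] by (auto simp: hyperbolic_curve_domain_def abs_less_iff)
  have 2: "(g s)\<^sup>2 - (k s)\<^sup>2 > 0" if "s \<in> J" for s
    using that J_sub kg_dominates[of s] by auto
  have "smooth_on J (\<lambda>s. (1 / sqrt (1 - (T s)\<^sup>2) / sqrt ((g s)\<^sup>2 - (k s)\<^sup>2)) *\<^sub>R (g s *\<^sub>R N s + k s *\<^sub>R e1 s)
    + (T s / sqrt (1 - (T s)\<^sup>2)) *\<^sub>R e2 s)"
    by (intro smooth_on_add smooth_on_scaleR smooth_on_divide smooth_on_diff smooth_on_power smooth_on_const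
        smooth_on_sqrt open_J sub[OF smooth_T] sub[OF smooth_k] sub[OF smooth_g] sub[OF smooth_N]
        sub[OF smooth_e1] sub[OF smooth_e2] 1 2)
       (use 1 2 in fastforce)+
  then show ?thesis using smooth_on_cong[OF open_J] CH_explicit by (metis (mono_tags, lifting))
qed

lemma CH_products:
  assumes "s \<in> J"
  shows "lprod (CH s) (CH s) = -1" "lprod (CH s) (t s) = 0" "lprod (CH s) (t' s) = 0" "lprod (CH s) (t'' s) = 0"
proof -
  have s: "s \<in> I" "\<bar>T s\<bar> < 1" using assms by (auto simp: hyperbolic_curve_domain_def)
  show "lprod (CH s) (CH s) = -1" "lprod (CH s) (t s) = 0" "lprod (CH s) (t' s) = 0" "lprod (CH s) (t'' s) = 0"
    unfolding hyperbolic_curve_def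
    by (simp_all add: surface_products(1-3)[OF s(1)] third_derivative_orthogonal_iff[OF s(1)]
        tanh_artanh_real[OF s(2)])
qed

lemma CH_through:
  assumes "s \<in> I" "T s = tanh \<theta>"
  shows "s \<in> J" "CH s = S s \<theta>"
  using assms tanh_real_bounds[of \<theta>]
  by (auto simp: hyperbolic_curve_domain_def hyperbolic_curve_def artanh_tanh_real)

definition pairing :: "nat \<Rightarrow> nat \<Rightarrow> real \<Rightarrow> real" where
  "pairing i j s = lprod ((vderiv ^^ i) CH s) ((vderiv ^^ j) t s)"

definition self_pairing :: "nat \<Rightarrow> nat \<Rightarrow> real \<Rightarrow> real" where
  "self_pairing i j s = lprod ((vderiv ^^ i) CH s) ((vderiv ^^ j) CH s)"

lemma DERIV_lprod_iterated:
  assumes "smooth_on J p" "smooth_on J q" "s \<in> J"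
  shows "((\<lambda>s. lprod ((vderiv ^^ i) p s) ((vderiv ^^ j) q s)) has_field_derivative
    lprod ((vderiv ^^ Suc i) p s) ((vderiv ^^ j) q s) + lprod ((vderiv ^^ i) p s) ((vderiv ^^ Suc j) q s)) (at s)"
  using lprod.has_vector_derivative[OF iterated_vderiv_works[OF open_J assms(1,3), of i]
      iterated_vderiv_works[OF open_J assms(2,3), of j]]
  unfolding has_real_derivative_iff_has_vector_derivative by (simp only: add.commute)

lemma pairing_deriv:
  assumes "s \<in> J" shows "(pairing i j has_field_derivative pairing (Suc i) j s + pairing i (Suc j) s) (at s)"
  using DERIV_lprod_iterated[OF smooth_CH smooth_on_subset[OF smooth_t J_sub] assms]
  unfolding pairing_def[abs_def] .

lemma self_pairing_deriv:
  assumes "s \<in> J"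
  shows "(self_pairing i j has_field_derivative self_pairing (Suc i) j s + self_pairing i (Suc j) s) (at s)"
  using DERIV_lprod_iterated[OF smooth_CH smooth_CH assms] unfolding self_pairing_def[abs_def] .

lemma DERIV_unique_J:
  fixes f h :: "real \<Rightarrow> real"
  assumes "s \<in> J" "(f has_field_derivative a) (at s)" "(h has_field_derivative b) (at s)" "\<And>s. s \<in> J \<Longrightarrow> f s = h s"
  shows "a = b"
  using has_field_derivative_transform_within_open[OF assms(2) open_J assms(1,4)] assms(3) DERIV_unique by blast

text \<open>Each entry comes from differentiating an identity between previous entries, starting from the
  vanishing of \<open>\<langle>C, t\<rangle>\<close>, \<open>\<langle>C, t'\<rangle>\<close> and \<open>\<langle>C, t''\<rangle>\<close> along the whole curve.\<close>

lemma pairing_table: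
  assumes s: "s \<in> J"
  shows "pairing 1 0 s = 0" "pairing 1 1 s = 0" "pairing 1 2 s = - pairing 0 3 s"
    "pairing 2 1 s = pairing 0 3 s"
    "pairing 2 2 s = - 2 * pairing 1 3 s - pairing 0 4 s"
    "pairing 3 1 s = 3 * pairing 1 3 s + 2 * pairing 0 4 s"
proof -
  have step: "pairing (Suc i) j s = - pairing i (Suc j) s" if "\<And>s. s \<in> J \<Longrightarrow> pairing i j s = 0" "s \<in> J" for i j s
    using DERIV_unique_J[OF that(2) pairing_deriv[OF that(2)] DERIV_const that(1)] by simp
  have 00: "pairing 0 0 s = 0" and 01: "pairing 0 (Suc 0) s = 0" and 02: "pairing 0 (Suc (Suc 0)) s = 0"
    if "s \<in> J" for s
    using CH_products[OF that] by (simp_all add: pairing_def)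
  have 10: "pairing (Suc 0) 0 s = 0" if "s \<in> J" for s using step[OF 00 that] 01[OF that] by simp
  have 11: "pairing (Suc 0) (Suc 0) s = 0" if "s \<in> J" for s using step[OF 01 that] 02[OF that] by simp
  have 12: "pairing (Suc 0) (Suc (Suc 0)) s = - pairing 0 (Suc (Suc (Suc 0))) s" if "s \<in> J" for s
    using step[OF 02 that] by simp
  have 21: "pairing (Suc (Suc 0)) (Suc 0) s = pairing 0 (Suc (Suc (Suc 0))) s" if "s \<in> J" for s
    using step[OF 11 that] 12[OF that] by simp
  note der = pairing_deriv[OF s]
  have 22: "pairing (Suc (Suc 0)) (Suc (Suc 0)) s + pairing (Suc 0) (Suc (Suc (Suc 0))) s
      = - (pairing (Suc 0) (Suc (Suc (Suc 0))) s + pairing 0 (Suc (Suc (Suc (Suc 0)))) s)"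
    by (rule DERIV_unique_J[OF s der DERIV_minus[OF der] 12])
  have 31: "pairing (Suc (Suc (Suc 0))) (Suc 0) s + pairing (Suc (Suc 0)) (Suc (Suc 0)) s
      = pairing (Suc 0) (Suc (Suc (Suc 0))) s + pairing 0 (Suc (Suc (Suc (Suc 0)))) s"
    by (rule DERIV_unique_J[OF s der der 21])
  show "pairing 1 0 s = 0" "pairing 1 1 s = 0" "pairing 1 2 s = - pairing 0 3 s"
    "pairing 2 1 s = pairing 0 3 s"
    "pairing 2 2 s = - 2 * pairing 1 3 s - pairing 0 4 s"
    "pairing 3 1 s = 3 * pairing 1 3 s + 2 * pairing 0 4 s"
    using 10 11 12 21 22 31 s by (simp_all add: numeral_eq_Suc)
qed

text \<open>Obtained in the same way from \<open>\<langle>C, C\<rangle> = -1\<close>.\<close>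

lemma self_pairing_table:
  assumes s: "s \<in> J"
  shows "self_pairing 1 0 s = 0" "self_pairing 2 0 s = - self_pairing 1 1 s"
    "self_pairing 3 0 s = - 3 * self_pairing 2 1 s"
proof -
  have sym: "self_pairing i j s = self_pairing j i s" for i j s
    by (simp add: self_pairing_def lprod_commute)
  have step: "self_pairing (Suc i) j s = - self_pairing i (Suc j) s"
    if "\<And>s. s \<in> J \<Longrightarrow> self_pairing i j s = c" "s \<in> J" for i j s c
    using DERIV_unique_J[OF that(2) self_pairing_deriv[OF that(2)] DERIV_const that(1)] by simp
  have 00: "self_pairing 0 0 s = -1" if "s \<in> J" for s
    using CH_products[OF that] by (simp add: self_pairing_def)
  have 10: "self_pairing (Suc 0) 0 s = 0" if "s \<in> J" for s
    using step[OF 00 that] sym[of "Suc 0" 0 s] by simp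
  have 20: "self_pairing (Suc (Suc 0)) 0 s = - self_pairing (Suc 0) (Suc 0) s" if "s \<in> J" for s
    using step[OF 10 that] .
  note der = self_pairing_deriv[OF s]
  have 30: "self_pairing (Suc (Suc (Suc 0))) 0 s + self_pairing (Suc (Suc 0)) (Suc 0) s
      = - (self_pairing (Suc (Suc 0)) (Suc 0) s + self_pairing (Suc 0) (Suc (Suc 0)) s)"
    by (rule DERIV_unique_J[OF s der DERIV_minus[OF der] 20])
  show "self_pairing 1 0 s = 0" "self_pairing 2 0 s = - self_pairing 1 1 s"
    "self_pairing 3 0 s = - 3 * self_pairing 2 1 s"
    using 10[OF s] 20[OF s] 30 sym[of "Suc 0" "Suc (Suc 0)" s] by (simp_all add: numeral_eq_Suc)
qed

text \<open>The kernel of the spatial projection is timelike, so the projection is injective on the tangent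
  spaces of hyperbolic space, which are orthogonal to the timelike position vector.\<close>

lemma spatial_tangent_eq_0:
  assumes "lprod v v = -1" "lprod w v = 0" "spatial w = 0"
  shows "w = 0"
proof -
  have w: "w $ 1 = 0" "w $ 2 = 0" "w $ 3 = 0"
    using assms(3) by (simp_all add: spatial_def vec_eq_iff forall_3)
  have "v $ 0 \<noteq> 0"
  proof
    assume "v $ 0 = 0"
    then have "lprod v v = v $ 1 * v $ 1 + v $ 2 * v $ 2 + v $ 3 * v $ 3" by (simp add: lprod_def)
    moreover have "0 \<le> v $ 1 * v $ 1" "0 \<le> v $ 2 * v $ 2" "0 \<le> v $ 3 * v $ 3" by simp_all
    ultimately show False using assms(1) by linarith
  qed
  then have "w $ 0 = 0" using assms(2) w by (simp add: lprod_def)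
  then show ?thesis using w by (simp add: vec_eq_iff forall_4')
qed

lemma chart_curve:
  assumes "s0 \<in> J"
  obtains r where "r > 0" "\<And>u. \<bar>u\<bar> < r \<Longrightarrow> s0 + u \<in> J \<and> CH (s0 + u) \<in> H3"
    "smooth_on {-r<..<r} (\<lambda>u. spatial (CH (s0 + u)))"
    "\<And>i. (vderiv ^^ i) (\<lambda>u. spatial (CH (s0 + u))) 0 = spatial ((vderiv ^^ i) CH s0)"
proof -
  obtain r where r: "r > 0" "ball s0 r \<subseteq> J" using openE[OF open_J assms] by blast
  have in_J: "s0 + u \<in> J" if "\<bar>u\<bar> < r" for u
    using r(2) that by (auto simp: subset_iff dist_real_def)
  show thesis
  proof
    show "r > 0" by (rule r(1))
    show "s0 + u \<in> J \<and> CH (s0 + u) \<in> H3" if "\<bar>u\<bar> < r" for u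
      using in_J[OF that] CH_products(1) by (simp add: H3_def)
    have sm: "smooth_on {-r<..<r} (\<lambda>u. CH (s0 + u))"
      by (rule smooth_on_compose[OF _ open_J smooth_on_add[OF _ smooth_on_const smooth_on_ident] smooth_CH])
         (auto intro!: in_J simp: abs_less_iff)
    show "smooth_on {-r<..<r} (\<lambda>u. spatial (CH (s0 + u)))"
      by (rule smooth_on_compose[OF _ open_UNIV sm smooth_on_bounded_linear[OF open_UNIV bounded_linear_spatial]]) auto
    show "(vderiv ^^ i) (\<lambda>u. spatial (CH (s0 + u))) 0 = spatial ((vderiv ^^ i) CH s0)" for i
      using iterated_vderiv_linear_shift[OF open_J smooth_CH bounded_linear_spatial, of s0 0 i] assms by simp
  qed
qed

lemma CH_isCont: "s \<in> J \<Longrightarrow> isCont CH s"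
  using smooth_on_continuous[OF smooth_CH] open_J by (simp add: continuous_on_eq_continuous_at)

text \<open>Here \<open>\<langle>C', t''\<rangle> = - \<langle>C, t'''\<rangle>\<close> is nonzero, so \<open>C\<close> is regular.\<close>

lemma regular_point_line:
  assumes s0: "s0 \<in> J" and ne: "pairing 0 3 s0 \<noteq> 0"
  shows "\<exists>d :: real ^ 3. d \<noteq> 0 \<and> curve_locally_diffeomorphic H3 J CH s0 (span {d})"
proof -
  obtain r where r: "r > 0" and J: "\<And>u. \<bar>u\<bar> < r \<Longrightarrow> s0 + u \<in> J \<and> CH (s0 + u) \<in> H3"
    and sm: "smooth_on {-r<..<r} (\<lambda>u. spatial (CH (s0 + u)))"
    and der: "\<And>i. (vderiv ^^ i) (\<lambda>u. spatial (CH (s0 + u))) 0 = spatial ((vderiv ^^ i) CH s0)"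
    using chart_curve[OF s0] by blast
  define d where "d = spatial (vderiv CH s0)"
  have "vderiv CH s0 \<noteq> 0"
    using pairing_table(3)[OF s0] ne by (auto simp: pairing_def lprod.zero_left)
  then have d: "d \<noteq> 0"
    using spatial_tangent_eq_0[OF CH_products(1)[OF s0], of "vderiv CH s0"] self_pairing_table(1)[OF s0]
    by (auto simp: d_def self_pairing_def)
  have dd: "d = vderiv (\<lambda>u. spatial (CH (s0 + u))) 0" using der[of 1] by (simp add: d_def)
  obtain V \<Psi> where "open V" "0 \<in> V" "smooth_on V \<Psi>" "inj (frechet_derivative \<Psi> (at 0))"
    "\<And>u. \<bar>u\<bar> < r \<Longrightarrow> u *\<^sub>R d \<in> V \<and> \<Psi> (u *\<^sub>R d) = spatial (CH (s0 + u))"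
    using regular_curve_model[OF r sm dd d] by metis
  then have "curve_locally_diffeomorphic H3 J CH s0 (span {d})"
    by (intro curve_in_H3_locally_diffeomorphic[OF r J CH_isCont[OF s0], of V \<Psi> "\<lambda>u. u *\<^sub>R d"]
        same_germ_line d) (auto intro!: continuous_intros)
  then show ?thesis using d by blast
qed

text \<open>Now \<open>C'\<close> vanishes, and the matrix of products of \<open>C''\<close>, \<open>C'''\<close> with \<open>t''\<close>, \<open>t'\<close> is triangular with the
  diagonal entries \<open>- \<langle>C, t''''\<rangle>\<close> and \<open>2 \<langle>C, t''''\<rangle>\<close>.\<close>

lemma singular_point_cusp:
  assumes s0: "s0 \<in> J" and z: "pairing 0 3 s0 = 0" and ne: "pairing 0 4 s0 \<noteq> 0"
  shows "curve_locally_diffeomorphic H3 J CH s0 cusp234"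
proof -
  obtain r where r: "r > 0" and J: "\<And>u. \<bar>u\<bar> < r \<Longrightarrow> s0 + u \<in> J \<and> CH (s0 + u) \<in> H3"
    and sm: "smooth_on {-r<..<r} (\<lambda>u. spatial (CH (s0 + u)))"
    and der: "\<And>i. (vderiv ^^ i) (\<lambda>u. spatial (CH (s0 + u))) 0 = spatial ((vderiv ^^ i) CH s0)"
    using chart_curve[OF s0] by blast
  have s0': "s0 \<in> I" "\<bar>T s0\<bar> < 1" using s0 by (auto simp: hyperbolic_curve_domain_def)
  note tab = pairing_table[OF s0] and stab = self_pairing_table[OF s0]
  have C1: "vderiv CH s0 = 0"
  proof (rule osculating_complement_trivial[OF s0'(1) tanh_artanh_real[OF s0'(2), symmetric]])
    show "lprod (vderiv CH s0) (t s0) = 0" "lprod (vderiv CH s0) (t' s0) = 0"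
      "lprod (vderiv CH s0) (t'' s0) = 0"
      using tab(1-3) z by (simp_all add: pairing_def numeral_eq_Suc)
    show "lprod (vderiv CH s0) (S s0 (artanh (T s0))) = 0"
      using stab(1) by (simp add: self_pairing_def hyperbolic_curve_def)
  qed
  then have z1: "pairing 1 j s0 = 0" "self_pairing 1 j s0 = 0" "self_pairing j 1 s0 = 0" for j
    by (simp_all add: pairing_def self_pairing_def lprod.zero_left lprod.zero_right)
  let ?c = "\<lambda>u. spatial (CH (s0 + u))"
  have c1: "vderiv ?c 0 = 0"
    using der[of 1] C1 linear_0[OF bounded_linear.linear[OF bounded_linear_spatial]] by simp
  \<comment> \<open>As \<open>C'\<close> vanishes at \<open>s0\<close>, the vectors \<open>C''\<close> and \<open>C'''\<close> are tangent to hyperbolic space there, so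
     their independence is not lost under projection.\<close>
  have indep: "a = 0 \<and> b = 0" if ab: "a *\<^sub>R (vderiv ^^ 2) ?c 0 + b *\<^sub>R (vderiv ^^ 3) ?c 0 = 0" for a b
  proof -
    define w where "w = a *\<^sub>R (vderiv ^^ 2) CH s0 + b *\<^sub>R (vderiv ^^ 3) CH s0"
    have "spatial w = 0"
      using ab unfolding der w_def
      by (simp add: linear_add[OF bounded_linear.linear[OF bounded_linear_spatial]]
          linear_scale[OF bounded_linear.linear[OF bounded_linear_spatial]])
    moreover have "lprod w (CH s0) = a * self_pairing 2 0 s0 + b * self_pairing 3 0 s0"
      by (simp add: w_def self_pairing_def lprod.add_left lprod.scaleR_left)
    then have "lprod w (CH s0) = 0" using stab z1 by simp
    ultimately have "w = 0"
      using spatial_tangent_eq_0[OF CH_products(1)[OF s0]] by blast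
    moreover have "lprod w ((vderiv ^^ j) t s0) = a * pairing 2 j s0 + b * pairing 3 j s0" for j
      by (simp add: w_def pairing_def lprod.add_left lprod.scaleR_left)
    ultimately have eq: "a * pairing 2 j s0 + b * pairing 3 j s0 = 0" for j
      by (metis lprod.zero_left)
    have "b = 0" using eq[of 1] tab z z1 ne by simp
    moreover from this have "a = 0" using eq[of 2] tab z1 ne by simp
    ultimately show ?thesis by simp
  qed
  obtain V and \<Psi> :: "real ^ 3 \<Rightarrow> real ^ 3" and e where V: "open V" "0 \<in> V" "smooth_on V \<Psi>"
    "inj (frechet_derivative \<Psi> (at 0))" "e > 0"
    and m: "\<And>u. \<bar>u\<bar> < e \<Longrightarrow> vector [u ^ 2, u ^ 3, u ^ 4] \<in> V \<and> \<Psi> (vector [u ^ 2, u ^ 3, u ^ 4]) = ?c u"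
    using cusp_curve_model[OF r sm c1 indep] by blast
  define m0 where "m0 u = (vector [u ^ 2, u ^ 3, u ^ 4] :: real ^ 3)" for u :: real
  have "isCont m0 0"
    unfolding isCont_def
  proof (rule vec_tendstoI)
    fix i :: 3
    have "\<exists>j. (\<lambda>u. m0 u $ i) = (\<lambda>u. u ^ j)"
      using exhaust_3[of i] by (auto simp: m0_def)
    then obtain j where j: "m0 u $ i = u ^ j" for u by meson
    show "((\<lambda>u. m0 u $ i) \<longlongrightarrow> m0 0 $ i) (at 0)"
      unfolding j by (intro tendsto_power tendsto_ident_at)
  qed
  moreover have "m0 0 = 0" by (simp add: m0_def vec_eq_iff forall_3)
  ultimately show ?thesis
    using V m J r same_germ_cusp[folded m0_def]
    by (intro curve_in_H3_locally_diffeomorphic[of "min r e" s0 J CH V \<Psi> m0] CH_isCont[OF s0])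
       (auto simp: m0_def)
qed

lemma height_derivative:
  assumes "s \<in> I"
  shows "(deriv ^^ i) (tangential_height \<gamma> v) s = lprod ((vderiv ^^ i) t s) v"
proof -
  have "(vderiv ^^ i) (\<lambda>s. lprod (t s) v) s = lprod ((vderiv ^^ i) t s) v"
    using iterated_vderiv_linear[OF open_I smooth_t lprod.bounded_linear_left assms] .
  then show ?thesis by (simp add: deriv_eq_vderiv tangential_height_def[abs_def])
qed

lemma slice_contact_Suc_iff:
  assumes s0: "s0 \<in> I" and c: "c = lprod (\<gamma> s0) v"
  shows "slice_contact \<gamma> v c (Suc j) s0 \<longleftrightarrow> A_singularity j (tangential_height \<gamma> v) s0"
proof -
  let ?h = "\<lambda>s. lprod (\<gamma> s) v - c"
  have "vderiv ?h s = tangential_height \<gamma> v s" if s: "s \<in> I" for s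
  proof (rule vderiv_eqI)
    have "((\<lambda>s. lprod (\<gamma> s) v) has_vector_derivative lprod (vderiv \<gamma> s) v) (at s)"
      by (rule bounded_linear.has_vector_derivative[OF lprod.bounded_linear_left vderiv_works[OF smooth_\<gamma> s]])
    then show "(?h has_vector_derivative tangential_height \<gamma> v s) (at s)"
      by (auto intro!: derivative_eq_intros simp: tangential_height_def tangent_vderiv)
  qed
  then have "(deriv ^^ Suc i) ?h s0 = (deriv ^^ i) (tangential_height \<gamma> v) s0" for i
    using vderiv_cong_open[OF open_I _ s0, of "vderiv ?h" "tangential_height \<gamma> v" i]
    by (simp only: deriv_eq_vderiv funpow_Suc_right o_apply)
  moreover have "?h s0 = 0" using c by simp
  moreover have "(\<forall>i\<le>Suc j. P i) \<longleftrightarrow> P 0 \<and> (\<forall>i\<le>j. P (Suc i))" for P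
    by (metis Suc_le_mono le0 not0_implies_Suc)
  ultimately show ?thesis
    unfolding slice_contact_def A_singularity_def by (simp del: funpow.simps add: funpow_0)
qed

end

section \<open>Contact with spacelike slices\<close>

theorem proposition3p7:
  fixes U :: "(real ^ 3) set" and X :: "real ^ 3 \<Rightarrow> real ^ 4"
    and n :: "real ^ 4 \<Rightarrow> real ^ 4"
    and I :: "real set" and \<beta> :: "real \<Rightarrow> real ^ 3" and \<gamma> :: "real \<Rightarrow> real ^ 4"
    and s0 \<theta>0 c :: real and v0 :: "real ^ 4"
  assumes "spacelike_hypersurface U X"
    and "future_unit_normal U X n"
    and "open I" and "is_interval I"
    and "unit_speed_curve U X I \<beta> \<gamma>"
    and "\<And>s. s \<in> I \<Longrightarrow> kg n \<gamma> s \<noteq> 0"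
    and "\<And>s. s \<in> I \<Longrightarrow> kn n \<gamma> s * tau2 n \<gamma> s + kg n \<gamma> s * taug n \<gamma> s \<noteq> 0"
    and "\<And>s. s \<in> I \<Longrightarrow> (kg n \<gamma> s)\<^sup>2 > (kn n \<gamma> s)\<^sup>2"
    and "\<exists>s\<in>I. rho n \<gamma> s \<noteq> 0"
    and "s0 \<in> I"
    and "v0 = hyperbolic_surface n \<gamma> s0 \<theta>0"
    and "c = lprod (\<gamma> s0) v0"
  shows "timelike v0 \<and>
    ((\<exists>k\<ge>3. slice_contact \<gamma> v0 c k s0) \<longleftrightarrow>
       (\<exists>k\<ge>2. A_singularity k (tangential_height \<gamma> v0) s0)) \<and>
    (slice_contact \<gamma> v0 c 3 s0 \<longrightarrow>
       (\<exists>d :: real ^ 3. d \<noteq> 0 \<and>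
          curve_locally_diffeomorphic H3 (hyperbolic_curve_domain n \<gamma> I) (hyperbolic_curve n \<gamma>) s0
            (span {d}))) \<and>
    (slice_contact \<gamma> v0 c 4 s0 \<longleftrightarrow> A_singularity 3 (tangential_height \<gamma> v0) s0) \<and>
    (slice_contact \<gamma> v0 c 4 s0 \<and> lambda0 n \<gamma> s0 \<noteq> 0 \<longrightarrow>
       curve_locally_diffeomorphic H3 (hyperbolic_curve_domain n \<gamma> I) (hyperbolic_curve n \<gamma>) s0
         cusp234)"
proof -
  interpret curve_in_hypersurface U X n I \<beta> \<gamma>
    using assms by unfold_locales auto
  note s0 = \<open>s0 \<in> I\<close> and v0 = \<open>v0 = hyperbolic_surface n \<gamma> s0 \<theta>0\<close>
  note contact = slice_contact_Suc_iff[OF s0 \<open>c = lprod (\<gamma> s0) v0\<close>]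
  have contact34: "slice_contact \<gamma> v0 c 3 s0 \<longleftrightarrow> A_singularity 2 (tangential_height \<gamma> v0) s0"
    "slice_contact \<gamma> v0 c 4 s0 \<longleftrightarrow> A_singularity 3 (tangential_height \<gamma> v0) s0"
    using contact[of 2] contact[of 3] by (simp_all add: numeral_eq_Suc)
  have unit: "lprod v0 v0 = -1"
    unfolding v0 by (rule surface_products(1)[OF s0])
  have "v0 \<noteq> 0"
  proof
    assume "v0 = 0"
    then have "lprod v0 v0 = 0" by (simp add: lprod.zero_left)
    then show False using unit by simp
  qed
  then have "timelike v0" using unit by (simp add: timelike_def)
  moreover have "(\<exists>k\<ge>3. slice_contact \<gamma> v0 c k s0) \<longleftrightarrow>
       (\<exists>k\<ge>2. A_singularity k (tangential_height \<gamma> v0) s0)"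
  proof
    assume "\<exists>k\<ge>3. slice_contact \<gamma> v0 c k s0"
    then obtain k where "k \<ge> 3" "slice_contact \<gamma> v0 c k s0" by blast
    then show "\<exists>k\<ge>2. A_singularity k (tangential_height \<gamma> v0) s0"
      using contact[of "k - 1"] by (intro exI[of _ "k - 1"]) auto
  next
    assume "\<exists>k\<ge>2. A_singularity k (tangential_height \<gamma> v0) s0"
    then obtain k where "k \<ge> 2" "A_singularity k (tangential_height \<gamma> v0) s0" by blast
    then show "\<exists>k\<ge>3. slice_contact \<gamma> v0 c k s0"
      using contact[of k] by (intro exI[of _ "Suc k"]) auto
  qed
  moreover have on_curve: "s0 \<in> hyperbolic_curve_domain n \<gamma> I \<and> hyperbolic_curve n \<gamma> s0 = v0"
    if "(deriv ^^ 2) (tangential_height \<gamma> v0) s0 = 0"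
  proof -
    have "(deriv ^^ 2) (tangential_height \<gamma> v0) s0 = lprod v0 (vderiv (vderiv (tangent \<gamma>)) s0)"
      unfolding height_derivative[OF s0] by (simp add: numeral_eq_Suc lprod_commute)
    then have "tanh_theta n \<gamma> s0 = tanh \<theta>0"
      using that third_derivative_orthogonal_iff[OF s0, of \<theta>0] v0 by simp
    then show ?thesis using CH_through[OF s0] v0 by simp
  qed
  have pair: "(deriv ^^ i) (tangential_height \<gamma> v0) s0 = pairing 0 i s0"
    if "hyperbolic_curve n \<gamma> s0 = v0" for i
    unfolding height_derivative[OF s0] using that by (simp add: pairing_def lprod_commute)
  have "\<exists>d :: real ^ 3. d \<noteq> 0 \<and>
      curve_locally_diffeomorphic H3 (hyperbolic_curve_domain n \<gamma> I) (hyperbolic_curve n \<gamma>) s0 (span {d})"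
    if "slice_contact \<gamma> v0 c 3 s0"
  proof -
    have A: "(deriv ^^ 2) (tangential_height \<gamma> v0) s0 = 0" "(deriv ^^ 3) (tangential_height \<gamma> v0) s0 \<noteq> 0"
      using that contact34(1) by (auto simp: A_singularity_def simp del: funpow.simps)
    show ?thesis
      using on_curve[OF A(1)] A(2) pair regular_point_line by simp
  qed
  moreover have
    "curve_locally_diffeomorphic H3 (hyperbolic_curve_domain n \<gamma> I) (hyperbolic_curve n \<gamma>) s0 cusp234"
    if "slice_contact \<gamma> v0 c 4 s0"
  proof -
    have A: "(deriv ^^ 2) (tangential_height \<gamma> v0) s0 = 0" "(deriv ^^ 3) (tangential_height \<gamma> v0) s0 = 0"
      "(deriv ^^ 4) (tangential_height \<gamma> v0) s0 \<noteq> 0"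
      using that contact34(2) by (auto simp: A_singularity_def simp del: funpow.simps)
    show ?thesis
      using on_curve[OF A(1)] A(2,3) pair singular_point_cusp by simp
  qed
  ultimately show ?thesis
    using contact34(2) by blast
qed

end
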